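(* Let $\{\lambda_k\}_{k\in\mathbb N^*}$ and $\{\gamma_k\}_{k\in\mathbb Z}$ be two sequences in $\mathbb C$ for which there is $N\in\mathbb N^*$ such that the following hold. For $\{\gamma_k\}_{k\in\mathbb Z}$: (i) for all $k,j\in\mathbb Z$, $\gamma_k\ne\gamma_j$ unless $j=k$; (ii) $\gamma_k=\beta+2k\pi i+\nu_k$ for all $|k|\ge N$, where $\beta\in\mathbb C$ and $\{\nu_k\}_{|k|\ge N}\in\ell^2$. For $\{\lambda_k\}_{k\in\mathbb N^*}$, there exist constants $A_0\ge0$, $B_0\ge\delta$ with $\delta>0$, and some $\epsilon>0$, such that: (i) for all $k,j\in\mathbb N^*$, $\lambda_k\ne\lambda_j$ unless $j=k$; (ii) $\frac{-\Re(\lambda_k)}{|\Im(\lambda_k)|}\ge\widehat c$ for some $\widehat c>0$ and all $k\ge N$; (iii) there exists some $r>1$ such that $|\lambda_k-\lambda_j|\ge\delta|k^r-j^r|$ for all $k\ne j$ with $k,j\ge N$; (iv) $\epsilon(A_0+B_0k^r)\le|\lambda_k|\le A_0+B_0k^r$ for all $k\ge N$ (with the same $r$). Assume also that the families are disjoint: $\{\gamma_k:k\in\mathbb Z\}\cap\{\lambda_k:k\in\mathbb N^*\}=\emptyset$. Then, for any time $T>1$, there exists a positive constant $C$ depending only on $T$ such that $$\int_0^T\Big|\sum_{k\in\mathbb N^*}a_ke^{\lambda_kt}+\sum_{k\in\mathbb Z}b_ke^{\gamma_kt}\Big|^2dt\ \ge\ C\Big(\sum_{k\in\mathbb N^*}|a_k|^2e^{2\Re(\lambda_k)T}+\sum_{k\in\mathbb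 Z}|b_k|^2\Big)$$ for all sequences $\{a_k\}_{k\in\mathbb N^*}$ and $\{b_k\}_{k\in\mathbb Z}$ in $\ell^2$.
   Context: $\mathbb N^*=\{1,2,3,\dots\}$. The sequences $\{\lambda_k\}$, $\{\gamma_k\}$ are fixed; "$C$ depending only on $T$" means in particular that $C$ does not depend on $\{a_k\}$, $\{b_k\}$. When $\Im(\lambda_k)=0$, condition (ii) on $\lambda_k$ is read as $-\Re(\lambda_k)\ge\widehat c\,|\Im(\lambda_k)|$. *)

theory Defs
  imports "HOL-Analysis.Analysis"
begin

definition ell2_on :: "'i set \<Rightarrow> ('i \<Rightarrow> complex) \<Rightarrow> bool" where
  "ell2_on I a \<longleftrightarrow> (\<lambda>k. (cmod (a k))\<^sup>2) summable_on I"

definition square_integrable :: "real \<Rightarrow> (real \<Rightarrow> complex) \<Rightarrow> bool" where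
  "square_integrable T f \<longleftrightarrow>
     f \<in> borel_measurable (lebesgue_on {0..T}) \<and>
     integrable (lebesgue_on {0..T}) (\<lambda>t. (cmod (f t))\<^sup>2)"

text \<open>
  For square-summable coefficients, a series of exponentials such as
  \<open>\<Sum>k. b k * exp (\<gamma> k * t)\<close> need not converge absolutely at any \<open>t\<close>; it denotes its
  (unconditional) sum in \<open>L\<^sup>2(0,T)\<close>. The function \<open>f\<close> below represents this sum and is
  determined up to a null set. When every \<open>u k\<close> is square integrable, as the exponentials
  are, all the integrals below are finite.
\<close>

definition has_L2_sum ::
    "real \<Rightarrow> ('i \<Rightarrow> real \<Rightarrow> complex) \<Rightarrow> 'i set \<Rightarrow> (real \<Rightarrow> complex) \<Rightarrow> bool" where
  "has_L2_sum T u I f \<longleftrightarrow>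
     square_integrable T f \<and>
     ((\<lambda>F. \<integral>t. (cmod (f t - (\<Sum>k\<in>F. u k t)))\<^sup>2 \<partial>lebesgue_on {0..T}) \<longlongrightarrow> 0)
       (finite_subsets_at_top I)"

end

theory Submission
  imports Defs "HOL-Real_Asymp.Real_Asymp"
begin

text \<open>
  Call a family of exponents \<open>e\<close> observable in time \<open>T\<close> if the energy over \<open>[0,T]\<close> of every finite
  exponential sum dominates the sum of \<open>|c i|\<^sup>2 exp (2 T Re (e i))\<close>, with one constant for all sums. Since
  \<open>Re (\<gamma> k)\<close> is bounded, the theorem is observability of the joint family, passed to the limit in
  \<open>L\<^sup>2\<close>; the limits exist by Riesz-Fischer, since the upper bound (Bessel's inequality) holds for both
  families.

  \<^bold>\<open>Parabolic exponents\<close> are observable in every positive time. The operator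
  \<open>u \<mapsto> u(\<cdot> + d) - exp (\<lambda> j d) u\<close> annihilates the \<open>j\<close>-th exponential and multiplies the \<open>k\<close>-th by
  \<open>exp (\<lambda> k d) - exp (\<lambda> j d)\<close>. Applying one such operator for each \<open>j \<noteq> k\<close>, with steps \<open>d\<close> of total length
  below the available time, leaves only the \<open>k\<close>-th term. As \<open>-Re (\<lambda> k)\<close> grows like \<open>k\<^sup>r\<close> with
  \<open>r > 1\<close>, the steps can be chosen so that the product of the multipliers has modulus at least
  \<open>exp (\<theta> Re (\<lambda> k)) k\<^bsup>-O(k)\<^esup>\<close> with \<open>\<theta>\<close> well below the available time, and a loss of \<open>k\<^bsup>O(k)\<^esup>\<close> is negligible
  against exponentials of \<open>k\<^sup>r\<close>.

  \<^bold>\<open>The two families together.\<close> The operator \<open>u \<mapsto> u(\<cdot> + 1) - exp \<beta> u\<close> annihilates the exact frequencies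
  \<open>\<beta> + 2 \<pi> i k\<close>, so it multiplies the hyperbolic coefficients by factors of size \<open>O(|\<nu> k|)\<close>, and
  the parabolic ones, for large \<open>k\<close>, by factors bounded away from \<open>0\<close>. This costs time \<open>1\<close>, and the remaining time \<open>T - 1 > 0\<close> suffices to observe the parabolic
  part. The hyperbolic part is then recovered on \<open>[T - 1, T]\<close> as the difference of the whole sum and the
  parabolic part: on an interval of length \<open>1\<close> the exact frequencies form an orthogonal system up to a
  bounded weight. The terms in \<open>\<nu>\<close> are absorbed when all indices are large (\<open>tail_observable\<close>).

  \<^bold>\<open>The finitely many remaining exponents\<close> are added one at a time, each at the cost of an arbitrarily
  small amount of time (\<open>observable_insert\<close>): subtracting from \<open>u\<close> the average of
  \<open>exp (- \<mu> s) u(\<cdot> + s)\<close> over a short interval annihilates \<open>exp (\<mu> t)\<close>, and its multipliers at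
  the other exponents are bounded away from \<open>0\<close>.
\<close>

section \<open>Exponential sums and their energy\<close>

definition exp_sum :: "('i \<Rightarrow> complex) \<Rightarrow> ('i \<Rightarrow> complex) \<Rightarrow> 'i set \<Rightarrow> real \<Rightarrow> complex" where
  "exp_sum e c F t = (\<Sum>i\<in>F. c i * exp (e i * of_real t))"

definition energy :: "(real \<Rightarrow> complex) \<Rightarrow> real \<Rightarrow> real \<Rightarrow> real" where
  "energy f p q = integral {p..q} (\<lambda>t. (cmod (f t))\<^sup>2)"

lemma continuous_on_exp_sum [continuous_intros]: "continuous_on S (exp_sum e c F)"
  unfolding exp_sum_def by (intro continuous_intros)

lemma exp_sum_shift:
  "exp_sum e c F (t + s) = exp_sum e (\<lambda>i. c i * exp (e i * of_real s)) F t"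
  unfolding exp_sum_def by (simp add: exp_add ring_distribs mult_ac)

lemma exp_sum_insert:
  assumes "finite F" "i \<notin> F"
  shows "exp_sum e c (insert i F) t = c i * exp (e i * of_real t) + exp_sum e c F t"
  unfolding exp_sum_def using assms by simp

lemma exp_sum_Un:
  assumes "finite F" "finite G" "F \<inter> G = {}"
  shows "exp_sum e c (F \<union> G) t = exp_sum e c F t + exp_sum e c G t"
  unfolding exp_sum_def using assms by (simp add: sum.union_disjoint)

lemma energy_integrable:
  fixes p q :: real
  assumes "continuous_on {p..q} f"
  shows "(\<lambda>t. (cmod (f t))\<^sup>2) integrable_on {p..q}"
  by (intro integrable_continuous_real continuous_intros assms)

lemma energy_nonneg: "0 \<le> energy f p q"
  unfolding energy_def
  by (cases "(\<lambda>t. (cmod (f t))\<^sup>2) integrable_on {p..q}")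
     (auto intro: integral_nonneg simp: not_integrable_integral)

lemma energy_cong:
  assumes "\<And>t. p \<le> t \<Longrightarrow> t \<le> q \<Longrightarrow> cmod (f t) = cmod (g t)"
  shows "energy f p q = energy g p q"
  unfolding energy_def by (rule integral_cong) (simp add: assms)

lemma energy_mono:
  assumes "continuous_on {p..q} f" "continuous_on {p..q} g"
    and "\<And>t. p \<le> t \<Longrightarrow> t \<le> q \<Longrightarrow> cmod (f t) \<le> cmod (g t)"
  shows "energy f p q \<le> energy g p q"
  unfolding energy_def
  by (intro integral_le energy_integrable assms) (simp add: assms power_mono)

lemma energy_le_const:
  assumes "continuous_on {p..q} f" "p \<le> q"
    and "\<And>t. p \<le> t \<Longrightarrow> t \<le> q \<Longrightarrow> (cmod (f t))\<^sup>2 \<le> K"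
  shows "energy f p q \<le> (q - p) * K"
proof -
  have "energy f p q \<le> integral {p..q} (\<lambda>_. K)"
    unfolding energy_def by (intro integral_le energy_integrable assms) (auto simp: assms)
  thus ?thesis using assms by simp
qed

lemma energy_ge_const:
  assumes "continuous_on {p..q} f" "p \<le> q"
    and "\<And>t. p \<le> t \<Longrightarrow> t \<le> q \<Longrightarrow> K \<le> (cmod (f t))\<^sup>2"
  shows "(q - p) * K \<le> energy f p q"
proof -
  have "integral {p..q} (\<lambda>_. K) \<le> energy f p q"
    unfolding energy_def by (intro integral_le energy_integrable assms) (auto simp: assms)
  thus ?thesis using assms by simp
qed

lemma energy_subset:
  assumes "continuous_on {p'..q'} f" "{p..q} \<subseteq> {p'..q'}"
  shows "energy f p q \<le> energy f p' q'"
  unfolding energy_def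
  by (intro integral_subset_le energy_integrable continuous_on_subset[OF assms(1)] assms(2)) auto

lemma energy_shift: "energy (\<lambda>t. f (t + s)) p q = energy f (p + s) (q + s)"
  using integral_shift_real_ivl[of "p + s" s "q + s" "\<lambda>t. (cmod (f t))\<^sup>2"]
  unfolding energy_def by simp

lemma energy_cmult: "energy (\<lambda>t. z * f t) p q = (cmod z)\<^sup>2 * energy f p q"
  unfolding energy_def by (simp add: norm_mult power_mult_distrib)

text \<open>
  Convexity of the square, with weights chosen so that equality holds for \<open>x = y\<close>.
\<close>

lemma sq_cmod_add_weighted:
  assumes "0 \<le> \<epsilon>"
  shows "(cmod (x + of_real \<epsilon> * y))\<^sup>2 \<le> (1 + \<epsilon>) * ((cmod x)\<^sup>2 + \<epsilon> * (cmod y)\<^sup>2)"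
proof -
  have "cmod (x + of_real \<epsilon> * y) \<le> cmod x + \<epsilon> * cmod y"
    using norm_triangle_ineq[of x "of_real \<epsilon> * y"] assms by (simp add: norm_mult)
  hence "(cmod (x + of_real \<epsilon> * y))\<^sup>2 \<le> (cmod x + \<epsilon> * cmod y)\<^sup>2"
    by (rule power_mono) simp
  also have "\<dots> = (1 + \<epsilon>) * ((cmod x)\<^sup>2 + \<epsilon> * (cmod y)\<^sup>2) - \<epsilon> * (cmod x - cmod y)\<^sup>2"
    by (simp add: power2_eq_square algebra_simps)
  also have "\<dots> \<le> (1 + \<epsilon>) * ((cmod x)\<^sup>2 + \<epsilon> * (cmod y)\<^sup>2)" using assms by simp
  finally show ?thesis .
qed

lemma sq_cmod_add: "(cmod (x + y))\<^sup>2 \<le> 2 * (cmod x)\<^sup>2 + 2 * (cmod y)\<^sup>2"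
  using sq_cmod_add_weighted[of 1 x y] by simp

lemma energy_add_weighted:
  assumes "continuous_on {p..q} f" "continuous_on {p..q} g" "0 \<le> \<epsilon>"
  shows "energy (\<lambda>t. f t + of_real \<epsilon> * g t) p q \<le> (1 + \<epsilon>) * (energy f p q + \<epsilon> * energy g p q)"
proof -
  have "energy (\<lambda>t. f t + of_real \<epsilon> * g t) p q
      \<le> integral {p..q} (\<lambda>t. (1 + \<epsilon>) * ((cmod (f t))\<^sup>2 + \<epsilon> * (cmod (g t))\<^sup>2))"
    unfolding energy_def
    by (intro integral_le integrable_continuous_real continuous_intros assms sq_cmod_add_weighted)
  also have "\<dots> = (1 + \<epsilon>) * (energy f p q + \<epsilon> * energy g p q)"
  proof -
    have "integral {p..q} (\<lambda>t. (cmod (f t))\<^sup>2 + \<epsilon> * (cmod (g t))\<^sup>2)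
        = integral {p..q} (\<lambda>t. (cmod (f t))\<^sup>2) + integral {p..q} (\<lambda>t. \<epsilon> * (cmod (g t))\<^sup>2)"
      by (intro integral_add integrable_on_mult_right energy_integrable assms)
    thus ?thesis unfolding energy_def by simp
  qed
  finally show ?thesis .
qed

lemma energy_add:
  assumes "continuous_on {p..q} f" "continuous_on {p..q} g"
  shows "energy (\<lambda>t. f t + g t) p q \<le> 2 * energy f p q + 2 * energy g p q"
  using energy_add_weighted[OF assms, of 1] by simp

lemma energy_diff:
  assumes "continuous_on {p..q} f" "continuous_on {p..q} g"
  shows "energy (\<lambda>t. f t - g t) p q \<le> 2 * energy f p q + 2 * energy g p q"
proof -
  have "energy (\<lambda>t. - g t) p q = energy g p q" by (rule energy_cong) simp
  thus ?thesis
    using energy_add[of p q f "\<lambda>t. - g t"] assms by (simp add: continuous_on_minus)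
qed

lemma sq_cmod_sum_le:
  "(cmod (\<Sum>i\<in>F. x i * y i))\<^sup>2 \<le> (\<Sum>i\<in>F. (cmod (x i))\<^sup>2) * (\<Sum>i\<in>F. (cmod (y i))\<^sup>2)"
proof -
  have "cmod (\<Sum>i\<in>F. x i * y i) \<le> (\<Sum>i\<in>F. cmod (x i) * cmod (y i))"
    using norm_sum[of "\<lambda>i. x i * y i" F] by (simp add: norm_mult)
  hence "(cmod (\<Sum>i\<in>F. x i * y i))\<^sup>2 \<le> (\<Sum>i\<in>F. cmod (x i) * cmod (y i))\<^sup>2"
    by (rule power_mono) simp
  also have "\<dots> \<le> (\<Sum>i\<in>F. (cmod (x i))\<^sup>2) * (\<Sum>i\<in>F. (cmod (y i))\<^sup>2)"
    by (rule Cauchy_Schwarz_ineq_sum)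
  finally show ?thesis .
qed

section \<open>Annihilating exponentials by differences\<close>

text \<open>
  The triangle inequality in \<open>L\<^sup>2\<close> with its sharp factor, which matters because the operator is
  iterated many times: with \<open>\<epsilon> = |z|\<close> the weighted inequality for squares yields exactly \<open>(1 + \<epsilon>)\<^sup>2\<close>.
\<close>

lemma energy_difference_operator:
  assumes "continuous_on UNIV u" "0 \<le> d"
  shows "energy (\<lambda>t. u (t + d) - z * u t) 0 (p - d) \<le> (1 + cmod z)\<^sup>2 * energy u 0 p"
proof -
  \<comment> \<open>writes the operator as \<open>u(t + d) + |z| w(t)\<close> with \<open>|w| \<le> |u|\<close>\<close>
  define w where "w = (\<lambda>t. - sgn z * u t)"
  have cu: "continuous_on S u" for S using assms(1) continuous_on_subset by blast
  have cs: "continuous_on S (\<lambda>t. u (t + d))" for S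
    by (rule continuous_on_compose2[OF assms(1)]) (auto intro!: continuous_intros)
  have cw: "continuous_on S w" for S unfolding w_def by (intro continuous_intros cu)
  have z: "z = sgn z * of_real (cmod z)"
    by (cases "z = 0") (auto simp: sgn_div_norm scaleR_conv_of_real)
  have 0: "energy (\<lambda>t. u (t + d) - z * u t) 0 (p - d)
        = energy (\<lambda>t. u (t + d) + of_real (cmod z) * w t) 0 (p - d)"
    by (rule energy_cong, subst z) (simp add: w_def mult_ac)
  have 1: "energy (\<lambda>t. u (t + d)) 0 (p - d) \<le> energy u 0 p"
    using energy_subset[OF cu, of d p 0 p] assms(2) by (simp add: energy_shift)
  have "energy w 0 (p - d) \<le> energy u 0 (p - d)"
    by (rule energy_mono[OF cw cu]) (auto simp: w_def norm_mult norm_sgn)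
  also have "\<dots> \<le> energy u 0 p"
    using energy_subset[OF cu, of 0 "p - d" 0 p] assms(2) by simp
  finally have 2: "energy w 0 (p - d) \<le> energy u 0 p" .
  have "energy (\<lambda>t. u (t + d) - z * u t) 0 (p - d)
     \<le> (1 + cmod z) * (energy (\<lambda>t. u (t + d)) 0 (p - d) + cmod z * energy w 0 (p - d))"
    unfolding 0 by (rule energy_add_weighted[OF cs cw]) simp
  also have "\<dots> \<le> (1 + cmod z) * (energy u 0 p + cmod z * energy u 0 p)"
    by (intro mult_left_mono add_mono 1 2) auto
  finally show ?thesis by (simp add: power2_eq_square algebra_simps)
qed

lemma energy_annihilate:
  assumes "finite G" "\<And>j. j \<in> G \<Longrightarrow> 0 \<le> d j"
  shows "energy (exp_sum e (\<lambda>i. c i * (\<Prod>j\<in>G. exp (e i * of_real (d j)) - exp (e j * of_real (d j)))) F)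
           0 (p - sum d G)
       \<le> (\<Prod>j\<in>G. (1 + exp (Re (e j) * d j))\<^sup>2) * energy (exp_sum e c F) 0 p"
  using assms
proof (induction G)
  case empty
  show ?case by simp
next
  case (insert k G)
  define c' where "c' = (\<lambda>i. c i * (\<Prod>j\<in>G. exp (e i * of_real (d j)) - exp (e j * of_real (d j))))"
  define z where "z = exp (e k * of_real (d k))"
  have *: "exp_sum e (\<lambda>i. c i * (\<Prod>j\<in>insert k G. exp (e i * of_real (d j)) - exp (e j * of_real (d j)))) F
     = (\<lambda>t. exp_sum e c' F (t + d k) - z * exp_sum e c' F t)"
    using insert.hyps unfolding exp_sum_shift
    by (simp add: fun_eq_iff exp_sum_def c'_def z_def sum_distrib_left sum_subtractf [symmetric]
        algebra_simps)
  have "energy (\<lambda>t. exp_sum e c' F (t + d k) - z * exp_sum e c' F t) 0 ((p - sum d G) - d k)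
      \<le> (1 + cmod z)\<^sup>2 * energy (exp_sum e c' F) 0 (p - sum d G)"
    by (rule energy_difference_operator) (use insert.prems in \<open>auto intro: continuous_intros\<close>)
  also have "\<dots> \<le> (1 + cmod z)\<^sup>2 * ((\<Prod>j\<in>G. (1 + exp (Re (e j) * d j))\<^sup>2) * energy (exp_sum e c F) 0 p)"
    using insert.IH insert.prems unfolding c'_def by (intro mult_left_mono) auto
  finally show ?case
    unfolding * using insert.hyps by (simp add: z_def algebra_simps)
qed

text \<open>
  Applied with all indices but \<open>k\<close>, the difference operators leave a single exponential.
\<close>

lemma energy_isolate:
  assumes "finite F" "k \<in> F" "\<And>j. j \<in> F \<Longrightarrow> 0 \<le> d j" "p + sum d (F - {k}) \<le> q"
  shows "(cmod (c k))\<^sup>2 * (\<Prod>j\<in>F - {k}. (cmod (exp (e k * of_real (d j)) - exp (e j * of_real (d j))))\<^sup>2)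
            * energy (\<lambda>t. exp (e k * of_real t)) 0 p
       \<le> (\<Prod>j\<in>F - {k}. (1 + exp (Re (e j) * d j))\<^sup>2) * energy (exp_sum e c F) 0 q"
proof -
  let ?m = "\<lambda>i. \<Prod>j\<in>F - {k}. exp (e i * of_real (d j)) - exp (e j * of_real (d j))"
  have "exp_sum e (\<lambda>i. c i * ?m i) F = (\<lambda>t. (c k * ?m k) * exp (e k * of_real t))"
  proof
    fix t
    have "?m i = 0" if "i \<in> F - {k}" for i
      by (rule prod_zero[OF _ bexI[OF _ that]]) (use assms(1) in auto)
    hence "(\<Sum>i\<in>F - {k}. c i * ?m i * exp (e i * of_real t)) = 0"
      by (intro sum.neutral) simp
    thus "exp_sum e (\<lambda>i. c i * ?m i) F t = (c k * ?m k) * exp (e k * of_real t)"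
      unfolding exp_sum_def by (subst sum.remove[OF assms(1,2)]) simp
  qed
  with energy_annihilate[of "F - {k}" d e c F q] assms
  have 1: "(cmod (c k * ?m k))\<^sup>2 * energy (\<lambda>t. exp (e k * of_real t)) 0 (q - sum d (F - {k}))
     \<le> (\<Prod>j\<in>F - {k}. (1 + exp (Re (e j) * d j))\<^sup>2) * energy (exp_sum e c F) 0 q"
    by (simp add: energy_cmult)
  have 2: "energy (\<lambda>t. exp (e k * of_real t)) 0 p \<le> energy (\<lambda>t. exp (e k * of_real t)) 0 (q - sum d (F - {k}))"
    by (rule energy_subset) (use assms in \<open>auto intro!: continuous_intros\<close>)
  have "(cmod (c k * ?m k))\<^sup>2 * energy (\<lambda>t. exp (e k * of_real t)) 0 p
     \<le> (cmod (c k * ?m k))\<^sup>2 * energy (\<lambda>t. exp (e k * of_real t)) 0 (q - sum d (F - {k}))"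
    by (rule mult_left_mono[OF 2]) simp
  with 1 show ?thesis
    by (simp add: norm_mult power_mult_distrib prod_norm [symmetric] prod_power_distrib)
qed

lemma cmod_one_minus_exp_ge:
  assumes "cmod v \<le> 1/4"
  shows "cmod v / 2 \<le> cmod (1 - exp v)"
proof -
  have "\<bar>Re v\<bar> \<le> 1/2" using abs_Re_le_cmod[of v] assms by linarith
  hence "exp \<bar>Re v\<bar> \<le> 2" using exp_half_le2 by (meson exp_le_cancel_iff order_trans)
  moreover have "cmod (exp v - (1 + v)) \<le> exp \<bar>Re v\<bar> * (cmod v)\<^sup>2"
    using Taylor_exp[of v 1] by (simp add: power2_eq_square)
  ultimately have "cmod (exp v - (1 + v)) \<le> 2 * (cmod v)\<^sup>2"
    using mult_right_mono[of "exp \<bar>Re v\<bar>" 2 "(cmod v)\<^sup>2"] by simp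
  also have "\<dots> \<le> cmod v / 2"
    using mult_left_mono[OF assms norm_ge_zero[of v]] by (simp add: power2_eq_square)
  finally have "cmod (exp v - (1 + v)) \<le> cmod v / 2" .
  moreover have "cmod v \<le> cmod (1 - exp v) + cmod (exp v - (1 + v))"
    using norm_triangle_ineq[of "1 - exp v" "exp v - (1 + v)"] by simp
  ultimately show ?thesis by linarith
qed

section \<open>Observability of parabolic exponents\<close>

text \<open>
  All but finitely many of the \<open>y j\<close> together sum to at most one half, and over these the product is at
  least one half by the Weierstrass inequality.
\<close>

lemma prod_one_minus_bounded_below:
  fixes y :: "nat \<Rightarrow> real"
  assumes "summable y" "\<And>j. 0 \<le> y j" "\<And>j. j \<in> A \<Longrightarrow> y j < 1"
  shows "\<exists>p>0. \<forall>G. finite G \<longrightarrow> G \<subseteq> A \<longrightarrow> p \<le> (\<Prod>j\<in>G. 1 - y j)"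
proof -
  obtain M where M: "\<And>n. norm (sum y {M..<n}) < 1/2"
    using assms(1) unfolding summable_Cauchy by (metis half_gt_zero_iff order_refl zero_less_one)
  define B where "B = A \<inter> {..<M}"
  define p where "p = (\<Prod>j\<in>B. 1 - y j)"
  have fB: "finite B" unfolding B_def by simp
  have p: "p > 0" unfolding p_def B_def by (intro prod_pos) (auto simp: assms(3))
  have "p / 2 \<le> (\<Prod>j\<in>G. 1 - y j)" if G: "finite G" "G \<subseteq> A" for G
  proof -
    have "p = (\<Prod>j\<in>G \<inter> B. 1 - y j) * (\<Prod>j\<in>B - G. 1 - y j)"
      unfolding p_def using fB by (subst prod.Int_Diff[where B = G]) (auto simp: Int_commute)
    also have "\<dots> \<le> (\<Prod>j\<in>G \<inter> B. 1 - y j) * 1"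
      using G by (intro mult_left_mono prod_le_1 prod_nonneg)
        (auto simp: assms B_def intro: less_imp_le)
    finally have 1: "p \<le> (\<Prod>j\<in>G \<inter> B. 1 - y j)" by simp
    obtain n where n: "\<And>j. j \<in> G \<Longrightarrow> j < n" using G(1) by (meson finite_nat_set_iff_bounded)
    have "sum y (G - B) \<le> sum y {M..<n}"
      using G n assms(2) by (intro sum_mono2) (auto simp: B_def)
    hence "sum y (G - B) \<le> 1/2" using M[of n] by (simp add: sum_nonneg assms(2))
    moreover have "1 - sum y (G - B) \<le> (\<Prod>j\<in>G - B. 1 - y j)"
      using G by (intro Weierstrass_prod_ineq) (auto simp: assms(2) intro!: less_imp_le[OF assms(3)])
    ultimately have 2: "1/2 \<le> (\<Prod>j\<in>G - B. 1 - y j)" by linarith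
    have "p * (1/2) \<le> (\<Prod>j\<in>G \<inter> B. 1 - y j) * (\<Prod>j\<in>G - B. 1 - y j)"
      using p 1 by (intro mult_mono 1 2) auto
    also have "\<dots> = (\<Prod>j\<in>G. 1 - y j)"
      using G by (subst (3) prod.Int_Diff[where B = B]) auto
    finally show ?thesis by simp
  qed
  thus ?thesis using p by (intro exI[of _ "p/2"]) auto
qed

lemma summable_exp_neg_powr:
  fixes \<eta> s :: real
  assumes "\<eta> > 0" "s > 0"
  shows "summable (\<lambda>j::nat. exp (- \<eta> * real j powr s))"
proof -
  have "(\<lambda>j::nat. exp (- \<eta> * real j powr s)) \<in> O(\<lambda>j. 1 / real j ^ 2)"
    using assms by real_asymp
  thus ?thesis
    by (rule summable_comparison_test_bigo[rotated]) (simp add: inverse_power_summable divide_inverse)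
qed

text \<open>
  The factor \<open>(M k)\<^bsup>K k\<^esup> = exp (K k ln (M k))\<close> is the loss caused by indices comparable to
  \<open>k\<close>; it is beaten by \<open>exp (- \<eta> k\<^sup>r)\<close> because \<open>r > 1\<close>.
\<close>

lemma summable_exp_neg_powr_times_power:
  fixes \<eta> r M :: real and K :: nat
  assumes "\<eta> > 0" "r > 1" "M > 0" "K > 0"
  shows "summable (\<lambda>k::nat. exp (- \<eta> * real k powr r) * (M * real k) ^ (K * k))"
proof -
  define c where "c = real K"
  have "c > 0" using assms unfolding c_def by simp
  hence "(\<lambda>k::nat. exp (- \<eta> * real k powr r) * exp (c * real k * ln (M * real k))) \<in> O(\<lambda>k. 1 / real k ^ 2)"
    using assms(1-3) by real_asymp
  hence "summable (\<lambda>k::nat. exp (- \<eta> * real k powr r) * exp (real K * real k * ln (M * real k)))"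
    unfolding c_def by (rule summable_comparison_test_bigo[rotated]) (simp add: inverse_power_summable divide_inverse)
  moreover have "exp (real K * real k * ln (M * real k)) = (M * real k) ^ (K * k)" if "k \<ge> 1" for k
    using that assms exp_of_nat_mult[of "K * k" "ln (M * real k)"] by simp
  ultimately show ?thesis
    by (subst (asm) summable_cong[of _ "\<lambda>k::nat. exp (- \<eta> * real k powr r) * (M * real k) ^ (K * k)"])
       (auto intro!: eventually_sequentiallyI[of 1])
qed

text \<open>
  For two exponents that may be close, or whose difference may be nearly imaginary, a fixed step \<open>\<sigma>\<close>
  could be resonant, that is \<open>(z - w) \<sigma>\<close> could be close to a multiple of \<open>2 \<pi> i\<close>. Shortening
  the step to \<open>1 / (4 |z - w|)\<close> where necessary keeps \<open>(z - w) d\<close> in the disc where \<open>exp v - 1\<close> is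
  comparable to \<open>v\<close>.
\<close>

lemma cmod_exp_diff_ge_near:
  fixes z w :: complex
  assumes "z \<noteq> w" "\<sigma> > 0"
  defines "d \<equiv> min \<sigma> (1 / (4 * cmod (z - w)))"
  shows "exp (Re z * d) * (min (\<sigma> * cmod (z - w)) (1/4) / 2)
     \<le> cmod (exp (z * of_real d) - exp (w * of_real d))"
proof -
  define v where "v = (w - z) * of_real d"
  have d: "d > 0" using assms by (simp add: d_def)
  have cv: "cmod v = min (\<sigma> * cmod (z - w)) (1/4)"
    using d assms(1) unfolding v_def norm_mult
    by (auto simp: d_def norm_minus_commute min_def field_simps)
  have "exp (z * of_real d) - exp (w * of_real d) = exp (z * of_real d) * (1 - exp v)"
    by (simp add: v_def algebra_simps exp_diff exp_minus field_simps)
  hence "cmod (exp (z * of_real d) - exp (w * of_real d)) = exp (Re z * d) * cmod (1 - exp v)"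
    by (simp add: norm_mult)
  moreover have "cmod v / 2 \<le> cmod (1 - exp v)"
    by (rule cmod_one_minus_exp_ge) (simp add: cv)
  ultimately show ?thesis using cv by simp
qed

text \<open>
  If \<open>w\<close> lies far to the left of \<open>z\<close>, resonance is impossible. The factor \<open>1 + exp (Re w d)\<close> is the
  norm of the difference operator that annihilates \<open>w\<close>; the ratio of multiplier and norm is
  at least \<open>exp (Re z d)\<close> up to the factor \<open>(1 - exp (- x d))\<^sup>2\<close>, and infinitely many factors of
  this kind have a positive product as soon as the terms \<open>exp (- x d)\<close> are summable.
\<close>

lemma cmod_exp_diff_ge_far:
  fixes z w :: complex
  assumes "d \<ge> 0" "0 \<le> x" "Re w \<le> Re z - x" "Re w \<le> - x"
  shows "(1 + exp (Re w * d)) * (exp (Re z * d) * (1 - exp (- x * d))\<^sup>2)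
     \<le> cmod (exp (z * of_real d) - exp (w * of_real d))"
proof -
  define y where "y = exp (- x * d)"
  have y: "0 \<le> y" "y \<le> 1" using assms by (auto simp: y_def)
  have "exp (Re w * d) \<le> y"
    using mult_right_mono[OF assms(4,1)] by (simp add: y_def)
  hence "(1 + exp (Re w * d)) * (1 - y)\<^sup>2 \<le> (1 + y) * (1 - y)\<^sup>2"
    by (intro mult_right_mono) auto
  also have "\<dots> = (1 - y) * (1 - y\<^sup>2)" by (simp add: power2_eq_square algebra_simps)
  also have "\<dots> \<le> (1 - y) * 1" using y by (intro mult_left_mono) auto
  finally have 1: "(1 + exp (Re w * d)) * (1 - y)\<^sup>2 \<le> 1 - y" by simp
  have "exp (Re w * d) \<le> exp (Re z * d) * y"
    using mult_right_mono[OF assms(3,1)] by (simp add: y_def exp_add [symmetric] algebra_simps)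
  hence "exp (Re z * d) * (1 - y) \<le> exp (Re z * d) - exp (Re w * d)" by (simp add: algebra_simps)
  also have "\<dots> \<le> cmod (exp (z * of_real d) - exp (w * of_real d))"
    using norm_triangle_ineq2[of "exp (z * of_real d)" "exp (w * of_real d)"] by simp
  finally have "exp (Re z * d) * (1 - y) \<le> cmod (exp (z * of_real d) - exp (w * of_real d))" .
  moreover have "exp (Re z * d) * ((1 + exp (Re w * d)) * (1 - y)\<^sup>2) \<le> exp (Re z * d) * (1 - y)"
    by (intro mult_left_mono 1) auto
  ultimately have "exp (Re z * d) * ((1 + exp (Re w * d)) * (1 - y)\<^sup>2)
     \<le> cmod (exp (z * of_real d) - exp (w * of_real d))" by (rule order_trans[rotated])
  thus ?thesis unfolding y_def by (simp only: mult.left_commute)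
qed

text \<open>
  Isolate the \<open>k\<close>-th term with steps of total length at most \<open>\<tau> / 4\<close>. For the \<open>K k\<close> indices
  \<open>j \<le> K k\<close> the steps have length at most \<open>\<sigma> / (K k)\<close>, and each such index costs a factor of order
  \<open>1 / k\<close>. For \<open>j > K k\<close>, where \<open>- Re (\<lambda> j) \<ge> 2 (- Re (\<lambda> k))\<close>, the steps are proportional to
  \<open>j\<^bsup>-s\<^esup>\<close> with \<open>1 < s < r\<close>: they are summable, while \<open>Re (\<lambda> j) d j\<close> is of order
  \<open>- j\<^bsup>r - s\<^esup>\<close>, so that these indices cost only a constant factor altogether.
\<close>

lemma parabolic_coefficient_bound:
  fixes lam :: "nat \<Rightarrow> complex" and r c1 c2 \<delta> \<tau> :: real
  assumes "r > 1" "c1 > 0" "\<delta> > 0" "\<tau> > 0" "N \<ge> 1"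
    and lower: "\<And>k. k \<ge> N \<Longrightarrow> c1 * real k powr r \<le> - Re (lam k)"
    and upper: "\<And>k. k \<ge> N \<Longrightarrow> - Re (lam k) \<le> c2 * real k powr r"
    and gap: "\<And>k j. k \<ge> N \<Longrightarrow> j \<ge> N \<Longrightarrow> k \<noteq> j \<Longrightarrow> \<delta> \<le> cmod (lam k - lam j)"
  obtains D M K where "D > 0" "M > 0" "K > (0::nat)"
    "\<And>F a k. finite F \<Longrightarrow> F \<subseteq> {N..} \<Longrightarrow> k \<in> F \<Longrightarrow> (cmod (a k) * exp (Re (lam k) * \<tau>))\<^sup>2
       \<le> D * energy (exp_sum lam a F) 0 \<tau>
           * (exp (- (c1 * \<tau> / 4) * real k powr r) * (M * real k) ^ (K * k))\<^sup>2"
proof -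
  \<comment> \<open>any exponent strictly between \<open>1\<close> and \<open>r\<close>\<close>
  define s where "s = (1 + r) / 2"
  have s: "s > 1" "r - s > 0" using assms by (auto simp: s_def)
  define S where "S = (\<Sum>j. real j powr (- s))"
  have sumS: "summable (\<lambda>j. real j powr (- s))" using s by (simp add: summable_real_powr_iff)
  have "0 < real 1 powr (- s)" by simp
  hence S: "S > 0" unfolding S_def by (intro suminf_pos2[OF sumS, of 1]) auto
  define \<sigma> where "\<sigma> = \<tau> / 8"
  have \<sigma>: "\<sigma> > 0" using assms by (simp add: \<sigma>_def)
  \<comment> \<open>the choice of \<open>K\<close> makes \<open>- Re (\<lambda> j)\<close> at least twice \<open>- Re (\<lambda> k)\<close> once \<open>j > K k\<close>\<close>
  obtain K where K: "K > 0" "2 * c2 \<le> c1 * real K powr r"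
  proof -
    have "filterlim (\<lambda>K::nat. c1 * real K powr r) at_top sequentially" using assms by real_asymp
    hence "eventually (\<lambda>K. 2 * c2 \<le> c1 * real K powr r \<and> K > 0) sequentially"
      by (intro eventually_conj eventually_gt_at_top) (auto simp: filterlim_at_top)
    thus ?thesis using that by (auto dest: eventually_happens)
  qed
  define \<eta> where "\<eta> = c1 * \<sigma> / (2 * S)"
  have \<eta>: "\<eta> > 0" using assms \<sigma> S by (simp add: \<eta>_def)
  define y where "y = (\<lambda>j. exp (- \<eta> * real j powr (r - s)))"
  obtain p0 where p0: "p0 > 0" "\<And>G. finite G \<Longrightarrow> G \<subseteq> {1..} \<Longrightarrow> p0 \<le> (\<Prod>j\<in>G. 1 - y j)"
    using prod_one_minus_bounded_below[of y "{1..}"] summable_exp_neg_powr[OF \<eta> s(2)] \<eta>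
    unfolding y_def by auto
  \<comment> \<open>large enough that \<open>4 / (M k)\<close> is at most each of \<open>\<sigma> \<delta> / (K k)\<close> and \<open>1 / 4\<close>\<close>
  define M where "M = 4 * real K / (\<delta> * \<sigma>) + 16"
  have M: "M \<ge> 16" "M > 0" using assms \<sigma> by (auto simp: M_def add_nonneg_pos)
  define D where "D = 2 / (\<tau> * p0 ^ 4)"
  have D: "D > 0" using assms p0 by (simp add: D_def)
  have main: "(cmod (a k) * exp (Re (lam k) * \<tau>))\<^sup>2
       \<le> D * energy (exp_sum lam a F) 0 \<tau> * (exp (- (c1 * \<tau> / 4) * real k powr r) * (M * real k) ^ (K * k))\<^sup>2"
    if F: "finite F" "F \<subseteq> {N..}" and k: "k \<in> F" for F a k
  proof -
    have kN: "k \<ge> N" "k \<ge> 1" using F k assms by auto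
    define \<sigma>' where "\<sigma>' = \<sigma> / real (K * k)"
    have \<sigma>': "\<sigma>' > 0" using \<sigma> K kN by (simp add: \<sigma>'_def)
    \<comment> \<open>at \<open>j = k\<close> the division by zero yields the step \<open>0\<close>, which is harmless\<close>
    define d where "d = (\<lambda>j. if j \<le> K * k then min \<sigma>' (1 / (4 * cmod (lam k - lam j)))
                        else \<sigma> / S * real j powr (- s))"
    have d: "d j \<ge> 0" for j using \<sigma> \<sigma>' S by (auto simp: d_def)
    \<comment> \<open>the loss at index \<open>j\<close>, apart from the factor \<open>exp (Re (\<lambda> k) d j)\<close>\<close>
    define \<rho> where "\<rho> = (\<lambda>j. if j \<le> K * k then 1 / (M * real k) else (1 - y j)\<^sup>2)"
    define B where "B = F - {k}"
    have B: "finite B" "B \<subseteq> {N..}" "B \<subseteq> {1..}" "k \<notin> B" using F k assms by (auto simp: B_def)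
    define near where "near = B \<inter> {..K * k}"
    have nearc: "card near \<le> K * k"
    proof -
      have "near \<subseteq> {1..K * k}" using B by (auto simp: near_def)
      from card_mono[OF _ this] show ?thesis by simp
    qed
    have sumd: "sum d B \<le> \<tau> / 4"
    proof -
      have "sum d near \<le> (\<Sum>j\<in>near. \<sigma>')" by (intro sum_mono) (auto simp: near_def d_def)
      also have "\<dots> \<le> real (K * k) * \<sigma>'" using nearc \<sigma>' by (simp del: of_nat_mult)
      also have "\<dots> = \<sigma>" using K kN by (simp add: \<sigma>'_def)
      finally have 1: "sum d near \<le> \<sigma>" .
      have "sum d (B - {..K * k}) = \<sigma> / S * (\<Sum>j\<in>B - {..K * k}. real j powr (- s))"
        unfolding sum_distrib_left by (intro sum.cong) (auto simp: d_def)
      also have "\<dots> \<le> \<sigma> / S * S"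
        unfolding S_def using B \<sigma> S unfolding S_def
        by (intro mult_left_mono sum_le_suminf[OF sumS]) auto
      finally have 2: "sum d (B - {..K * k}) \<le> \<sigma>" using S by simp
      have "sum d B = sum d near + sum d (B - {..K * k})"
        unfolding near_def using B by (intro sum.Int_Diff) auto
      thus ?thesis using 1 2 by (simp add: \<sigma>_def)
    qed
    have factor: "(1 + exp (Re (lam j) * d j)) * (exp (Re (lam k) * d j) * \<rho> j)
        \<le> cmod (exp (lam k * of_real (d j)) - exp (lam j * of_real (d j)))" if j: "j \<in> B" for j
    proof (cases "j \<le> K * k")
      case True
      have jj: "j \<ge> N" "j \<noteq> k" using j B by auto
      have gj: "\<delta> \<le> cmod (lam k - lam j)" using gap[OF kN(1) jj(1)] jj by auto
      have "Re (lam j) \<le> 0" using lower[OF jj(1)] assms by (smt (verit) powr_ge_zero mult_nonneg_nonneg)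
      hence "exp (Re (lam j) * d j) \<le> 1" using d[of j] by (simp add: mult_nonpos_nonneg)
      hence "(1 + exp (Re (lam j) * d j)) * (exp (Re (lam k) * d j) * \<rho> j)
         \<le> 2 * (exp (Re (lam k) * d j) * \<rho> j)"
        using M by (intro mult_right_mono) (auto simp: \<rho>_def)
      also have "\<dots> = exp (Re (lam k) * d j) * (2 / (M * real k))" using True by (simp add: \<rho>_def)
      also have "\<dots> \<le> exp (Re (lam k) * d j) * (min (\<sigma>' * cmod (lam k - lam j)) (1/4) / 2)"
      proof (intro mult_left_mono)
        have "16 * 1 \<le> M * real k" using M kN by (intro mult_mono) auto
        hence 1: "4 / (M * real k) \<le> 1/4" by (simp add: field_simps)
        have "4 * real K / (\<delta> * \<sigma>) \<le> M" by (simp add: M_def)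
        hence "4 * real K * real k \<le> M * real k * (\<delta> * \<sigma>)"
          using assms \<sigma> mult_right_mono[of "4 * real K" "M * (\<delta> * \<sigma>)" "real k"]
          by (simp add: field_simps)
        hence "4 / (M * real k) \<le> \<sigma>' * \<delta>"
          using M kN K unfolding \<sigma>'_def by (simp add: field_simps)
        also have "\<dots> \<le> \<sigma>' * cmod (lam k - lam j)" using gj \<sigma>' by simp
        finally show "2 / (M * real k) \<le> min (\<sigma>' * cmod (lam k - lam j)) (1/4) / 2"
          using 1 by simp
      qed auto
      also have "\<dots> \<le> cmod (exp (lam k * of_real (d j)) - exp (lam j * of_real (d j)))"
      proof -
        have "lam k \<noteq> lam j" using gj assms(3) by auto
        from cmod_exp_diff_ge_near[OF this \<sigma>'] True show ?thesis by (simp add: d_def)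
      qed
      finally show ?thesis .
    next
      case False
      have jj: "j \<ge> N" "j \<ge> 1" using j B by auto
      define x where "x = c1 * real j powr r / 2"
      have x: "x \<ge> 0" using assms by (simp add: x_def)
      have "- Re (lam k) \<le> c2 * real k powr r" by (rule upper[OF kN(1)])
      also have "\<dots> \<le> c1 * real K powr r / 2 * real k powr r"
        using K by (intro mult_right_mono) auto
      also have "\<dots> = c1 * real (K * k) powr r / 2" by (simp add: powr_mult)
      also have "\<dots> \<le> x" unfolding x_def using False assms
        by (intro divide_right_mono mult_left_mono powr_mono2) (auto simp del: of_nat_mult)
      finally have "- Re (lam k) \<le> x" .
      moreover have "2 * x \<le> - Re (lam j)" using lower[OF jj(1)] by (simp add: x_def)
      ultimately have "Re (lam j) \<le> Re (lam k) - x" "Re (lam j) \<le> - x" using x by auto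
      moreover have "exp (- x * d j) = y j"
        using False jj by (simp add: x_def y_def d_def \<eta>_def powr_diff powr_minus field_simps)
      ultimately show ?thesis
        using cmod_exp_diff_ge_far[of "d j" x "lam j" "lam k"] d x False by (simp add: \<rho>_def)
    qed
    define P where "P = (\<Prod>j\<in>B. 1 + exp (Re (lam j) * d j))"
    define Q where "Q = (\<Prod>j\<in>B. cmod (exp (lam k * of_real (d j)) - exp (lam j * of_real (d j))))"
    have P: "P > 0" unfolding P_def by (intro prod_pos) (auto simp: add_pos_pos)
    define L where "L = exp (Re (lam k) * (\<tau> / 4)) * ((1 / (M * real k)) ^ (K * k) * p0\<^sup>2)"
    have L: "L > 0" using M kN p0 by (simp add: L_def)
    have Rk: "Re (lam k) \<le> - c1 * real k powr r" using lower[OF kN(1)] by simp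
    hence Rk0: "Re (lam k) \<le> 0" using assms by (smt (verit) powr_ge_zero mult_nonneg_nonneg mult_minus_left)
    have "P * L \<le> Q"
    proof -
      have "L \<le> exp (Re (lam k) * sum d B) * (\<Prod>j\<in>B. \<rho> j)"
        unfolding L_def
      proof (intro mult_mono)
        show "exp (Re (lam k) * (\<tau> / 4)) \<le> exp (Re (lam k) * sum d B)"
          using mult_left_mono_neg[OF sumd Rk0] by simp
        have "16 * 1 \<le> M * real k" using M kN by (intro mult_mono) auto
        hence mk: "1 / (M * real k) \<le> 1" by simp
        have "(1 / (M * real k)) ^ (K * k) \<le> (1 / (M * real k)) ^ card near"
          using M by (intro power_decreasing nearc mk) auto
        also have "\<dots> = (\<Prod>j\<in>near. \<rho> j)"
          by (simp add: near_def \<rho>_def)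
        finally have 1: "(1 / (M * real k)) ^ (K * k) \<le> (\<Prod>j\<in>near. \<rho> j)" .
        have "p0\<^sup>2 \<le> (\<Prod>j\<in>B - {..K * k}. 1 - y j)\<^sup>2"
          using p0 B by (intro power_mono) auto
        also have "\<dots> = (\<Prod>j\<in>B - {..K * k}. \<rho> j)"
          unfolding prod_power_distrib by (intro prod.cong) (auto simp: \<rho>_def)
        finally have 2: "p0\<^sup>2 \<le> (\<Prod>j\<in>B - {..K * k}. \<rho> j)" .
        have "(1 / (M * real k)) ^ (K * k) * p0\<^sup>2 \<le> (\<Prod>j\<in>near. \<rho> j) * (\<Prod>j\<in>B - {..K * k}. \<rho> j)"
          using M by (intro mult_mono 1 2 prod_nonneg) (auto simp: \<rho>_def)
        also have "\<dots> = (\<Prod>j\<in>B. \<rho> j)"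
          unfolding near_def using B by (intro prod.Int_Diff [symmetric]) auto
        finally show "(1 / (M * real k)) ^ (K * k) * p0\<^sup>2 \<le> (\<Prod>j\<in>B. \<rho> j)" .
      qed (use M p0 in auto)
      hence "P * L \<le> P * (exp (Re (lam k) * sum d B) * (\<Prod>j\<in>B. \<rho> j))"
        using P by simp
      also have "\<dots> = (\<Prod>j\<in>B. (1 + exp (Re (lam j) * d j)) * (exp (Re (lam k) * d j) * \<rho> j))"
        using B by (simp add: P_def prod.distrib sum_distrib_left exp_sum)
      also have "\<dots> \<le> Q"
        unfolding Q_def using M by (intro prod_mono conjI factor) (auto simp: \<rho>_def add_nonneg_nonneg)
      finally show ?thesis .
    qed
    define E where "E = energy (\<lambda>t. exp (lam k * of_real t)) 0 (\<tau> / 2)"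
    have E: "\<tau> / 2 * exp (Re (lam k) * \<tau>) \<le> E"
    proof -
      have "(\<tau> / 2 - 0) * exp (Re (lam k) * \<tau>) \<le> E"
        unfolding E_def
      proof (rule energy_ge_const)
        fix t assume "0 \<le> t" "t \<le> \<tau> / 2"
        hence "Re (lam k) * \<tau> \<le> Re (lam k) * (2 * t)" using Rk0 by (intro mult_left_mono_neg) auto
        thus "exp (Re (lam k) * \<tau>) \<le> (cmod (exp (lam k * complex_of_real t)))\<^sup>2"
          by (simp add: exp_double [symmetric] mult_ac)
      qed (use assms in \<open>auto intro!: continuous_intros\<close>)
      thus ?thesis by simp
    qed
    define U where "U = energy (exp_sum lam a F) 0 \<tau>"
    have U: "U \<ge> 0" unfolding U_def by (rule energy_nonneg)
    have "(cmod (a k))\<^sup>2 * Q\<^sup>2 * E \<le> P\<^sup>2 * U"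
      using energy_isolate[of F k d "\<tau> / 2" \<tau> a lam] F k d sumd assms
      unfolding U_def E_def P_def Q_def B_def by (simp add: prod_power_distrib)
    moreover have "(cmod (a k))\<^sup>2 * (P * L)\<^sup>2 * (\<tau> / 2 * exp (Re (lam k) * \<tau>)) \<le> (cmod (a k))\<^sup>2 * Q\<^sup>2 * E"
      using \<open>P * L \<le> Q\<close> P L assms by (intro mult_mono power_mono E order.refl) auto
    ultimately have "P\<^sup>2 * ((cmod (a k))\<^sup>2 * L\<^sup>2 * (\<tau> / 2 * exp (Re (lam k) * \<tau>))) \<le> P\<^sup>2 * U"
      by (simp add: power_mult_distrib mult_ac)
    hence fin: "(cmod (a k))\<^sup>2 * L\<^sup>2 * (\<tau> / 2 * exp (Re (lam k) * \<tau>)) \<le> U"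
      using P by (simp add: mult_le_cancel_left_pos)
    define m where "m = (M * real k) ^ (K * k)"
    have m: "m > 0" using M kN by (simp add: m_def)
    have Lm: "L\<^sup>2 = exp (Re (lam k) * (\<tau> / 2)) * p0 ^ 4 / m\<^sup>2"
      using M kN
      by (simp add: L_def m_def power_mult_distrib power_divide exp_double [symmetric] field_simps)
    have "(cmod (a k) * exp (Re (lam k) * \<tau>))\<^sup>2
        = ((cmod (a k))\<^sup>2 * L\<^sup>2 * (\<tau> / 2 * exp (Re (lam k) * \<tau>))) * (D * (exp (Re (lam k) * (\<tau> / 2)) * m\<^sup>2))"
    proof -
      have "exp (Re (lam k) * \<tau>) = exp (Re (lam k) * (\<tau> / 2)) * exp (Re (lam k) * (\<tau> / 2))"
        by (simp add: exp_add [symmetric])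
      thus ?thesis using m p0 assms unfolding Lm D_def
        by (simp add: power_mult_distrib power2_eq_square field_simps)
    qed
    also have "\<dots> \<le> U * (D * ((exp (- (c1 * \<tau> / 4) * real k powr r))\<^sup>2 * m\<^sup>2))"
    proof (intro mult_mono fin)
      have "Re (lam k) * (\<tau> / 2) \<le> (- c1 * real k powr r) * (\<tau> / 2)"
        using Rk assms by (intro mult_right_mono) auto
      also have "\<dots> = 2 * (- (c1 * \<tau> / 4) * real k powr r)" by simp
      finally show "exp (Re (lam k) * (\<tau> / 2)) \<le> (exp (- (c1 * \<tau> / 4) * real k powr r))\<^sup>2"
        unfolding exp_double [symmetric] by simp
    qed (use D U in auto)
    finally show ?thesis by (simp add: U_def m_def power_mult_distrib mult_ac)
  qed
  show ?thesis by (rule that[OF D M(2) K(1) main])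
qed

text \<open>
  Observability in every time \<open>\<tau> > 0\<close>, in the stronger form where the weighted coefficients are
  summed rather than their squares. It also bounds the sum pointwise at times later than \<open>\<tau>\<close>.
\<close>

lemma parabolic_observability:
  fixes lam :: "nat \<Rightarrow> complex" and r c1 c2 \<delta> \<tau> :: real
  assumes "r > 1" "c1 > 0" "\<delta> > 0" "\<tau> > 0" "N \<ge> 1"
    and "\<And>k. k \<ge> N \<Longrightarrow> c1 * real k powr r \<le> - Re (lam k)"
    and "\<And>k. k \<ge> N \<Longrightarrow> - Re (lam k) \<le> c2 * real k powr r"
    and "\<And>k j. k \<ge> N \<Longrightarrow> j \<ge> N \<Longrightarrow> k \<noteq> j \<Longrightarrow> \<delta> \<le> cmod (lam k - lam j)"
  shows "\<exists>C>0. \<forall>F a. finite F \<longrightarrow> F \<subseteq> {N..} \<longrightarrow>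
     (\<Sum>k\<in>F. cmod (a k) * exp (Re (lam k) * \<tau>))\<^sup>2 \<le> C * energy (exp_sum lam a F) 0 \<tau>"
proof (rule parabolic_coefficient_bound[of r c1 \<delta> \<tau> N lam c2])
  fix D M K
  assume D: "D > 0" "M > 0" "K > (0::nat)" and
    coef: "\<And>F a k. finite F \<Longrightarrow> F \<subseteq> {N..} \<Longrightarrow> k \<in> F \<Longrightarrow>
      (cmod (a k) * exp (Re (lam k) * \<tau>))\<^sup>2
       \<le> D * energy (exp_sum lam a F) 0 \<tau>
           * (exp (- (c1 * \<tau> / 4) * real k powr r) * (M * real k) ^ (K * k))\<^sup>2"
  define w where "w = (\<lambda>k. exp (- (c1 * \<tau> / 4) * real k powr r) * (M * real k) ^ (K * k))"
  have w: "summable w" "\<And>k. w k \<ge> 0"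
    using summable_exp_neg_powr_times_power[of "c1 * \<tau> / 4" r M K] assms D by (auto simp: w_def)
  define W where "W = suminf w"
  have W: "W \<ge> 0" unfolding W_def by (rule suminf_nonneg[OF w])
  have "(\<Sum>k\<in>F. cmod (a k) * exp (Re (lam k) * \<tau>))\<^sup>2 \<le> (D * (W + 1)\<^sup>2) * energy (exp_sum lam a F) 0 \<tau>"
    if F: "finite F" "F \<subseteq> {N..}" for F a
  proof -
    define U where "U = energy (exp_sum lam a F) 0 \<tau>"
    have U: "U \<ge> 0" unfolding U_def by (rule energy_nonneg)
    have "cmod (a k) * exp (Re (lam k) * \<tau>) \<le> sqrt (D * U) * w k" if "k \<in> F" for k
    proof (rule power2_le_imp_le)
      show "(cmod (a k) * exp (Re (lam k) * \<tau>))\<^sup>2 \<le> (sqrt (D * U) * w k)\<^sup>2"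
        using coef[OF F that, of a] D U by (simp add: power_mult_distrib U_def w_def)
    qed (use w D U in auto)
    hence "(\<Sum>k\<in>F. cmod (a k) * exp (Re (lam k) * \<tau>)) \<le> sqrt (D * U) * (\<Sum>k\<in>F. w k)"
      unfolding sum_distrib_left by (rule sum_mono)
    also have "\<dots> \<le> sqrt (D * U) * (W + 1)"
      using sum_le_suminf[OF w(1) F(1)] w D U by (intro mult_left_mono) (auto simp: W_def)
    finally have "(\<Sum>k\<in>F. cmod (a k) * exp (Re (lam k) * \<tau>))\<^sup>2 \<le> (sqrt (D * U) * (W + 1))\<^sup>2"
      by (intro power_mono sum_nonneg) auto
    also have "\<dots> = (D * (W + 1)\<^sup>2) * U" using D U by (simp add: power_mult_distrib)
    finally show ?thesis unfolding U_def .
  qed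
  thus ?thesis using D W by (intro exI[of _ "D * (W + 1)\<^sup>2"]) auto
qed (fact assms)+

section \<open>Observability and Bessel inequalities for families of exponents\<close>

text \<open>
  The weight \<open>exp (2 T Re (e i))\<close> is the one natural for dissipative exponentials. For exponents in a
  vertical strip it is equivalent to \<open>1\<close>, so one notion serves both families.
\<close>

definition observable :: "('i \<Rightarrow> complex) \<Rightarrow> 'i set \<Rightarrow> real \<Rightarrow> bool" where
  "observable e I T \<longleftrightarrow> (\<exists>C>0. \<forall>F c. finite F \<longrightarrow> F \<subseteq> I \<longrightarrow>
     C * (\<Sum>i\<in>F. (cmod (c i))\<^sup>2 * exp (2 * Re (e i) * T)) \<le> energy (exp_sum e c F) 0 T)"

definition bessel :: "('i \<Rightarrow> complex) \<Rightarrow> 'i set \<Rightarrow> real \<Rightarrow> bool" where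
  "bessel e I T \<longleftrightarrow> (\<exists>K\<ge>0. \<forall>F c. finite F \<longrightarrow> F \<subseteq> I \<longrightarrow>
     energy (exp_sum e c F) 0 T \<le> K * (\<Sum>i\<in>F. (cmod (c i))\<^sup>2))"

lemma bessel_subset: "bessel e I T \<Longrightarrow> J \<subseteq> I \<Longrightarrow> bessel e J T"
  unfolding bessel_def by (meson subset_trans)

lemma bessel_singleton: "bessel e {i} T"
  unfolding bessel_def
proof (intro exI[of _ "energy (\<lambda>t. exp (e i * of_real t)) 0 T"] conjI allI impI energy_nonneg)
  fix F c assume "finite F" "F \<subseteq> {i}"
  then consider "F = {}" | "F = {i}" by blast
  thus "energy (exp_sum e c F) 0 T \<le> energy (\<lambda>t. exp (e i * of_real t)) 0 T * (\<Sum>i\<in>F. (cmod (c i))\<^sup>2)"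
  proof cases
    case 1
    thus ?thesis by (simp add: exp_sum_def energy_def)
  next
    case 2
    hence "exp_sum e c F = (\<lambda>t. c i * exp (e i * of_real t))" by (simp add: exp_sum_def fun_eq_iff)
    thus ?thesis using 2 by (simp only: energy_cmult) (simp add: mult.commute)
  qed
qed

lemma bessel_Un:
  assumes "bessel e I T" "bessel e J T"
  shows "bessel e (I \<union> J) T"
proof -
  obtain K where K: "K \<ge> 0" "\<And>F c. finite F \<Longrightarrow> F \<subseteq> I \<Longrightarrow>
      energy (exp_sum e c F) 0 T \<le> K * (\<Sum>i\<in>F. (cmod (c i))\<^sup>2)"
    using assms(1) unfolding bessel_def by blast
  obtain L where L: "L \<ge> 0" "\<And>F c. finite F \<Longrightarrow> F \<subseteq> J \<Longrightarrow>
      energy (exp_sum e c F) 0 T \<le> L * (\<Sum>i\<in>F. (cmod (c i))\<^sup>2)"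
    using assms(2) unfolding bessel_def by blast
  have "energy (exp_sum e c F) 0 T \<le> (2 * K + 2 * L) * (\<Sum>i\<in>F. (cmod (c i))\<^sup>2)"
    if F: "finite F" "F \<subseteq> I \<union> J" for F c
  proof -
    have "exp_sum e c F = (\<lambda>t. exp_sum e c (F \<inter> I) t + exp_sum e c (F - I) t)"
      using exp_sum_Un[of "F \<inter> I" "F - I" e c] F(1) by (auto simp: Int_Diff_Un Int_Diff_disjoint)
    hence "energy (exp_sum e c F) 0 T \<le> 2 * energy (exp_sum e c (F \<inter> I)) 0 T + 2 * energy (exp_sum e c (F - I)) 0 T"
      by (simp add: energy_add continuous_on_exp_sum)
    also have "\<dots> \<le> 2 * (K * (\<Sum>i\<in>F. (cmod (c i))\<^sup>2)) + 2 * (L * (\<Sum>i\<in>F. (cmod (c i))\<^sup>2))"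
    proof (intro add_mono mult_left_mono)
      have "energy (exp_sum e c (F \<inter> I)) 0 T \<le> K * (\<Sum>i\<in>F \<inter> I. (cmod (c i))\<^sup>2)"
        using F by (intro K) auto
      also have "\<dots> \<le> K * (\<Sum>i\<in>F. (cmod (c i))\<^sup>2)"
        using F K by (intro mult_left_mono sum_mono2) auto
      finally show "energy (exp_sum e c (F \<inter> I)) 0 T \<le> K * (\<Sum>i\<in>F. (cmod (c i))\<^sup>2)" .
      have "energy (exp_sum e c (F - I)) 0 T \<le> L * (\<Sum>i\<in>F - I. (cmod (c i))\<^sup>2)"
        using F by (intro L) auto
      also have "\<dots> \<le> L * (\<Sum>i\<in>F. (cmod (c i))\<^sup>2)"
        using F L by (intro mult_left_mono sum_mono2) auto
      finally show "energy (exp_sum e c (F - I)) 0 T \<le> L * (\<Sum>i\<in>F. (cmod (c i))\<^sup>2)" .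
    qed auto
    finally show ?thesis by (simp add: algebra_simps)
  qed
  thus ?thesis unfolding bessel_def using K(1) L(1) by (intro exI[of _ "2 * K + 2 * L"]) auto
qed

lemma bessel_finite: "finite I \<Longrightarrow> bessel e I T"
proof (induction I rule: finite_induct)
  case empty
  show ?case by (rule bessel_subset[OF bessel_singleton]) auto
next
  case (insert i I)
  show ?case using bessel_Un[OF bessel_singleton insert.IH] by simp
qed

lemma bessel_reindex:
  assumes "bessel (\<lambda>k. e (h k)) A T" "inj_on h A"
  shows "bessel e (h ` A) T"
proof -
  obtain K where K: "K \<ge> 0" "\<And>F c. finite F \<Longrightarrow> F \<subseteq> A \<Longrightarrow>
      energy (exp_sum (\<lambda>k. e (h k)) c F) 0 T \<le> K * (\<Sum>i\<in>F. (cmod (c i))\<^sup>2)"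
    using assms(1) unfolding bessel_def by blast
  have "energy (exp_sum e c F) 0 T \<le> K * (\<Sum>i\<in>F. (cmod (c i))\<^sup>2)" if F: "finite F" "F \<subseteq> h ` A" for F c
  proof -
    obtain G where G: "G \<subseteq> A" "finite G" "F = h ` G" using finite_subset_image[OF F] by blast
    have "inj_on h G" using assms(2) G inj_on_subset by blast
    hence "exp_sum e c (h ` G) = exp_sum (\<lambda>k. e (h k)) (\<lambda>k. c (h k)) G"
      and "(\<Sum>i\<in>h ` G. (cmod (c i))\<^sup>2) = (\<Sum>k\<in>G. (cmod (c (h k)))\<^sup>2)"
      by (simp_all add: fun_eq_iff exp_sum_def sum.reindex)
    thus ?thesis using K(2)[OF G(2,1), of "\<lambda>k. c (h k)"] unfolding G(3) by simp
  qed
  thus ?thesis using K(1) unfolding bessel_def by blast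
qed

section \<open>Adding finitely many exponents\<close>

text \<open>
  The averaging operator that annihilates \<open>exp (\<mu> t)\<close> has multiplier \<open>1 - (exp w - 1) / w\<close> at
  \<open>w = (z - \<mu>) h\<close>. The bound on \<open>Re w\<close> excludes its nonzero roots: with \<open>w = x + i y\<close> a root satisfies
  \<open>|y| = exp x |sin y| < 2\<close>, and if \<open>y \<noteq> 0\<close> then
  \<open>x \<ge> 0\<close> and \<open>|y| \<le> |tan y| = |y| / (1 + x)\<close>, which forces \<open>x = 0\<close> and \<open>sin y = y\<close>.
\<close>

lemma exp_neq_one_plus:
  fixes w :: complex
  assumes "w \<noteq> 0" "Re w < ln 2"
  shows "exp w \<noteq> 1 + w"
proof
  assume eq: "exp w = 1 + w"
  define x y where "x = Re w" and "y = Im w"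
  have 1: "exp x * cos y = 1 + x" "exp x * sin y = y"
    using arg_cong[OF eq, of Re] arg_cong[OF eq, of Im] by (simp_all add: x_def y_def Re_exp Im_exp)
  have ex: "exp x < 2" using assms(2) by (metis exp_less_mono exp_ln x_def zero_less_numeral)
  have ya: "\<bar>y\<bar> = exp x * \<bar>sin y\<bar>" using 1(2) by (metis abs_exp_cancel abs_mult)
  have "y = 0"
  proof (rule ccontr)
    assume y: "y \<noteq> 0"
    have "\<bar>y\<bar> \<le> exp x * 1" unfolding ya by (rule mult_left_mono) (auto simp: ya[symmetric])
    hence y2: "\<bar>y\<bar> < 2" using ex by simp
    have "1 * \<bar>y\<bar> \<le> exp x * \<bar>y\<bar>"
      using mult_left_mono[OF abs_sin_x_le_abs_x[of y], of "exp x"] ya by simp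
    hence "1 \<le> exp x" using y by (simp add: mult_le_cancel_right)
    hence x0: "x \<ge> 0" by simp
    hence cp: "cos y > 0" using 1(1) by (smt (verit) exp_gt_zero zero_less_mult_pos)
    have "\<bar>y\<bar> < pi / 2"
    proof (rule ccontr)
      assume "\<not> \<bar>y\<bar> < pi / 2"
      hence "cos \<bar>y\<bar> \<le> cos (pi / 2)" using y2 pi_gt3 by (intro cos_monotone_0_pi_le) auto
      thus False using cp by (simp add: abs_if split: if_splits)
    qed
    hence "\<bar>y\<bar> \<le> \<bar>tan y\<bar>" by (rule abs_tan_ge)
    also have "\<bar>tan y\<bar> = \<bar>sin y\<bar> / cos y" using cp by (simp add: tan_def)
    finally have "\<bar>y\<bar> * cos y \<le> \<bar>sin y\<bar>" using cp by (simp add: field_simps)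
    hence "exp x * (\<bar>y\<bar> * cos y) \<le> \<bar>y\<bar>" unfolding ya[symmetric] using ya
      by (metis exp_ge_zero mult_left_mono)
    hence "\<bar>y\<bar> * (1 + x) \<le> \<bar>y\<bar> * 1" by (subst 1(1) [symmetric]) (simp add: mult_ac)
    hence "x = 0" using y x0 by (auto simp: mult_le_cancel_left)
    hence "cos y = 1" "sin y = y" using 1 by auto
    thus False using y sin_cos_squared_add[of y] by simp
  qed
  hence "ln (exp x) = exp x - 1" unfolding ln_exp using 1 by simp
  hence "exp x = 1" by (intro ln_eq_minus_one) auto
  hence "x = 0" by simp
  thus False using \<open>y = 0\<close> assms(1) by (simp add: complex_eq_iff x_def y_def)
qed

lemma has_integral_exp_interval:
  fixes w :: complex
  assumes "w \<noteq> 0" "0 \<le> h"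
  shows "((\<lambda>s. exp (w * of_real s)) has_integral ((exp (w * of_real h) - 1) / w)) {0..h}"
proof -
  have "((\<lambda>s. exp (w * of_real s)) has_integral (exp (w * of_real h) / w - exp (w * of_real 0) / w)) {0..h}"
  proof (rule fundamental_theorem_of_calculus)
    fix s assume "s \<in> {0..h}"
    have "((\<lambda>x. exp (w * x) / w) has_field_derivative exp (w * of_real s)) (at (of_real s))"
      using assms by (auto intro!: derivative_eq_intros)
    thus "((\<lambda>s. exp (w * complex_of_real s) / w) has_vector_derivative exp (w * complex_of_real s)) (at s within {0..h})"
      by (rule has_vector_derivative_real_field)
  qed fact
  thus ?thesis by (simp add: diff_divide_distrib)
qed

lemma sq_integral_le:
  fixes f :: "real \<Rightarrow> real"
  assumes "continuous_on {0..h} f" "h > 0"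
  shows "(integral {0..h} f)\<^sup>2 \<le> h * integral {0..h} (\<lambda>s. (f s)\<^sup>2)"
proof -
  \<comment> \<open>the mean value; the inequality expresses that the variance is nonnegative\<close>
  define q where "q = integral {0..h} f / h"
  have fi: "(f has_integral q * h) {0..h}"
    using integrable_continuous_real[OF assms(1)] assms(2) unfolding q_def
    by (simp add: has_integral_integral)
  have f2: "((\<lambda>s. (f s)\<^sup>2) has_integral integral {0..h} (\<lambda>s. (f s)\<^sup>2)) {0..h}"
    by (intro integrable_integral integrable_continuous_real continuous_intros assms(1))
  have "((\<lambda>s. (f s)\<^sup>2 - 2 * q * f s + q\<^sup>2) has_integral
      (integral {0..h} (\<lambda>s. (f s)\<^sup>2) - 2 * q * (q * h) + h * q\<^sup>2)) {0..h}"
    using has_integral_const_real[of "q\<^sup>2" 0 h] assms(2)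
    by (intro has_integral_add has_integral_diff has_integral_mult_right fi f2) auto
  moreover have "(\<lambda>s. (f s)\<^sup>2 - 2 * q * f s + q\<^sup>2) = (\<lambda>s. (f s - q)\<^sup>2)"
    by (simp add: power2_eq_square algebra_simps fun_eq_iff)
  ultimately have "0 \<le> integral {0..h} (\<lambda>s. (f s)\<^sup>2) - 2 * q * (q * h) + h * q\<^sup>2"
    by (metis (no_types, lifting) has_integral_nonneg zero_le_power2)
  hence "h * (h * q\<^sup>2) \<le> h * integral {0..h} (\<lambda>s. (f s)\<^sup>2)"
    using assms(2) by (intro mult_left_mono) (auto simp: power2_eq_square algebra_simps)
  thus ?thesis using assms(2) by (simp add: q_def power2_eq_square)
qed

text \<open>
  The Cauchy-Schwarz inequality on \<open>[0,h]\<close>.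
\<close>

lemma sq_cmod_average_le:
  assumes u: "continuous_on UNIV u" and h: "h > 0"
  shows "(cmod (integral {0..h} (\<lambda>s. exp (- (\<mu> * of_real s)) * u (t + s)) / of_real h))\<^sup>2
     \<le> (exp (\<bar>Re \<mu>\<bar> * h))\<^sup>2 / h * energy u t (t + h)"
proof -
  define Q where "Q = exp (\<bar>Re \<mu>\<bar> * h)"
  have cs: "continuous_on S (\<lambda>s. u (t + s))" for S
    by (rule continuous_on_compose2[OF u]) (auto intro!: continuous_intros)
  have "cmod (integral {0..h} (\<lambda>s. exp (- (\<mu> * of_real s)) * u (t + s)))
      \<le> integral {0..h} (\<lambda>s. Q * cmod (u (t + s)))"
  proof (rule integral_norm_bound_integral)
    fix s assume s: "s \<in> {0..h}"
    have "- (Re \<mu> * s) \<le> \<bar>Re \<mu>\<bar> * s" using s by (auto simp: abs_if mult_right_mono)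
    also have "\<dots> \<le> \<bar>Re \<mu>\<bar> * h" using s by (intro mult_left_mono) auto
    finally show "cmod (exp (- (\<mu> * of_real s)) * u (t + s)) \<le> Q * cmod (u (t + s))"
      unfolding norm_mult Q_def by (intro mult_right_mono) auto
  qed (auto intro!: integrable_continuous_interval continuous_intros cs)
  also have "\<dots> = Q * integral {0..h} (\<lambda>s. cmod (u (t + s)))" by simp
  finally have "(cmod (integral {0..h} (\<lambda>s. exp (- (\<mu> * of_real s)) * u (t + s))))\<^sup>2
      \<le> (Q * integral {0..h} (\<lambda>s. cmod (u (t + s))))\<^sup>2"
    by (rule power_mono) simp
  also have "\<dots> \<le> Q\<^sup>2 * (h * integral {0..h} (\<lambda>s. (cmod (u (t + s)))\<^sup>2))"
    unfolding power_mult_distrib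
    by (intro mult_left_mono sq_integral_le continuous_intros cs h) auto
  also have "integral {0..h} (\<lambda>s. (cmod (u (t + s)))\<^sup>2) = energy u t (t + h)"
    using energy_shift[of u t 0 h] by (simp add: energy_def add.commute)
  finally have "(cmod (integral {0..h} (\<lambda>s. exp (- (\<mu> * of_real s)) * u (t + s))))\<^sup>2 / h\<^sup>2
     \<le> Q\<^sup>2 * (h * energy u t (t + h)) / h\<^sup>2" by (rule divide_right_mono) simp
  thus ?thesis using h unfolding Q_def
    by (simp add: norm_divide power_divide power2_eq_square field_simps)
qed

lemma exp_sum_minus_average:
  assumes G: "finite G" "i0 \<notin> G" "\<And>i. i \<in> G \<Longrightarrow> e i \<noteq> e i0" and h: "h > 0"
  defines "m \<equiv> \<lambda>w. (exp w - 1) / w"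
  shows "exp_sum e c (insert i0 G) t
       - integral {0..h} (\<lambda>s. exp (- (e i0 * of_real s)) * exp_sum e c (insert i0 G) (t + s)) / of_real h
     = exp_sum e (\<lambda>i. c i * (1 - m ((e i - e i0) * of_real h))) G t"
proof -
  let ?\<mu> = "e i0"
  have "((\<lambda>s. c i0 * exp (?\<mu> * of_real t)
            + (\<Sum>i\<in>G. (c i * exp (e i * of_real t)) * exp ((e i - ?\<mu>) * of_real s)))
     has_integral (c i0 * exp (?\<mu> * of_real t) * of_real h
            + (\<Sum>i\<in>G. (c i * exp (e i * of_real t)) * ((exp ((e i - ?\<mu>) * of_real h) - 1) / (e i - ?\<mu>))))) {0..h}"
    using has_integral_const_real[of "c i0 * exp (?\<mu> * of_real t)" 0 h] h G
    by (intro has_integral_add has_integral_sum has_integral_mult_right has_integral_exp_interval)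
       (auto simp: scaleR_conv_of_real mult_ac)
  moreover have "(\<lambda>s. exp (- (?\<mu> * of_real s)) * exp_sum e c (insert i0 G) (t + s)) =
    (\<lambda>s. c i0 * exp (?\<mu> * of_real t)
            + (\<Sum>i\<in>G. (c i * exp (e i * of_real t)) * exp ((e i - ?\<mu>) * of_real s)))"
  proof
    fix s
    have *: "exp (- (?\<mu> * of_real s)) * (x * exp (z * of_real (t + s)))
        = x * exp (z * of_real t) * exp ((z - ?\<mu>) * of_real s)" for x z
      by (simp add: exp_add [symmetric] exp_diff exp_minus field_simps)
    have "exp (- (?\<mu> * of_real s)) * exp_sum e c (insert i0 G) (t + s)
       = (\<Sum>i\<in>insert i0 G. (c i * exp (e i * of_real t)) * exp ((e i - ?\<mu>) * of_real s))"
      unfolding exp_sum_def sum_distrib_left * ..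
    thus "exp (- (?\<mu> * of_real s)) * exp_sum e c (insert i0 G) (t + s) =
      c i0 * exp (?\<mu> * of_real t)
            + (\<Sum>i\<in>G. (c i * exp (e i * of_real t)) * exp ((e i - ?\<mu>) * of_real s))"
      using G by simp
  qed
  ultimately have "integral {0..h} (\<lambda>s. exp (- (?\<mu> * of_real s)) * exp_sum e c (insert i0 G) (t + s))
     = c i0 * exp (?\<mu> * of_real t) * of_real h
            + (\<Sum>i\<in>G. (c i * exp (e i * of_real t)) * ((exp ((e i - ?\<mu>) * of_real h) - 1) / (e i - ?\<mu>)))"
    by (simp add: integral_unique)
  hence "integral {0..h} (\<lambda>s. exp (- (?\<mu> * of_real s)) * exp_sum e c (insert i0 G) (t + s)) / of_real h
     = c i0 * exp (?\<mu> * of_real t)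
            + (\<Sum>i\<in>G. (c i * exp (e i * of_real t)) * m ((e i - ?\<mu>) * of_real h))"
    using h by (simp add: add_divide_distrib sum_divide_distrib m_def mult_ac)
  thus ?thesis
    unfolding exp_sum_insert[OF G(1,2)] unfolding exp_sum_def
    by (simp add: sum_subtractf [symmetric] algebra_simps)
qed

text \<open>
  The multiplier tends to \<open>1\<close> as \<open>|e i| \<rightarrow> \<infinity>\<close> with \<open>Re (e i)\<close> bounded above, so only finitely
  many indices could make it small, and for them it does not vanish.
\<close>

lemma averaging_multiplier_bounded_below:
  assumes Re: "\<And>i. i \<in> I \<Longrightarrow> (Re (e i) - Re \<mu>) * h < ln 2" and h: "h > 0"
    and fin: "\<And>R. finite {i \<in> I. cmod (e i) \<le> R}"
    and ne: "\<And>i. i \<in> I \<Longrightarrow> e i \<noteq> \<mu>"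
  defines "m \<equiv> \<lambda>w. (exp w - 1) / w"
  shows "\<exists>\<kappa>>0. \<forall>i\<in>I. \<kappa> \<le> cmod (1 - m ((e i - \<mu>) * of_real h))"
proof -
  define w where "w = (\<lambda>i. (e i - \<mu>) * of_real h)"
  define J where "J = {i \<in> I. cmod (e i) \<le> 6 / h + cmod \<mu>}"
  define \<kappa> where "\<kappa> = Min (insert (1/2) ((\<lambda>i. cmod (1 - m (w i))) ` J))"
  have fJ: "finite J" unfolding J_def by (rule fin)
  have w: "w i \<noteq> 0" "Re (w i) < ln 2" if "i \<in> I" for i
    using ne[OF that] h Re[OF that] by (auto simp: w_def)
  have "cmod (1 - m (w i)) > 0" if "i \<in> I" for i
    using exp_neq_one_plus[OF w[OF that]] w(1)[OF that] by (auto simp: m_def field_simps)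
  hence "\<kappa> > 0" unfolding \<kappa>_def using fJ by (subst Min_gr_iff) (auto simp: J_def)
  moreover have "\<kappa> \<le> cmod (1 - m (w i))" if i: "i \<in> I" for i
  proof (cases "i \<in> J")
    case True
    thus ?thesis unfolding \<kappa>_def using fJ by (intro Min_le) auto
  next
    case False
    have "6 / h < cmod (e i - \<mu>)"
      using False i norm_triangle_ineq2[of "e i" \<mu>] by (simp add: J_def)
    moreover have "cmod (w i) = cmod (e i - \<mu>) * h" using h unfolding w_def norm_mult by simp
    ultimately have 6: "6 \<le> cmod (w i)" using h by (simp add: field_simps)
    have "exp (Re (w i)) < 2" using w(2)[OF i] by (metis exp_less_mono exp_ln zero_less_numeral)
    hence "cmod (exp (w i) - 1) \<le> 3" using norm_triangle_ineq4[of "exp (w i)" 1] by simp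
    hence "cmod (m (w i)) \<le> 3 / 6" unfolding m_def norm_divide using 6 by (intro frac_le) auto
    hence "1/2 \<le> cmod (1 - m (w i))" using norm_triangle_ineq2[of 1 "m (w i)"] by simp
    moreover have "\<kappa> \<le> 1/2" unfolding \<kappa>_def using fJ by (intro Min_le) auto
    ultimately show ?thesis by linarith
  qed
  ultimately show ?thesis unfolding w_def by blast
qed

text \<open>
  The averaged sum no longer contains \<open>e i0\<close>, so observability in time \<open>T'\<close> bounds the other
  coefficients. By Bessel's inequality, started at time \<open>T'\<close>, their contribution on \<open>[T',T]\<close> is then
  bounded as well, and subtracting it from the whole sum leaves the new term.
\<close>

lemma observable_insert:
  assumes T': "0 \<le> T'" "T' < T" and obs: "observable e I T'" and bes: "bessel e I T"
    and ReK: "\<And>i. i \<in> I \<Longrightarrow> Re (e i) \<le> K"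
    and fin: "\<And>R. finite {i \<in> I. cmod (e i) \<le> R}"
    and ne: "\<And>i. i \<in> I \<Longrightarrow> e i \<noteq> e i0"
  shows "observable e (insert i0 I) T"
proof -
  let ?\<mu> = "e i0"
  \<comment> \<open>an averaging interval that fits into \<open>T - T'\<close> and keeps \<open>Re ((e i - \<mu>) h)\<close> below \<open>ln 2\<close>\<close>
  define h where "h = min (T - T') (ln 2 / (2 * (\<bar>K - Re ?\<mu>\<bar> + 1)))"
  have h: "h > 0" "h \<le> T - T'" using T' by (auto simp: h_def intro!: divide_pos_pos add_nonneg_pos)
  have hl: "(\<bar>K - Re ?\<mu>\<bar> + 1) * h < ln 2"
  proof -
    have "(\<bar>K - Re ?\<mu>\<bar> + 1) * h \<le> (\<bar>K - Re ?\<mu>\<bar> + 1) * (ln 2 / (2 * (\<bar>K - Re ?\<mu>\<bar> + 1)))"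
      by (intro mult_left_mono) (auto simp: h_def)
    also have "\<dots> = ln 2 / 2"
    proof -
      have "P * (ln 2 / (2 * P)) = ln 2 / 2" if "P > 0" for P :: real using that by simp
      moreover have "\<bar>K - Re ?\<mu>\<bar> + 1 > 0" by linarith
      ultimately show ?thesis by blast
    qed
    finally show ?thesis by (smt (verit) ln_2_less_1 field_sum_of_halves ln_gt_zero)
  qed
  define m where "m = (\<lambda>w. (exp w - 1) / w :: complex)"
  have "(Re (e i) - Re ?\<mu>) * h < ln 2" if "i \<in> I" for i
  proof -
    have "(Re (e i) - Re ?\<mu>) * h \<le> (\<bar>K - Re ?\<mu>\<bar> + 1) * h"
      using ReK[OF that] h by (intro mult_right_mono) auto
    thus ?thesis using hl by linarith
  qed
  from averaging_multiplier_bounded_below[OF this h(1) fin ne]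
  obtain \<kappa> where \<kappa>: "\<kappa> > 0" "\<And>i. i \<in> I \<Longrightarrow> \<kappa> \<le> cmod (1 - m ((e i - ?\<mu>) * of_real h))"
    unfolding m_def by blast
  obtain C0 where C0: "C0 > 0" "\<And>F c. finite F \<Longrightarrow> F \<subseteq> I \<Longrightarrow>
     C0 * (\<Sum>i\<in>F. (cmod (c i))\<^sup>2 * exp (2 * Re (e i) * T')) \<le> energy (exp_sum e c F) 0 T'"
    using obs unfolding observable_def by blast
  obtain L where L: "L \<ge> 0" "\<And>F c. finite F \<Longrightarrow> F \<subseteq> I \<Longrightarrow>
      energy (exp_sum e c F) 0 T \<le> L * (\<Sum>i\<in>F. (cmod (c i))\<^sup>2)"
    using bes unfolding bessel_def by blast
  define A where "A = 2 + 2 * (T' * ((exp (\<bar>Re ?\<mu>\<bar> * h))\<^sup>2 / h))"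
  have A: "A > 0" unfolding A_def using T' h by (intro add_pos_nonneg) auto
  define A1 where "A1 = A / (C0 * \<kappa>\<^sup>2)"
  have A1: "A1 > 0" using A C0 \<kappa> by (simp add: A1_def)
  define E where "E = energy (\<lambda>t. exp (?\<mu> * of_real t)) T' T"
  have E: "E > 0"
  proof -
    have "(T - T') * exp (- (2 * \<bar>Re ?\<mu>\<bar> * T)) \<le> E"
      unfolding E_def
    proof (rule energy_ge_const)
      fix t assume t: "T' \<le> t" "t \<le> T"
      have "- (Re ?\<mu> * t) \<le> \<bar>Re ?\<mu>\<bar> * t" using t T' by (auto simp: abs_if mult_right_mono)
      also have "\<dots> \<le> \<bar>Re ?\<mu>\<bar> * T" using t by (intro mult_left_mono) auto
      finally have "- (2 * \<bar>Re ?\<mu>\<bar> * T) \<le> 2 * (Re ?\<mu> * t)" by linarith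
      hence "exp (- (2 * \<bar>Re ?\<mu>\<bar> * T)) \<le> exp (2 * (Re ?\<mu> * t))" by (simp only: exp_le_cancel_iff)
      thus "exp (- (2 * \<bar>Re ?\<mu>\<bar> * T)) \<le> (cmod (exp (?\<mu> * complex_of_real t)))\<^sup>2"
        by (simp add: exp_double)
    qed (use T' in \<open>auto intro!: continuous_intros\<close>)
    moreover have "(T - T') * exp (- (2 * \<bar>Re ?\<mu>\<bar> * T)) > 0" using T' by simp
    ultimately show ?thesis by linarith
  qed
  define A2 where "A2 = (2 + 2 * L * A1) / E * exp (2 * Re ?\<mu> * T) + exp (2 * \<bar>K\<bar> * (T - T')) * A1"
  have A2: "A2 > 0" unfolding A2_def using L A1 E by (intro add_nonneg_pos) auto
  have main: "(\<Sum>i\<in>insert i0 G. (cmod (c i))\<^sup>2 * exp (2 * Re (e i) * T)) \<le> A2 * energy (exp_sum e c (insert i0 G)) 0 T"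
    if G: "finite G" "G \<subseteq> I" for G c
  proof -
    have i0: "i0 \<notin> G" using ne G by blast
    have neG: "\<And>i. i \<in> G \<Longrightarrow> e i \<noteq> ?\<mu>" using ne G by blast
    define u where "u = exp_sum e c (insert i0 G)"
    define U where "U = energy u 0 T"
    have U: "U \<ge> 0" unfolding U_def by (rule energy_nonneg)
    have cu: "continuous_on S u" for S unfolding u_def by (rule continuous_on_exp_sum)
    define avg where "avg = (\<lambda>t. integral {0..h} (\<lambda>s. exp (- (?\<mu> * of_real s)) * u (t + s)) / of_real h)"
    define c' where "c' = (\<lambda>i. c i * (1 - m ((e i - ?\<mu>) * of_real h)))"
    have v: "u t - avg t = exp_sum e c' G t" for t
      unfolding u_def avg_def c'_def m_def
      by (rule exp_sum_minus_average[OF G(1) i0 _ h(1)]) (rule neG)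
    hence avg: "avg = (\<lambda>t. u t - exp_sum e c' G t)" by (simp add: fun_eq_iff algebra_simps)
    have ca: "continuous_on S avg" for S unfolding avg by (intro continuous_intros cu)
    have "energy avg 0 T' \<le> (T' - 0) * ((exp (\<bar>Re ?\<mu>\<bar> * h))\<^sup>2 / h * U)"
    proof (rule energy_le_const[OF ca])
      fix t assume t: "0 \<le> t" "t \<le> T'"
      have "(cmod (avg t))\<^sup>2 \<le> (exp (\<bar>Re ?\<mu>\<bar> * h))\<^sup>2 / h * energy u t (t + h)"
        unfolding avg_def by (rule sq_cmod_average_le[OF cu h(1)])
      also have "\<dots> \<le> (exp (\<bar>Re ?\<mu>\<bar> * h))\<^sup>2 / h * U"
        unfolding U_def using t h by (intro mult_left_mono energy_subset cu) auto
      finally show "(cmod (avg t))\<^sup>2 \<le> (exp (\<bar>Re ?\<mu>\<bar> * h))\<^sup>2 / h * U" .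
    qed (use T' in auto)
    moreover have "energy (\<lambda>t. u t - avg t) 0 T' \<le> 2 * energy u 0 T' + 2 * energy avg 0 T'"
      by (rule energy_diff[OF cu ca])
    moreover have "energy u 0 T' \<le> U"
      unfolding U_def by (rule energy_subset[OF cu]) (use T' in auto)
    moreover have "A * U = 2 * U + 2 * ((T' - 0) * ((exp (\<bar>Re ?\<mu>\<bar> * h))\<^sup>2 / h * U))"
      by (simp add: A_def distrib_right)
    ultimately have "energy (\<lambda>t. u t - avg t) 0 T' \<le> A * U" by linarith
    hence vA: "energy (exp_sum e c' G) 0 T' \<le> A * U" unfolding v .
    define S where "S = (\<Sum>i\<in>G. (cmod (c i))\<^sup>2 * exp (2 * Re (e i) * T'))"
    have "\<kappa>\<^sup>2 * S \<le> (\<Sum>i\<in>G. (cmod (c' i))\<^sup>2 * exp (2 * Re (e i) * T'))"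
      unfolding S_def sum_distrib_left
    proof (rule sum_mono)
      fix i assume "i \<in> G"
      hence "\<kappa>\<^sup>2 \<le> (cmod (1 - m ((e i - ?\<mu>) * of_real h)))\<^sup>2"
        using \<kappa> G by (intro power_mono) auto
      hence "\<kappa>\<^sup>2 * ((cmod (c i))\<^sup>2 * exp (2 * Re (e i) * T'))
         \<le> (cmod (1 - m ((e i - ?\<mu>) * of_real h)))\<^sup>2 * ((cmod (c i))\<^sup>2 * exp (2 * Re (e i) * T'))"
        by (rule mult_right_mono) auto
      thus "\<kappa>\<^sup>2 * ((cmod (c i))\<^sup>2 * exp (2 * Re (e i) * T')) \<le> (cmod (c' i))\<^sup>2 * exp (2 * Re (e i) * T')"
        unfolding c'_def norm_mult power_mult_distrib by (simp only: mult_ac)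
    qed
    hence "C0 * (\<kappa>\<^sup>2 * S) \<le> C0 * (\<Sum>i\<in>G. (cmod (c' i))\<^sup>2 * exp (2 * Re (e i) * T'))"
      using C0 by (intro mult_left_mono) auto
    also have "\<dots> \<le> A * U" using C0(2)[OF G, of c'] vA by linarith
    finally have S: "S \<le> A1 * U" using C0 \<kappa> by (simp add: A1_def field_simps)
    have 1: "(\<Sum>i\<in>G. (cmod (c i))\<^sup>2 * exp (2 * Re (e i) * T)) \<le> exp (2 * \<bar>K\<bar> * (T - T')) * (A1 * U)"
    proof -
      have "(\<Sum>i\<in>G. (cmod (c i))\<^sup>2 * exp (2 * Re (e i) * T)) \<le> exp (2 * \<bar>K\<bar> * (T - T')) * S"
        unfolding S_def sum_distrib_left
      proof (rule sum_mono)
        fix i assume i: "i \<in> G"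
        have "Re (e i) * (T - T') \<le> \<bar>K\<bar> * (T - T')"
          using ReK[of i] i G T' by (intro mult_right_mono) auto
        hence "exp (2 * Re (e i) * T) \<le> exp (2 * \<bar>K\<bar> * (T - T')) * exp (2 * Re (e i) * T')"
          by (simp add: exp_add [symmetric] algebra_simps)
        hence "(cmod (c i))\<^sup>2 * exp (2 * Re (e i) * T)
           \<le> (cmod (c i))\<^sup>2 * (exp (2 * \<bar>K\<bar> * (T - T')) * exp (2 * Re (e i) * T'))"
          by (rule mult_left_mono) simp
        thus "(cmod (c i))\<^sup>2 * exp (2 * Re (e i) * T)
           \<le> exp (2 * \<bar>K\<bar> * (T - T')) * ((cmod (c i))\<^sup>2 * exp (2 * Re (e i) * T'))"
          by (simp only: mult_ac)
      qed
      also have "\<dots> \<le> exp (2 * \<bar>K\<bar> * (T - T')) * (A1 * U)" by (intro mult_left_mono S) auto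
      finally show ?thesis .
    qed
    have 2: "(cmod (c i0))\<^sup>2 * E \<le> (2 + 2 * L * A1) * U"
    proof -
      define g where "g = exp_sum e c G"
      have cg: "continuous_on S g" for S unfolding g_def by (rule continuous_on_exp_sum)
      have "(cmod (c i0))\<^sup>2 * E = energy (\<lambda>t. c i0 * exp (?\<mu> * of_real t)) T' T"
        unfolding E_def by (rule energy_cmult [symmetric])
      also have "(\<lambda>t. c i0 * exp (?\<mu> * of_real t)) = (\<lambda>t. u t - g t)"
        unfolding u_def g_def by (simp add: fun_eq_iff exp_sum_insert[OF G(1) i0])
      also have "energy (\<lambda>t. u t - g t) T' T \<le> 2 * energy u T' T + 2 * energy g T' T"
        by (rule energy_diff[OF cu cg])
      also have "energy u T' T \<le> U" unfolding U_def by (rule energy_subset[OF cu]) (use T' in auto)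
      also have "energy g T' T \<le> L * (A1 * U)"
      proof -
        have "energy g T' T = energy (\<lambda>t. g (t + T')) 0 (T - T')" by (simp add: energy_shift)
        also have "(\<lambda>t. g (t + T')) = exp_sum e (\<lambda>i. c i * exp (e i * of_real T')) G"
          unfolding g_def exp_sum_shift ..
        also have "energy \<dots> 0 (T - T') \<le> energy \<dots> 0 T"
          using T' by (intro energy_subset continuous_on_exp_sum) auto
        also have "\<dots> \<le> L * (\<Sum>i\<in>G. (cmod (c i * exp (e i * of_real T')))\<^sup>2)" by (rule L(2)[OF G])
        also have "(\<Sum>i\<in>G. (cmod (c i * exp (e i * of_real T')))\<^sup>2) = S"
          unfolding S_def by (intro sum.cong) (auto simp: norm_mult power_mult_distrib exp_double [symmetric] mult_ac)
        also have "L * S \<le> L * (A1 * U)" by (intro mult_left_mono S L(1))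
        finally show ?thesis .
      qed
      finally show ?thesis by (simp add: algebra_simps)
    qed
    have "(cmod (c i0))\<^sup>2 \<le> (2 + 2 * L * A1) / E * U"
      using 2 E by (simp add: field_simps)
    hence "(cmod (c i0))\<^sup>2 * exp (2 * Re ?\<mu> * T) \<le> (2 + 2 * L * A1) / E * U * exp (2 * Re ?\<mu> * T)"
      by (rule mult_right_mono) simp
    hence "(\<Sum>i\<in>insert i0 G. (cmod (c i))\<^sup>2 * exp (2 * Re (e i) * T)) \<le> A2 * U"
      using 1 G i0 by (simp add: A2_def algebra_simps)
    thus ?thesis unfolding U_def u_def .
  qed
  have "(\<Sum>i\<in>F. (cmod (c i))\<^sup>2 * exp (2 * Re (e i) * T)) \<le> A2 * energy (exp_sum e c F) 0 T"
    if F: "finite F" "F \<subseteq> insert i0 I" for F c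
  proof -
    define c' where "c' = (\<lambda>i. if i \<in> F then c i else 0)"
    define G where "G = F - {i0}"
    have G: "finite G" "G \<subseteq> I" "F \<subseteq> insert i0 G" using F by (auto simp: G_def)
    have "(\<Sum>i\<in>F. (cmod (c i))\<^sup>2 * exp (2 * Re (e i) * T)) = (\<Sum>i\<in>insert i0 G. (cmod (c' i))\<^sup>2 * exp (2 * Re (e i) * T))"
      using G by (intro sum.mono_neutral_cong_left) (auto simp: c'_def)
    also have "\<dots> \<le> A2 * energy (exp_sum e c' (insert i0 G)) 0 T" by (rule main[OF G(1,2)])
    also have "exp_sum e c' (insert i0 G) = exp_sum e c F"
      unfolding exp_sum_def using G
      by (intro ext sum.mono_neutral_cong_right) (auto simp: c'_def)
    finally show ?thesis .
  qed
  thus ?thesis unfolding observable_def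
    using A2 by (intro exI[of _ "1 / A2"]) (auto simp: field_simps)
qed

lemma bessel_mono:
  assumes "bessel e I T" "T' \<le> T"
  shows "bessel e I T'"
proof -
  have "energy (exp_sum e c F) 0 T' \<le> energy (exp_sum e c F) 0 T" for c F
    using assms(2) by (intro energy_subset continuous_on_exp_sum) auto
  thus ?thesis using assms(1) unfolding bessel_def by (meson order_trans)
qed

lemma observable_mono:
  assumes "observable e I T'" "T' \<le> T" "\<And>i. i \<in> I \<Longrightarrow> Re (e i) \<le> K"
  shows "observable e I T"
proof -
  obtain C where C: "C > 0" "\<And>F c. finite F \<Longrightarrow> F \<subseteq> I \<Longrightarrow>
     C * (\<Sum>i\<in>F. (cmod (c i))\<^sup>2 * exp (2 * Re (e i) * T')) \<le> energy (exp_sum e c F) 0 T'"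
    using assms(1) unfolding observable_def by blast
  define M where "M = exp (2 * \<bar>K\<bar> * (T - T'))"
  have "C / M * (\<Sum>i\<in>F. (cmod (c i))\<^sup>2 * exp (2 * Re (e i) * T)) \<le> energy (exp_sum e c F) 0 T"
    if F: "finite F" "F \<subseteq> I" for F c
  proof -
    have "(\<Sum>i\<in>F. (cmod (c i))\<^sup>2 * exp (2 * Re (e i) * T))
        \<le> (\<Sum>i\<in>F. M * ((cmod (c i))\<^sup>2 * exp (2 * Re (e i) * T')))"
    proof (rule sum_mono)
      fix i assume i: "i \<in> F"
      have "Re (e i) * (T - T') \<le> \<bar>K\<bar> * (T - T')"
        using assms(3)[of i] i F assms(2) by (intro mult_right_mono) auto
      hence "exp (2 * Re (e i) * T) \<le> M * exp (2 * Re (e i) * T')"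
        by (simp add: M_def exp_add [symmetric] algebra_simps)
      hence "(cmod (c i))\<^sup>2 * exp (2 * Re (e i) * T) \<le> (cmod (c i))\<^sup>2 * (M * exp (2 * Re (e i) * T'))"
        by (rule mult_left_mono) simp
      thus "(cmod (c i))\<^sup>2 * exp (2 * Re (e i) * T) \<le> M * ((cmod (c i))\<^sup>2 * exp (2 * Re (e i) * T'))"
        by (simp only: mult_ac)
    qed
    hence "C / M * (\<Sum>i\<in>F. (cmod (c i))\<^sup>2 * exp (2 * Re (e i) * T))
        \<le> C / M * (\<Sum>i\<in>F. M * ((cmod (c i))\<^sup>2 * exp (2 * Re (e i) * T')))"
      using C by (intro mult_left_mono) (auto simp: M_def)
    also have "\<dots> = C * (\<Sum>i\<in>F. (cmod (c i))\<^sup>2 * exp (2 * Re (e i) * T'))"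
      by (simp add: sum_distrib_left [symmetric] M_def)
    also have "\<dots> \<le> energy (exp_sum e c F) 0 T'" by (rule C(2)[OF F])
    also have "\<dots> \<le> energy (exp_sum e c F) 0 T"
      using assms(2) by (intro energy_subset continuous_on_exp_sum) auto
    finally show ?thesis .
  qed
  thus ?thesis unfolding observable_def
    using C(1) by (intro exI[of _ "C / M"]) (auto simp: M_def)
qed

text \<open>
  Each insertion takes half of the time that is left.
\<close>

lemma observable_Un_finite:
  assumes "finite J" "0 \<le> T'" "T' < T" "observable e I T'" "bessel e (I \<union> J) T"
    and "\<And>i. i \<in> I \<union> J \<Longrightarrow> Re (e i) \<le> K"
    and "\<And>R. finite {i \<in> I \<union> J. cmod (e i) \<le> R}"
    and "inj_on e (I \<union> J)" "I \<inter> J = {}"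
  shows "observable e (I \<union> J) T"
  using assms
proof (induction J arbitrary: T rule: finite_induct)
  case empty
  have "observable e I T"
    by (rule observable_mono[where T' = T' and K = K]) (use empty in auto)
  thus ?case by simp
next
  case (insert j J)
  define T1 where "T1 = (T' + T) / 2"
  have T1: "T' < T1" "T1 < T" "0 \<le> T1" using insert.prems by (auto simp: T1_def)
  have sub: "I \<union> J \<subseteq> I \<union> insert j J" by auto
  have fin: "finite {i \<in> I \<union> J. cmod (e i) \<le> R}" for R
    by (rule finite_subset[OF _ insert.prems(6)[of R]]) auto
  have "observable e (I \<union> J) T1"
  proof (rule insert.IH)
    show "bessel e (I \<union> J) T1"
      using bessel_mono[OF bessel_subset[OF insert.prems(4) sub]] T1 by simp
    show "inj_on e (I \<union> J)" by (rule inj_on_subset[OF insert.prems(7) sub])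
  qed (use insert.prems T1 fin in auto)
  moreover have "e i \<noteq> e j" if "i \<in> I \<union> J" for i
    using insert.prems(7,8) insert.hyps that unfolding inj_on_def by blast
  ultimately have "observable e (insert j (I \<union> J)) T"
    by (intro observable_insert[OF T1(3,2), where K = K] bessel_subset[OF insert.prems(4) sub] fin)
       (use insert.prems(5) in auto)
  thus ?case by simp
qed

section \<open>Perturbed Fourier frequencies\<close>

text \<open>
  Orthonormality of the Fourier system on \<open>[0,1]\<close>.
\<close>

lemma energy_fourier_unit:
  fixes b :: "int \<Rightarrow> complex"
  assumes "finite F"
  shows "energy (exp_sum (\<lambda>k. 2 * of_int k * of_real pi * \<i>) b F) 0 1 = (\<Sum>k\<in>F. (cmod (b k))\<^sup>2)"
proof -
  let ?e = "\<lambda>k::int. 2 * of_int k * of_real pi * \<i> :: complex"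
  have "((\<lambda>t. \<Sum>k\<in>F. \<Sum>j\<in>F. (b k * cnj (b j)) * exp (?e (k - j) * of_real t)) has_integral
      (\<Sum>k\<in>F. \<Sum>j\<in>F. (b k * cnj (b j)) * (if k = j then 1 else 0))) {0..1}"
  proof (intro has_integral_sum assms has_integral_mult_right)
    fix k j
    show "((\<lambda>t. exp (?e (k - j) * of_real t)) has_integral (if k = j then 1 else 0)) {0..1}"
    proof (cases "k = j")
      case True
      thus ?thesis using has_integral_const_real[of "1::complex" 0 1] by simp
    next
      case False
      hence "?e (k - j) \<noteq> 0" by simp
      moreover have "exp (?e (k - j) * of_real 1) = 1"
        using exp_integer_2pi[of "of_int (k - j)"] by (simp add: mult_ac)
      ultimately show ?thesis
        using has_integral_exp_interval[of "?e (k - j)" 1] False by simp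
    qed
  qed
  moreover have "(\<Sum>k\<in>F. \<Sum>j\<in>F. (b k * cnj (b j)) * exp (?e (k - j) * of_real t))
      = of_real ((cmod (exp_sum ?e b F t))\<^sup>2)" for t
    unfolding complex_norm_square exp_sum_def cnj_sum sum_product
    by (intro sum.cong refl) (simp add: exp_cnj exp_add [symmetric] algebra_simps)
  moreover have "(\<Sum>k\<in>F. \<Sum>j\<in>F. (b k * cnj (b j)) * (if k = j then 1 else 0))
      = of_real (\<Sum>k\<in>F. (cmod (b k))\<^sup>2)"
    using assms by (simp add: complex_norm_square [symmetric] if_distrib sum.delta cong: if_cong)
  ultimately have "((\<lambda>t. complex_of_real ((cmod (exp_sum ?e b F t))\<^sup>2)) has_integral
      of_real (\<Sum>k\<in>F. (cmod (b k))\<^sup>2)) {0..1}" by simp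
  from has_integral_Re[OF this] show ?thesis
    unfolding energy_def by (simp add: integral_unique)
qed

lemma energy_fourier:
  fixes b :: "int \<Rightarrow> complex"
  assumes "finite F"
  shows "energy (exp_sum (\<lambda>k. 2 * of_int k * of_real pi * \<i>) b F) p (p + 1) = (\<Sum>k\<in>F. (cmod (b k))\<^sup>2)"
proof -
  let ?e = "\<lambda>k::int. 2 * of_int k * of_real pi * \<i> :: complex"
  have "energy (exp_sum ?e b F) p (p + 1) = energy (\<lambda>t. exp_sum ?e b F (t + p)) 0 1"
    by (simp add: energy_shift add.commute)
  also have "\<dots> = (\<Sum>k\<in>F. (cmod (b k * exp (?e k * of_real p)))\<^sup>2)"
    unfolding exp_sum_shift by (rule energy_fourier_unit[OF assms])
  also have "\<dots> = (\<Sum>k\<in>F. (cmod (b k))\<^sup>2)" by (simp add: norm_mult)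
  finally show ?thesis .
qed

definition line_freq :: "complex \<Rightarrow> int \<Rightarrow> complex" where
  "line_freq \<beta> k = \<beta> + 2 * of_int k * of_real pi * \<i>"

lemma cmod_exp_sum_line_freq:
  "cmod (exp_sum (line_freq \<beta>) b F t)
     = exp (Re \<beta> * t) * cmod (exp_sum (\<lambda>k. 2 * of_int k * of_real pi * \<i>) b F t)"
proof -
  have "exp_sum (line_freq \<beta>) b F t
     = exp (\<beta> * of_real t) * exp_sum (\<lambda>k. 2 * of_int k * of_real pi * \<i>) b F t"
    unfolding exp_sum_def line_freq_def sum_distrib_left
    by (intro sum.cong refl) (simp add: exp_add ring_distribs mult_ac)
  thus ?thesis by (simp add: norm_mult)
qed

lemma exp_line_freq: "exp (line_freq \<beta> k) = exp \<beta>"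
  using exp_integer_2pi[of "of_int k"] by (simp add: line_freq_def exp_add mult_ac)

text \<open>
  Parseval's identity, up to the weight \<open>exp (2 Re \<beta> t)\<close>.
\<close>

lemma energy_line_freq_ge:
  assumes "finite F" "0 \<le> p"
  shows "exp (- 2 * \<bar>Re \<beta>\<bar> * (p + 1)) * (\<Sum>k\<in>F. (cmod (b k))\<^sup>2)
     \<le> energy (exp_sum (line_freq \<beta>) b F) p (p + 1)"
proof -
  let ?f = "exp_sum (\<lambda>k. 2 * of_int k * of_real pi * \<i>) b F"
  define \<omega> where "\<omega> = exp (- \<bar>Re \<beta>\<bar> * (p + 1))"
  have "energy (\<lambda>t. of_real \<omega> * ?f t) p (p + 1) \<le> energy (exp_sum (line_freq \<beta>) b F) p (p + 1)"
  proof (rule energy_mono)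
    fix t assume t: "p \<le> t" "t \<le> p + 1"
    have "- (Re \<beta> * t) \<le> \<bar>Re \<beta>\<bar> * t" using t assms by (auto simp: abs_if mult_right_mono)
    also have "\<dots> \<le> \<bar>Re \<beta>\<bar> * (p + 1)" using t by (intro mult_left_mono) auto
    finally have "\<omega> \<le> exp (Re \<beta> * t)" by (simp add: \<omega>_def)
    thus "cmod (of_real \<omega> * ?f t) \<le> cmod (exp_sum (line_freq \<beta>) b F t)"
      unfolding cmod_exp_sum_line_freq norm_mult
      by (intro mult_right_mono) (auto simp: \<omega>_def)
  qed (intro continuous_intros)+
  moreover have "\<omega>\<^sup>2 = exp (- 2 * \<bar>Re \<beta>\<bar> * (p + 1))" by (simp add: \<omega>_def exp_double [symmetric])
  ultimately show ?thesis
    unfolding energy_cmult energy_fourier[OF assms(1)] by simp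
qed

lemma bessel_line_freq:
  shows "bessel (line_freq \<beta>) UNIV T"
proof -
  obtain n :: nat where n: "T \<le> real n" using real_arch_simple by blast
  define \<Omega> where "\<Omega> = exp (\<bar>Re \<beta>\<bar> * real n)"
  have "energy (exp_sum (line_freq \<beta>) b F) 0 T \<le> \<Omega>\<^sup>2 * real n * (\<Sum>k\<in>F. (cmod (b k))\<^sup>2)"
    if F: "finite F" for F b
  proof -
    let ?f = "exp_sum (\<lambda>k. 2 * of_int k * of_real pi * \<i>) b F"
    have "energy (exp_sum (line_freq \<beta>) b F) 0 T \<le> energy (exp_sum (line_freq \<beta>) b F) 0 n"
      using n by (intro energy_subset continuous_intros) auto
    also have "\<dots> \<le> energy (\<lambda>t. of_real \<Omega> * ?f t) 0 n"
    proof (rule energy_mono)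
      fix t assume t: "0 \<le> t" "t \<le> real n"
      have "Re \<beta> * t \<le> \<bar>Re \<beta>\<bar> * t" using t by (intro mult_right_mono) auto
      also have "\<dots> \<le> \<bar>Re \<beta>\<bar> * real n" using t by (intro mult_left_mono) auto
      finally have "exp (Re \<beta> * t) \<le> \<Omega>" by (simp add: \<Omega>_def)
      thus "cmod (exp_sum (line_freq \<beta>) b F t) \<le> cmod (of_real \<Omega> * ?f t)"
        unfolding cmod_exp_sum_line_freq norm_mult
        by (intro mult_right_mono) (auto simp: \<Omega>_def)
    qed (intro continuous_intros)+
    also have "\<dots> = \<Omega>\<^sup>2 * energy ?f 0 n" unfolding energy_cmult by simp
    also have "energy ?f 0 (real n) = real n * (\<Sum>k\<in>F. (cmod (b k))\<^sup>2)"
    proof (induction n)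
      case 0
      show ?case by (simp add: energy_def)
    next
      case (Suc n)
      have "energy ?f 0 (real n) + energy ?f (real n) (real n + 1) = energy ?f 0 (real n + 1)"
        unfolding energy_def
        by (rule Henstock_Kurzweil_Integration.integral_combine) (auto intro!: energy_integrable continuous_intros)
      moreover have "real (Suc n) = real n + 1" by simp
      ultimately show ?case using Suc energy_fourier[OF F, of b "real n"] by (simp add: algebra_simps)
    qed
    finally show ?thesis by simp
  qed
  thus ?thesis unfolding bessel_def by (intro exI[of _ "\<Omega>\<^sup>2 * real n"]) auto
qed

lemma ell2_on_bounded:
  assumes "ell2_on A \<nu>"
  shows "\<exists>V\<ge>0. (\<forall>k\<in>A. cmod (\<nu> k) \<le> V)
    \<and> (\<forall>F. finite F \<longrightarrow> F \<subseteq> A \<longrightarrow> (\<Sum>k\<in>F. (cmod (\<nu> k))\<^sup>2) \<le> V\<^sup>2)"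
proof -
  define S where "S = (\<Sum>\<^sub>\<infinity>k\<in>A. (cmod (\<nu> k))\<^sup>2)"
  have S: "(\<Sum>k\<in>F. (cmod (\<nu> k))\<^sup>2) \<le> S" if "finite F" "F \<subseteq> A" for F
    unfolding S_def using assms that unfolding ell2_on_def by (intro finite_sum_le_infsum) auto
  have S0: "S \<ge> 0" using S[of "{}"] by simp
  show ?thesis
  proof (intro exI[of _ "sqrt S"] conjI ballI allI impI)
    fix k assume "k \<in> A"
    hence "(cmod (\<nu> k))\<^sup>2 \<le> S" using S[of "{k}"] by simp
    thus "cmod (\<nu> k) \<le> sqrt S" by (rule real_le_rsqrt)
  qed (use S S0 in auto)
qed

lemma ell2_on_tail:
  fixes \<nu> :: "int \<Rightarrow> complex"
  assumes "ell2_on {k. \<bar>k\<bar> \<ge> int N} \<nu>" "\<rho> > 0"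
  obtains M where "M \<ge> N" "\<And>F. finite F \<Longrightarrow> F \<subseteq> {k. \<bar>k\<bar> \<ge> int M} \<Longrightarrow> (\<Sum>k\<in>F. (cmod (\<nu> k))\<^sup>2) \<le> \<rho>"
proof -
  define A where "A = {k::int. \<bar>k\<bar> \<ge> int N}"
  define q where "q = (\<lambda>k. (cmod (\<nu> k))\<^sup>2)"
  have sm: "q summable_on A" using assms(1) unfolding ell2_on_def A_def q_def .
  have "eventually (\<lambda>F. infsum q A - \<rho> < sum q F) (finite_subsets_at_top A)"
    using infsum_tendsto[OF sm] assms(2) by (intro order_tendstoD(1)[of _ "infsum q A"]) auto
  then obtain F0 where F0: "finite F0" "F0 \<subseteq> A" "infsum q A - \<rho> < sum q F0"
    unfolding eventually_finite_subsets_at_top by blast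
  obtain m where m: "\<And>k. k \<in> F0 \<Longrightarrow> \<bar>k\<bar> < m"
  proof
    fix k assume "k \<in> F0"
    hence "\<bar>k\<bar> \<le> (\<Sum>j\<in>F0. \<bar>j\<bar>)" using F0(1) by (intro member_le_sum) auto
    thus "\<bar>k\<bar> < (\<Sum>j\<in>F0. \<bar>j\<bar>) + 1" by simp
  qed
  define M where "M = max N (nat m)"
  show ?thesis
  proof (rule that[of M])
    fix F assume F: "finite F" "F \<subseteq> {k. \<bar>k\<bar> \<ge> int M}"
    have "F \<inter> F0 = {}" proof -
      have False if "k \<in> F" "k \<in> F0" for k
      proof -
        have "int M \<le> \<bar>k\<bar>" using F that by auto
        thus False using m[OF that(2)] by (simp add: M_def)
      qed
      thus ?thesis by auto
    qed
    hence "sum q F0 + sum q F = sum q (F0 \<union> F)"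
      using F F0 by (subst sum.union_disjoint) auto
    also have "\<dots> \<le> infsum q A"
      using F F0 by (intro finite_sum_le_infsum sm) (auto simp: A_def M_def q_def)
    finally show "(\<Sum>k\<in>F. (cmod (\<nu> k))\<^sup>2) \<le> \<rho>" using F0(3) unfolding q_def by linarith
  qed (simp add: M_def)
qed

lemma cmod_exp_minus_1_le: "cmod (exp z - 1) \<le> exp (cmod z) * cmod z"
proof -
  have "cmod (exp z - 1) \<le> exp \<bar>Re z\<bar> * cmod z" using Taylor_exp[of z 0] by simp
  also have "\<dots> \<le> exp (cmod z) * cmod z" by (intro mult_right_mono) (auto simp: abs_Re_le_cmod)
  finally show ?thesis .
qed

text \<open>
  The perturbation of the Fourier system is of Hilbert-Schmidt type, uniformly in \<open>t\<close>: it is controlled by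
  the sum of the \<open>|\<nu> k|\<^sup>2\<close>, and is therefore small on sets of large indices.
\<close>

lemma hyperbolic_perturbation:
  fixes \<gamma> \<nu> :: "int \<Rightarrow> complex"
  assumes "\<And>k. k \<in> A \<Longrightarrow> \<gamma> k = line_freq \<beta> k + \<nu> k" "ell2_on A \<nu>" "T \<ge> 0"
  obtains H G where "H \<ge> 0" "G \<ge> 0"
    "\<And>k t. k \<in> A \<Longrightarrow> 0 \<le> t \<Longrightarrow> t \<le> T \<Longrightarrow>
       cmod (exp (\<gamma> k * of_real t) - exp (line_freq \<beta> k * of_real t)) \<le> H * cmod (\<nu> k)"
    "\<And>k t. k \<in> A \<Longrightarrow> 0 \<le> t \<Longrightarrow> t \<le> T \<Longrightarrow> cmod (exp (\<gamma> k * of_real t)) \<le> G"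
    "\<And>F b t. finite F \<Longrightarrow> F \<subseteq> A \<Longrightarrow> 0 \<le> t \<Longrightarrow> t \<le> T \<Longrightarrow>
       (cmod (exp_sum \<gamma> b F t - exp_sum (line_freq \<beta>) b F t))\<^sup>2
         \<le> H\<^sup>2 * (\<Sum>k\<in>F. (cmod (\<nu> k))\<^sup>2) * (\<Sum>k\<in>F. (cmod (b k))\<^sup>2)"
proof -
  obtain V where V: "V \<ge> 0" "\<And>k. k \<in> A \<Longrightarrow> cmod (\<nu> k) \<le> V"
    using ell2_on_bounded[OF assms(2)] by blast
  define H where "H = exp (\<bar>Re \<beta>\<bar> * T) * (exp (V * T) * T)"
  define G where "G = exp ((\<bar>Re \<beta>\<bar> + V) * T)"
  have H0: "H \<ge> 0" "G \<ge> 0" using assms(3) by (auto simp: H_def G_def)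
  have Hb: "cmod (exp (\<gamma> k * of_real t) - exp (line_freq \<beta> k * of_real t)) \<le> H * cmod (\<nu> k)"
    if k: "k \<in> A" and t: "0 \<le> t" "t \<le> T" for k t
  proof -
    have "exp (\<gamma> k * of_real t) - exp (line_freq \<beta> k * of_real t)
        = exp (line_freq \<beta> k * of_real t) * (exp (\<nu> k * of_real t) - 1)"
      unfolding assms(1)[OF k] by (simp add: exp_add algebra_simps)
    hence eq: "cmod (exp (\<gamma> k * of_real t) - exp (line_freq \<beta> k * of_real t))
        = cmod (exp (line_freq \<beta> k * of_real t)) * cmod (exp (\<nu> k * of_real t) - 1)"
      by (simp only: norm_mult)
    have 1: "cmod (exp (line_freq \<beta> k * of_real t)) \<le> exp (\<bar>Re \<beta>\<bar> * T)"
    proof -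
      have "Re \<beta> * t \<le> \<bar>Re \<beta>\<bar> * t" using t by (intro mult_right_mono) auto
      also have "\<dots> \<le> \<bar>Re \<beta>\<bar> * T" using t by (intro mult_left_mono) auto
      finally show ?thesis by (simp add: line_freq_def)
    qed
    have 2: "cmod (exp (\<nu> k * of_real t) - 1) \<le> exp (V * T) * T * cmod (\<nu> k)"
    proof -
      have "cmod (exp (\<nu> k * of_real t) - 1) \<le> exp (cmod (\<nu> k) * t) * (cmod (\<nu> k) * t)"
        using cmod_exp_minus_1_le[of "\<nu> k * of_real t"] t by (simp add: norm_mult)
      also have "\<dots> \<le> exp (V * T) * (cmod (\<nu> k) * T)"
        using t V k by (intro mult_mono iffD2[OF exp_le_cancel_iff]) auto
      finally show ?thesis by (simp add: mult_ac)
    qed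
    have "cmod (exp (\<gamma> k * of_real t) - exp (line_freq \<beta> k * of_real t))
        \<le> exp (\<bar>Re \<beta>\<bar> * T) * (exp (V * T) * T * cmod (\<nu> k))"
      unfolding eq by (intro mult_mono 1 2) auto
    thus ?thesis by (simp add: H_def mult_ac)
  qed
  show ?thesis
  proof (rule that[OF H0 Hb])
    fix k t assume k: "k \<in> A" and t: "0 \<le> t" "t \<le> T"
    have "Re (\<gamma> k) \<le> \<bar>Re \<beta>\<bar> + V"
      using V(2)[OF k] abs_Re_le_cmod[of "\<nu> k"] by (simp add: assms(1)[OF k] line_freq_def)
    hence "Re (\<gamma> k) * t \<le> (\<bar>Re \<beta>\<bar> + V) * t" using t by (intro mult_right_mono) auto
    also have "\<dots> \<le> (\<bar>Re \<beta>\<bar> + V) * T" using t V by (intro mult_left_mono) auto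
    finally show "cmod (exp (\<gamma> k * of_real t)) \<le> G" by (simp add: G_def)
  next
    fix F b t assume F: "finite F" "F \<subseteq> A" and t: "0 \<le> t" "t \<le> T"
    have "exp_sum \<gamma> b F t - exp_sum (line_freq \<beta>) b F t
        = (\<Sum>k\<in>F. b k * (exp (\<gamma> k * of_real t) - exp (line_freq \<beta> k * of_real t)))"
      unfolding exp_sum_def by (simp add: sum_subtractf algebra_simps)
    hence "(cmod (exp_sum \<gamma> b F t - exp_sum (line_freq \<beta>) b F t))\<^sup>2
       \<le> (\<Sum>k\<in>F. (cmod (b k))\<^sup>2) * (\<Sum>k\<in>F. (cmod (exp (\<gamma> k * of_real t) - exp (line_freq \<beta> k * of_real t)))\<^sup>2)"
      using sq_cmod_sum_le by simp
    also have "\<dots> \<le> (\<Sum>k\<in>F. (cmod (b k))\<^sup>2) * (\<Sum>k\<in>F. (H * cmod (\<nu> k))\<^sup>2)"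
      using F t by (intro mult_left_mono sum_mono power_mono Hb sum_nonneg) auto
    also have "(\<Sum>k\<in>F. (H * cmod (\<nu> k))\<^sup>2) = H\<^sup>2 * (\<Sum>k\<in>F. (cmod (\<nu> k))\<^sup>2)"
      by (simp add: power_mult_distrib sum_distrib_left)
    finally show "(cmod (exp_sum \<gamma> b F t - exp_sum (line_freq \<beta>) b F t))\<^sup>2
         \<le> H\<^sup>2 * (\<Sum>k\<in>F. (cmod (\<nu> k))\<^sup>2) * (\<Sum>k\<in>F. (cmod (b k))\<^sup>2)"
      by (simp add: mult_ac)
  qed
qed

lemma bessel_hyperbolic:
  fixes \<gamma> \<nu> :: "int \<Rightarrow> complex"
  assumes "\<And>k. k \<in> A \<Longrightarrow> \<gamma> k = line_freq \<beta> k + \<nu> k" "ell2_on A \<nu>" "T \<ge> 0"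
  shows "bessel \<gamma> A T"
proof (rule hyperbolic_perturbation[OF assms])
  fix H G
  assume H: "H \<ge> 0" and pert: "\<And>F b t. finite F \<Longrightarrow> F \<subseteq> A \<Longrightarrow> 0 \<le> t \<Longrightarrow> t \<le> T \<Longrightarrow>
       (cmod (exp_sum \<gamma> b F t - exp_sum (line_freq \<beta>) b F t))\<^sup>2
         \<le> H\<^sup>2 * (\<Sum>k\<in>F. (cmod (\<nu> k))\<^sup>2) * (\<Sum>k\<in>F. (cmod (b k))\<^sup>2)"
  obtain V where V: "\<And>F. finite F \<Longrightarrow> F \<subseteq> A \<Longrightarrow> (\<Sum>k\<in>F. (cmod (\<nu> k))\<^sup>2) \<le> V\<^sup>2"
    using ell2_on_bounded[OF assms(2)] by blast
  obtain L where L: "L \<ge> 0" "\<And>F c. finite F \<Longrightarrow> F \<subseteq> UNIV \<Longrightarrow>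
      energy (exp_sum (line_freq \<beta>) c F) 0 T \<le> L * (\<Sum>i\<in>F. (cmod (c i))\<^sup>2)"
    using bessel_line_freq[of \<beta> T] unfolding bessel_def by blast
  have "energy (exp_sum \<gamma> b F) 0 T \<le> (2 * (T * (H\<^sup>2 * V\<^sup>2)) + 2 * L) * (\<Sum>k\<in>F. (cmod (b k))\<^sup>2)"
    if F: "finite F" "F \<subseteq> A" for F b
  proof -
    let ?d = "\<lambda>t. exp_sum \<gamma> b F t - exp_sum (line_freq \<beta>) b F t"
    let ?B = "\<Sum>k\<in>F. (cmod (b k))\<^sup>2"
    have "energy ?d 0 T \<le> (T - 0) * (H\<^sup>2 * V\<^sup>2 * ?B)"
    proof (rule energy_le_const)
      fix t assume t: "0 \<le> t" "t \<le> T"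
      have "(cmod (?d t))\<^sup>2 \<le> H\<^sup>2 * (\<Sum>k\<in>F. (cmod (\<nu> k))\<^sup>2) * ?B" by (rule pert[OF F t])
      also have "\<dots> \<le> H\<^sup>2 * V\<^sup>2 * ?B" by (intro mult_right_mono mult_left_mono V F sum_nonneg) auto
      finally show "(cmod (?d t))\<^sup>2 \<le> H\<^sup>2 * V\<^sup>2 * ?B" .
    qed (use assms in \<open>auto intro!: continuous_intros\<close>)
    moreover have "energy (exp_sum (line_freq \<beta>) b F) 0 T \<le> L * ?B" using L F by auto
    moreover have "energy (\<lambda>t. ?d t + exp_sum (line_freq \<beta>) b F t) 0 T
        \<le> 2 * energy ?d 0 T + 2 * energy (exp_sum (line_freq \<beta>) b F) 0 T"
      by (intro energy_add continuous_intros)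
    ultimately show ?thesis by (simp add: algebra_simps)
  qed
  thus "bessel \<gamma> A T" unfolding bessel_def
    using assms(3) H L(1) by (intro exI[of _ "2 * (T * (H\<^sup>2 * V\<^sup>2)) + 2 * L"]) auto
qed

section \<open>Large parabolic and hyperbolic exponents together\<close>

lemma exp_sum_case_sum:
  assumes "finite F1" "finite F2"
  shows "exp_sum (case_sum lam \<gamma>) c (Inl ` F1 \<union> Inr ` F2) t
     = exp_sum lam (\<lambda>k. c (Inl k)) F1 t + exp_sum \<gamma> (\<lambda>k. c (Inr k)) F2 t"
  by (subst exp_sum_Un) (use assms in \<open>auto simp: exp_sum_def sum.reindex\<close>)

lemma finite_sum_index_split:
  assumes "finite F" "F \<subseteq> Inl ` A \<union> Inr ` B"
  obtains F1 F2 where "finite F1" "finite F2" "F1 \<subseteq> A" "F2 \<subseteq> B" "F = Inl ` F1 \<union> Inr ` F2"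
proof (rule that[of "Inl -` F" "Inr -` F"])
  show "finite (Inl -` F)" "finite (Inr -` F)"
    using assms(1) by (auto intro: finite_vimageI)
  show "F = Inl ` (Inl -` F) \<union> Inr ` (Inr -` F)"
  proof (rule set_eqI)
    fix x show "x \<in> F \<longleftrightarrow> x \<in> Inl ` (Inl -` F) \<union> Inr ` (Inr -` F)"
      by (cases x) auto
  qed
qed (use assms in auto)

lemma sum_squares_le_square_sum:
  fixes x :: "'a \<Rightarrow> real"
  assumes "finite F" "\<And>i. i \<in> F \<Longrightarrow> 0 \<le> x i"
  shows "(\<Sum>i\<in>F. (x i)\<^sup>2) \<le> (\<Sum>i\<in>F. x i)\<^sup>2"
proof -
  have "(\<Sum>i\<in>F. (x i)\<^sup>2) \<le> (\<Sum>i\<in>F. x i * (\<Sum>j\<in>F. x j))"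
    unfolding power2_eq_square
    by (intro sum_mono mult_left_mono member_le_sum assms) auto
  thus ?thesis by (simp add: power2_eq_square sum_distrib_right)
qed

text \<open>
  Here \<open>U\<close> is the energy of the whole sum, \<open>X\<close> measures the parabolic coefficients and \<open>Bb\<close> the
  hyperbolic ones. Each is bounded by \<open>U\<close> up to an error \<open>R * Bb\<close>, where \<open>R\<close> bounds the sum of the
  \<open>|\<nu> k|\<^sup>2\<close> involved; the constants do not depend on \<open>R\<close> or on the index sets, so the
  errors can be absorbed for large indices. The function \<open>P + Q\<close> in the proof is the image of the sum under
  \<open>u \<mapsto> u(\<cdot> + 1) - exp \<beta> u\<close>, with parabolic part \<open>P\<close> and hyperbolic part \<open>Q\<close>.
\<close>

lemma tail_estimate:
  fixes lam a :: "nat \<Rightarrow> complex" and \<gamma> \<nu> b :: "int \<Rightarrow> complex" and T :: real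
  assumes T: "T > 1"
    and neg: "\<And>k. k \<in> A \<Longrightarrow> Re (lam k) \<le> 0"
    and away: "\<kappa> > 0" "\<And>k. k \<in> A \<Longrightarrow> \<kappa> \<le> cmod (exp (lam k) - exp \<beta>)"
    and par: "C3 > 0" "\<And>F a. finite F \<Longrightarrow> F \<subseteq> A \<Longrightarrow>
       (\<Sum>k\<in>F. cmod (a k) * exp (Re (lam k) * (T - 1)))\<^sup>2 \<le> C3 * energy (exp_sum lam a F) 0 (T - 1)"
    and H: "H \<ge> 0" and G: "G \<ge> 0"
    and pert: "\<And>k t. k \<in> B \<Longrightarrow> 0 \<le> t \<Longrightarrow> t \<le> T \<Longrightarrow>
       cmod (exp (\<gamma> k * of_real t) - exp (line_freq \<beta> k * of_real t)) \<le> H * cmod (\<nu> k)"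
    and Gb: "\<And>k t. k \<in> B \<Longrightarrow> 0 \<le> t \<Longrightarrow> t \<le> T \<Longrightarrow> cmod (exp (\<gamma> k * of_real t)) \<le> G"
    and pert_sum: "\<And>F b t. finite F \<Longrightarrow> F \<subseteq> B \<Longrightarrow> 0 \<le> t \<Longrightarrow> t \<le> T \<Longrightarrow>
       (cmod (exp_sum \<gamma> b F t - exp_sum (line_freq \<beta>) b F t))\<^sup>2
         \<le> H\<^sup>2 * (\<Sum>k\<in>F. (cmod (\<nu> k))\<^sup>2) * (\<Sum>k\<in>F. (cmod (b k))\<^sup>2)"
    and F: "finite F1" "F1 \<subseteq> A" "finite F2" "F2 \<subseteq> B"
    and R: "(\<Sum>k\<in>F2. (cmod (\<nu> k))\<^sup>2) \<le> R"
  defines "U \<equiv> energy (\<lambda>t. exp_sum lam a F1 t + exp_sum \<gamma> b F2 t) 0 T"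
    and "Bb \<equiv> \<Sum>k\<in>F2. (cmod (b k))\<^sup>2"
    and "X \<equiv> \<Sum>k\<in>F1. cmod (a k) * exp (Re (lam k) * (T - 1))"
    and "K1 \<equiv> C3 / \<kappa>\<^sup>2 * (2 * (1 + cmod (exp \<beta>))\<^sup>2)"
    and "K2 \<equiv> C3 / \<kappa>\<^sup>2 * (2 * ((T - 1) * (H\<^sup>2 * G\<^sup>2)))"
  shows "X\<^sup>2 \<le> K1 * U + K2 * R * Bb
    \<and> exp (- 2 * \<bar>Re \<beta>\<bar> * T) * Bb \<le> (4 + 4 * K1) * U + (4 * K2 + 2 * H\<^sup>2) * R * Bb"
proof -
  define f where "f = exp_sum lam a F1"
  define g where "g = exp_sum \<gamma> b F2"
  define u where "u = (\<lambda>t. f t + g t)"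
  have cf: "continuous_on S f" and cg: "continuous_on S g" for S
    unfolding f_def g_def by (intro continuous_intros)+
  have cu: "continuous_on S u" for S unfolding u_def by (intro continuous_intros cf cg)
  have Uu: "U = energy u 0 T" by (simp add: U_def u_def f_def g_def)
  have Bb0: "Bb \<ge> 0" unfolding Bb_def by (intro sum_nonneg) auto
  have X0: "X \<ge> 0" unfolding X_def by (intro sum_nonneg) auto
  define P where "P = exp_sum lam (\<lambda>k. a k * (exp (lam k) - exp \<beta>)) F1"
  define Q where "Q = exp_sum \<gamma> (\<lambda>k. b k * (exp (\<gamma> k) - exp \<beta>)) F2"
  have cP: "continuous_on S P" and cQ: "continuous_on S Q" for S
    unfolding P_def Q_def by (intro continuous_intros)+
  have v: "u (t + 1) - exp \<beta> * u t = P t + Q t" for t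
    unfolding u_def f_def g_def exp_sum_shift P_def Q_def
    by (simp add: exp_sum_def sum_distrib_left sum_subtractf [symmetric] algebra_simps)
      (simp add: sum_subtractf algebra_simps sum.distrib)
  have ev: "energy (\<lambda>t. P t + Q t) 0 (T - 1) \<le> (1 + cmod (exp \<beta>))\<^sup>2 * U"
    using energy_difference_operator[OF cu, of 1 "exp \<beta>" T] unfolding v Uu by simp
  have eQ: "energy Q 0 (T - 1) \<le> (T - 1 - 0) * (H\<^sup>2 * G\<^sup>2 * R * Bb)"
  proof (rule energy_le_const[OF cQ])
    fix t assume t: "0 \<le> t" "t \<le> T - 1"
    have "Q t = (\<Sum>k\<in>F2. b k * ((exp (\<gamma> k) - exp \<beta>) * exp (\<gamma> k * of_real t)))"
      unfolding Q_def exp_sum_def by (simp add: mult_ac)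
    hence "(cmod (Q t))\<^sup>2 \<le> Bb * (\<Sum>k\<in>F2. (cmod ((exp (\<gamma> k) - exp \<beta>) * exp (\<gamma> k * of_real t)))\<^sup>2)"
      unfolding Bb_def using sq_cmod_sum_le by simp
    also have "\<dots> \<le> Bb * (\<Sum>k\<in>F2. (H * cmod (\<nu> k) * G)\<^sup>2)"
    proof (intro mult_left_mono sum_mono power_mono Bb0)
      fix k assume k: "k \<in> F2"
      hence kB: "k \<in> B" using F by auto
      have "cmod (exp (\<gamma> k) - exp \<beta>) \<le> H * cmod (\<nu> k)"
        using pert[OF kB, of 1] T by (simp add: exp_line_freq)
      thus "cmod ((exp (\<gamma> k) - exp \<beta>) * exp (\<gamma> k * of_real t)) \<le> H * cmod (\<nu> k) * G"
        unfolding norm_mult using Gb[OF kB, of t] t H by (intro mult_mono) auto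
    qed auto
    also have "(\<Sum>k\<in>F2. (H * cmod (\<nu> k) * G)\<^sup>2) = H\<^sup>2 * G\<^sup>2 * (\<Sum>k\<in>F2. (cmod (\<nu> k))\<^sup>2)"
      by (simp add: power_mult_distrib sum_distrib_left mult_ac)
    also have "Bb * (H\<^sup>2 * G\<^sup>2 * (\<Sum>k\<in>F2. (cmod (\<nu> k))\<^sup>2)) \<le> Bb * (H\<^sup>2 * G\<^sup>2 * R)"
      using R Bb0 by (intro mult_left_mono) auto
    finally show "(cmod (Q t))\<^sup>2 \<le> H\<^sup>2 * G\<^sup>2 * R * Bb" by (simp add: mult_ac)
  qed (use T in auto)
  have "energy P 0 (T - 1) \<le> 2 * energy (\<lambda>t. P t + Q t) 0 (T - 1) + 2 * energy Q 0 (T - 1)"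
    using energy_diff[of 0 "T - 1" "\<lambda>t. P t + Q t" Q] cP cQ by (simp add: continuous_on_add)
  hence eP: "energy P 0 (T - 1) \<le> 2 * (1 + cmod (exp \<beta>))\<^sup>2 * U + 2 * ((T - 1) * (H\<^sup>2 * G\<^sup>2)) * R * Bb"
    using ev eQ by (simp add: mult_ac)
  have "\<kappa> * X \<le> (\<Sum>k\<in>F1. cmod (a k * (exp (lam k) - exp \<beta>)) * exp (Re (lam k) * (T - 1)))"
    unfolding X_def sum_distrib_left
  proof (rule sum_mono)
    fix k assume "k \<in> F1"
    hence "\<kappa> \<le> cmod (exp (lam k) - exp \<beta>)" using away F by auto
    hence "\<kappa> * (cmod (a k) * exp (Re (lam k) * (T - 1)))
       \<le> cmod (exp (lam k) - exp \<beta>) * (cmod (a k) * exp (Re (lam k) * (T - 1)))"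
      by (rule mult_right_mono) auto
    thus "\<kappa> * (cmod (a k) * exp (Re (lam k) * (T - 1)))
       \<le> cmod (a k * (exp (lam k) - exp \<beta>)) * exp (Re (lam k) * (T - 1))"
      by (simp add: norm_mult mult_ac)
  qed
  hence "(\<kappa> * X)\<^sup>2 \<le> (\<Sum>k\<in>F1. cmod (a k * (exp (lam k) - exp \<beta>)) * exp (Re (lam k) * (T - 1)))\<^sup>2"
    using away X0 by (intro power_mono) auto
  also have "\<dots> \<le> C3 * energy P 0 (T - 1)" unfolding P_def by (rule par(2)[OF F(1,2)])
  also have "\<dots> \<le> C3 * (2 * (1 + cmod (exp \<beta>))\<^sup>2 * U + 2 * ((T - 1) * (H\<^sup>2 * G\<^sup>2)) * R * Bb)"
    using eP par(1) by (intro mult_left_mono) auto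
  finally have "X\<^sup>2 \<le> C3 * (2 * (1 + cmod (exp \<beta>))\<^sup>2 * U + 2 * ((T - 1) * (H\<^sup>2 * G\<^sup>2)) * R * Bb) / \<kappa>\<^sup>2"
    using away(1) by (simp add: power_mult_distrib field_simps)
  also have "\<dots> = K1 * U + K2 * R * Bb"
    by (simp add: K1_def K2_def distrib_left add_divide_distrib)
  finally have X: "X\<^sup>2 \<le> K1 * U + K2 * R * Bb" .
  have ef: "energy f (T - 1) T \<le> (T - (T - 1)) * X\<^sup>2"
  proof (rule energy_le_const[OF cf])
    fix t assume t: "T - 1 \<le> t" "t \<le> T"
    have "cmod (f t) \<le> (\<Sum>k\<in>F1. cmod (a k * exp (lam k * of_real t)))"
      unfolding f_def exp_sum_def by (rule norm_sum)
    also have "\<dots> \<le> X"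
      unfolding X_def
    proof (rule sum_mono)
      fix k assume "k \<in> F1"
      hence "Re (lam k) * t \<le> Re (lam k) * (T - 1)" using neg F t by (intro mult_left_mono_neg) auto
      thus "cmod (a k * exp (lam k * of_real t)) \<le> cmod (a k) * exp (Re (lam k) * (T - 1))"
        by (simp add: norm_mult mult_left_mono)
    qed
    finally show "(cmod (f t))\<^sup>2 \<le> X\<^sup>2" by (rule power_mono) simp
  qed simp
  define w where "w = exp_sum (line_freq \<beta>) b F2"
  have cw: "continuous_on S w" for S unfolding w_def by (intro continuous_intros)
  have ed: "energy (\<lambda>t. g t - w t) (T - 1) T \<le> (T - (T - 1)) * (H\<^sup>2 * R * Bb)"
  proof (rule energy_le_const)
    fix t assume t: "T - 1 \<le> t" "t \<le> T"
    have "(cmod (g t - w t))\<^sup>2 \<le> H\<^sup>2 * (\<Sum>k\<in>F2. (cmod (\<nu> k))\<^sup>2) * Bb"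
      unfolding g_def w_def Bb_def using t T by (intro pert_sum F) auto
    also have "\<dots> \<le> H\<^sup>2 * R * Bb" by (intro mult_right_mono mult_left_mono R Bb0) auto
    finally show "(cmod (g t - w t))\<^sup>2 \<le> H\<^sup>2 * R * Bb" .
  qed (auto intro!: continuous_intros cg cw)
  have "energy g (T - 1) T \<le> 2 * energy u (T - 1) T + 2 * energy f (T - 1) T"
    using energy_diff[OF cu cf, of "T - 1" T] by (simp add: u_def)
  moreover have "energy u (T - 1) T \<le> U" unfolding Uu by (rule energy_subset[OF cu]) (use T in auto)
  ultimately have eg: "energy g (T - 1) T \<le> 2 * U + 2 * X\<^sup>2" using ef by simp
  have "energy w (T - 1) T \<le> 2 * energy g (T - 1) T + 2 * energy (\<lambda>t. g t - w t) (T - 1) T"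
    using energy_diff[of "T - 1" T g "\<lambda>t. g t - w t"] cg cw by (simp add: continuous_on_diff)
  also have "\<dots> \<le> 2 * (2 * U + 2 * (K1 * U + K2 * R * Bb)) + 2 * (H\<^sup>2 * R * Bb)"
    using eg X ed by (intro add_mono mult_left_mono) auto
  also have "\<dots> = (4 + 4 * K1) * U + (4 * K2 + 2 * H\<^sup>2) * R * Bb" by (simp add: algebra_simps)
  finally have "energy w (T - 1) T \<le> (4 + 4 * K1) * U + (4 * K2 + 2 * H\<^sup>2) * R * Bb" .
  moreover have "exp (- 2 * \<bar>Re \<beta>\<bar> * T) * Bb \<le> energy w (T - 1) T"
    using energy_line_freq_ge[OF F(3), of "T - 1" \<beta> b] T unfolding w_def Bb_def by simp
  ultimately have "exp (- 2 * \<bar>Re \<beta>\<bar> * T) * Bb \<le> (4 + 4 * K1) * U + (4 * K2 + 2 * H\<^sup>2) * R * Bb"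
    by linarith
  with X show ?thesis by blast
qed

text \<open>
  For large \<open>k\<close> the multiplier \<open>exp (\<lambda> k) - exp \<beta>\<close> is at least \<open>|exp \<beta>| / 2\<close>, and the tails of
  \<open>\<nu>\<close> are as small as the absorption in the preceding estimate requires.
\<close>

lemma tail_observable:
  fixes lam :: "nat \<Rightarrow> complex" and \<gamma> \<nu> :: "int \<Rightarrow> complex" and r c1 c2 \<delta> T :: real
  assumes "r > 1" "c1 > 0" "\<delta> > 0" "N \<ge> 1" and T: "T > 1"
    and lower: "\<And>k. k \<ge> N \<Longrightarrow> c1 * real k powr r \<le> - Re (lam k)"
    and upper: "\<And>k. k \<ge> N \<Longrightarrow> - Re (lam k) \<le> c2 * real k powr r"
    and gap: "\<And>k j. k \<ge> N \<Longrightarrow> j \<ge> N \<Longrightarrow> k \<noteq> j \<Longrightarrow> \<delta> \<le> cmod (lam k - lam j)"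
    and \<gamma>: "\<And>k. \<bar>k\<bar> \<ge> int N \<Longrightarrow> \<gamma> k = line_freq \<beta> k + \<nu> k"
    and \<nu>: "ell2_on {k. \<bar>k\<bar> \<ge> int N} \<nu>"
  shows "\<exists>M\<ge>N. observable (case_sum lam \<gamma>) (Inl ` {M..} \<union> Inr ` {k. \<bar>k\<bar> \<ge> int M}) T"
proof -
  define D where "D = {k::int. \<bar>k\<bar> \<ge> int N}"
  have neg: "Re (lam k) \<le> 0" if "k \<ge> N" for k
  proof -
    have "0 \<le> c1 * real k powr r" using assms(2) by simp
    thus ?thesis using lower[OF that] by linarith
  qed
  have "\<exists>C>0. \<forall>F a. finite F \<longrightarrow> F \<subseteq> {N..} \<longrightarrow>
     (\<Sum>k\<in>F. cmod (a k) * exp (Re (lam k) * (T - 1)))\<^sup>2 \<le> C * energy (exp_sum lam a F) 0 (T - 1)"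
    by (rule parabolic_observability[of r c1 \<delta> "T - 1" N lam c2]) (use assms in auto)
  then obtain C3 where C3: "C3 > 0" "\<And>F a. finite F \<Longrightarrow> F \<subseteq> {N..} \<Longrightarrow>
     (\<Sum>k\<in>F. cmod (a k) * exp (Re (lam k) * (T - 1)))\<^sup>2 \<le> C3 * energy (exp_sum lam a F) 0 (T - 1)"
    by blast
  define \<kappa> where "\<kappa> = cmod (exp \<beta>) / 2"
  have \<kappa>: "\<kappa> > 0" by (simp add: \<kappa>_def)
  obtain M1 where M1: "M1 \<ge> N" "\<And>k. k \<ge> M1 \<Longrightarrow> \<kappa> \<le> cmod (exp (lam k) - exp \<beta>)"
  proof -
    have "(\<lambda>k::nat. exp (- c1 * real k powr r)) \<longlonglongrightarrow> 0" using assms(1,2) by real_asymp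
    hence "eventually (\<lambda>k. exp (- c1 * real k powr r) < \<kappa>) sequentially"
      using \<kappa> by (rule order_tendstoD)
    then obtain n where n: "\<And>k. k \<ge> n \<Longrightarrow> exp (- c1 * real k powr r) < \<kappa>"
      unfolding eventually_sequentially by blast
    show ?thesis
    proof (rule that[of "max n N"])
      fix k assume k: "k \<ge> max n N"
      have "cmod (exp (lam k)) \<le> exp (- c1 * real k powr r)" using lower[of k] k by simp
      also have "\<dots> < \<kappa>" using n k by simp
      finally have "cmod (exp (lam k)) < \<kappa>" .
      moreover have "cmod (exp \<beta>) \<le> cmod (exp (lam k) - exp \<beta>) + cmod (exp (lam k))"
        using norm_triangle_sub[of "exp \<beta>" "exp (lam k)"] by (simp add: norm_minus_commute add.commute)
      ultimately show "\<kappa> \<le> cmod (exp (lam k) - exp \<beta>)" by (simp add: \<kappa>_def)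
    qed simp
  qed
  have \<gamma>D: "\<And>k. k \<in> D \<Longrightarrow> \<gamma> k = line_freq \<beta> k + \<nu> k" using \<gamma> by (simp add: D_def)
  show ?thesis
  proof (rule hyperbolic_perturbation[of D \<gamma> \<beta> \<nu> T])
    show "\<And>k. k \<in> D \<Longrightarrow> \<gamma> k = line_freq \<beta> k + \<nu> k" by (rule \<gamma>D)
    show "ell2_on D \<nu>" using \<nu> by (simp add: D_def)
    show "0 \<le> T" using T by simp
    fix H G
    assume H: "H \<ge> 0" and G: "G \<ge> 0" and
      pert: "\<And>k t. k \<in> D \<Longrightarrow> 0 \<le> t \<Longrightarrow> t \<le> T \<Longrightarrow>
       cmod (exp (\<gamma> k * of_real t) - exp (line_freq \<beta> k * of_real t)) \<le> H * cmod (\<nu> k)" and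
      Gb: "\<And>k t. k \<in> D \<Longrightarrow> 0 \<le> t \<Longrightarrow> t \<le> T \<Longrightarrow> cmod (exp (\<gamma> k * of_real t)) \<le> G" and
      pert_sum: "\<And>F b t. finite F \<Longrightarrow> F \<subseteq> D \<Longrightarrow> 0 \<le> t \<Longrightarrow> t \<le> T \<Longrightarrow>
       (cmod (exp_sum \<gamma> b F t - exp_sum (line_freq \<beta>) b F t))\<^sup>2
         \<le> H\<^sup>2 * (\<Sum>k\<in>F. (cmod (\<nu> k))\<^sup>2) * (\<Sum>k\<in>F. (cmod (b k))\<^sup>2)"
    define K1 where "K1 = C3 / \<kappa>\<^sup>2 * (2 * (1 + cmod (exp \<beta>))\<^sup>2)"
    define K2 where "K2 = C3 / \<kappa>\<^sup>2 * (2 * ((T - 1) * (H\<^sup>2 * G\<^sup>2)))"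
    define \<omega> where "\<omega> = exp (- 2 * \<bar>Re \<beta>\<bar> * T)"
    \<comment> \<open>small enough to absorb the error terms into half of the left-hand side\<close>
    define \<rho> where "\<rho> = \<omega> / (2 * (4 * K2 + 2 * H\<^sup>2 + 1))"
    define K4 where "K4 = (2 / \<omega>) * (4 + 4 * K1)"
    have K: "K1 \<ge> 0" "K2 \<ge> 0" using C3 T by (auto simp: K1_def K2_def)
    have \<omega>: "\<omega> > 0" by (simp add: \<omega>_def)
    have K3: "4 * K2 + 2 * H\<^sup>2 + 1 > 0" using K by (intro add_nonneg_pos) auto
    have \<rho>: "\<rho> > 0" using \<omega> K3 unfolding \<rho>_def by (intro divide_pos_pos) auto
    have K4: "K4 \<ge> 0" using \<omega> K by (simp add: K4_def)
    have \<rho>\<omega>: "(4 * K2 + 2 * H\<^sup>2) * \<rho> \<le> \<omega> / 2"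
    proof -
      have "(4 * K2 + 2 * H\<^sup>2) * \<rho> \<le> (4 * K2 + 2 * H\<^sup>2 + 1) * \<rho>"
        using \<rho> by (intro mult_right_mono) auto
      also have "\<dots> = \<omega> / 2"
      proof -
        have "P * (\<omega> / (2 * P)) = \<omega> / 2" if "P > 0" for P :: real using that by simp
        from this[OF K3] show ?thesis unfolding \<rho>_def .
      qed
      finally show ?thesis .
    qed
    show ?thesis
    proof (rule ell2_on_tail[OF \<nu> \<rho>])
      fix M2
      assume M2: "N \<le> M2" "\<And>F. finite F \<Longrightarrow> F \<subseteq> {k. int M2 \<le> \<bar>k\<bar>} \<Longrightarrow> (\<Sum>k\<in>F. (cmod (\<nu> k))\<^sup>2) \<le> \<rho>"
      define M where "M = max M1 M2"
      have M: "M \<ge> N" using M1 by (simp add: M_def)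
      define KK where "KK = K1 + K2 * \<rho> * K4 + G\<^sup>2 * K4 + 1"
      have KK: "KK > 0" unfolding KK_def using K K4 \<rho> by (intro add_nonneg_pos add_nonneg_nonneg) auto
      have "1 / KK * (\<Sum>i\<in>F. (cmod (c i))\<^sup>2 * exp (2 * Re (case_sum lam \<gamma> i) * T))
          \<le> energy (exp_sum (case_sum lam \<gamma>) c F) 0 T"
        if F: "finite F" "F \<subseteq> Inl ` {M..} \<union> Inr ` {k. \<bar>k\<bar> \<ge> int M}" for F c
      proof (rule finite_sum_index_split[OF F])
        fix F1 F2
        assume F12: "finite F1" "finite F2" "F1 \<subseteq> {M..}" "F2 \<subseteq> {k. \<bar>k\<bar> \<ge> int M}" "F = Inl ` F1 \<union> Inr ` F2"
        define a where "a = (\<lambda>k. c (Inl k))"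
        define b where "b = (\<lambda>k. c (Inr k))"
        define U where "U = energy (exp_sum (case_sum lam \<gamma>) c F) 0 T"
        have U: "U = energy (\<lambda>t. exp_sum lam a F1 t + exp_sum \<gamma> b F2 t) 0 T"
          unfolding U_def F12(5) a_def b_def exp_sum_case_sum[OF F12(1,2), abs_def] ..
        have U0: "U \<ge> 0" unfolding U_def by (rule energy_nonneg)
        define Bb where "Bb = (\<Sum>k\<in>F2. (cmod (b k))\<^sup>2)"
        have Bb0: "Bb \<ge> 0" unfolding Bb_def by (intro sum_nonneg) auto
        define X where "X = (\<Sum>k\<in>F1. cmod (a k) * exp (Re (lam k) * (T - 1)))"
        have F1: "F1 \<subseteq> {M..}" and F1N: "k \<in> {M..} \<Longrightarrow> k \<ge> N" for k using F12 M by auto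
        have F2: "F2 \<subseteq> {k. int M2 \<le> \<bar>k\<bar>}" "F2 \<subseteq> D" using F12(4) M unfolding D_def by (auto simp: M_def)
        have est: "X\<^sup>2 \<le> K1 * U + K2 * \<rho> * Bb
          \<and> \<omega> * Bb \<le> (4 + 4 * K1) * U + (4 * K2 + 2 * H\<^sup>2) * \<rho> * Bb"
          unfolding U X_def Bb_def K1_def K2_def \<omega>_def
        proof (rule tail_estimate[where A = "{M..}" and B = D and \<nu> = \<nu>])
          show "\<And>k. k \<in> {M..} \<Longrightarrow> Re (lam k) \<le> 0" using neg M by auto
          show "\<And>k. k \<in> {M..} \<Longrightarrow> \<kappa> \<le> cmod (exp (lam k) - exp \<beta>)" using M1(2) by (auto simp: M_def)
          show "\<And>F a. finite F \<Longrightarrow> F \<subseteq> {M..} \<Longrightarrow>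
            (\<Sum>k\<in>F. cmod (a k) * exp (Re (lam k) * (T - 1)))\<^sup>2 \<le> C3 * energy (exp_sum lam a F) 0 (T - 1)"
            using M by (intro C3(2)) auto
          show "(\<Sum>k\<in>F2. (cmod (\<nu> k))\<^sup>2) \<le> \<rho>" by (rule M2(2)[OF F12(2) F2(1)])
        qed (fact T \<kappa> C3(1) H G pert Gb pert_sum F12 F1 F2)+
        have "(4 * K2 + 2 * H\<^sup>2) * \<rho> * Bb \<le> \<omega> / 2 * Bb" by (rule mult_right_mono[OF \<rho>\<omega> Bb0])
        hence "\<omega> / 2 * Bb \<le> (4 + 4 * K1) * U" using est by simp
        hence B: "Bb \<le> K4 * U" using \<omega> by (simp add: K4_def field_simps)
        have "K2 * \<rho> * Bb \<le> K2 * \<rho> * (K4 * U)" using B K \<rho> by (intro mult_left_mono) auto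
        hence X: "X\<^sup>2 \<le> (K1 + K2 * \<rho> * K4) * U" using est by (simp add: algebra_simps)
        have sa: "(\<Sum>k\<in>F1. (cmod (a k))\<^sup>2 * exp (2 * Re (lam k) * T)) \<le> X\<^sup>2"
        proof -
          have "(\<Sum>k\<in>F1. (cmod (a k))\<^sup>2 * exp (2 * Re (lam k) * T))
             \<le> (\<Sum>k\<in>F1. (cmod (a k) * exp (Re (lam k) * (T - 1)))\<^sup>2)"
          proof (rule sum_mono)
            fix k assume "k \<in> F1"
            hence "Re (lam k) * T \<le> Re (lam k) * (T - 1)"
              using neg[of k] F1 F1N by (intro mult_left_mono_neg) auto
            hence "exp (2 * Re (lam k) * T) \<le> (exp (Re (lam k) * (T - 1)))\<^sup>2"
              unfolding exp_double [symmetric] by simp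
            thus "(cmod (a k))\<^sup>2 * exp (2 * Re (lam k) * T) \<le> (cmod (a k) * exp (Re (lam k) * (T - 1)))\<^sup>2"
              unfolding power_mult_distrib by (rule mult_left_mono) simp
          qed
          also have "\<dots> \<le> X\<^sup>2" unfolding X_def
            by (rule sum_squares_le_square_sum) (use F12 in auto)
          finally show ?thesis .
        qed
        have sb: "(\<Sum>k\<in>F2. (cmod (b k))\<^sup>2 * exp (2 * Re (\<gamma> k) * T)) \<le> G\<^sup>2 * Bb"
        proof -
          have "(\<Sum>k\<in>F2. (cmod (b k))\<^sup>2 * exp (2 * Re (\<gamma> k) * T)) \<le> (\<Sum>k\<in>F2. (cmod (b k))\<^sup>2 * G\<^sup>2)"
          proof (intro sum_mono mult_left_mono)
            fix k assume "k \<in> F2"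
            hence "exp (Re (\<gamma> k) * T) \<le> G" using Gb[of k T] F2 T by auto
            hence "(exp (Re (\<gamma> k) * T))\<^sup>2 \<le> G\<^sup>2" by (rule power_mono) simp
            thus "exp (2 * Re (\<gamma> k) * T) \<le> G\<^sup>2" by (simp add: exp_double [symmetric] mult_ac)
          qed auto
          thus ?thesis by (simp add: Bb_def sum_distrib_left mult_ac)
        qed
        have "G\<^sup>2 * Bb \<le> G\<^sup>2 * (K4 * U)" by (intro mult_left_mono B) auto
        moreover have "(\<Sum>i\<in>F. (cmod (c i))\<^sup>2 * exp (2 * Re (case_sum lam \<gamma> i) * T))
           = (\<Sum>k\<in>F1. (cmod (a k))\<^sup>2 * exp (2 * Re (lam k) * T)) + (\<Sum>k\<in>F2. (cmod (b k))\<^sup>2 * exp (2 * Re (\<gamma> k) * T))"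
          unfolding F12(5) using F12
          by (subst sum.union_disjoint) (auto simp: sum.reindex a_def b_def)
        ultimately have "(\<Sum>i\<in>F. (cmod (c i))\<^sup>2 * exp (2 * Re (case_sum lam \<gamma> i) * T)) \<le> KK * U"
          using sa sb X U0 by (simp add: KK_def algebra_simps)
        thus ?thesis using KK unfolding U_def by (simp add: field_simps)
      qed
      hence "observable (case_sum lam \<gamma>) (Inl ` {M..} \<union> Inr ` {k. \<bar>k\<bar> \<ge> int M}) T"
        unfolding observable_def using KK by (intro exI[of _ "1 / KK"]) auto
      thus ?thesis using M by blast
    qed
  qed
qed

section \<open>Infinite sums in the mean square\<close>

lemma square_integrable_add:
  assumes "square_integrable T f" "square_integrable T g"
  shows "square_integrable T (\<lambda>t. f t + g t)"
    and "(\<integral>t. (cmod (f t + g t))\<^sup>2 \<partial>lebesgue_on {0..T})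
       \<le> 2 * (\<integral>t. (cmod (f t))\<^sup>2 \<partial>lebesgue_on {0..T}) + 2 * (\<integral>t. (cmod (g t))\<^sup>2 \<partial>lebesgue_on {0..T})"
proof -
  let ?M = "lebesgue_on {0..T}"
  have m: "f \<in> borel_measurable ?M" "g \<in> borel_measurable ?M"
    and i: "integrable ?M (\<lambda>t. (cmod (f t))\<^sup>2)" "integrable ?M (\<lambda>t. (cmod (g t))\<^sup>2)"
    using assms unfolding square_integrable_def by auto
  have m2: "(\<lambda>t. f t + g t) \<in> borel_measurable ?M" using m by simp
  have ii: "integrable ?M (\<lambda>t. 2 * (cmod (f t))\<^sup>2 + 2 * (cmod (g t))\<^sup>2)" using i by simp
  have int: "integrable ?M (\<lambda>t. (cmod (f t + g t))\<^sup>2)"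
    by (rule Bochner_Integration.integrable_bound[OF ii]) (use m2 sq_cmod_add in \<open>auto\<close>)
  thus "square_integrable T (\<lambda>t. f t + g t)" using m2 unfolding square_integrable_def by simp
  have "(\<integral>t. (cmod (f t + g t))\<^sup>2 \<partial>?M) \<le> (\<integral>t. 2 * (cmod (f t))\<^sup>2 + 2 * (cmod (g t))\<^sup>2 \<partial>?M)"
    by (rule integral_mono[OF int ii]) (rule sq_cmod_add)
  thus "(\<integral>t. (cmod (f t + g t))\<^sup>2 \<partial>?M) \<le> 2 * (\<integral>t. (cmod (f t))\<^sup>2 \<partial>?M) + 2 * (\<integral>t. (cmod (g t))\<^sup>2 \<partial>?M)"
    using i by simp
qed

lemma square_integrable_minus:
  "square_integrable T f \<Longrightarrow> square_integrable T (\<lambda>t. - f t)"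
  unfolding square_integrable_def by simp

lemma square_integrable_exp_sum: "square_integrable T (exp_sum e c F)"
  unfolding square_integrable_def
  by (intro conjI continuous_imp_measurable_on_sets_lebesgue continuous_imp_integrable_real
      continuous_intros) auto

lemma integral_exp_sum_eq_energy:
  "(\<integral>t. (cmod (exp_sum e c F t))\<^sup>2 \<partial>lebesgue_on {0..T}) = energy (exp_sum e c F) 0 T"
  unfolding energy_def
  using square_integrable_exp_sum[of T e c F] unfolding square_integrable_def
  by (intro lebesgue_integral_eq_integral) auto

lemma nn_integral_exp_sum_eq_energy:
  "(\<integral>\<^sup>+t. ennreal ((cmod (exp_sum e c F t))\<^sup>2) \<partial>lebesgue_on {0..T}) = ennreal (energy (exp_sum e c F) 0 T)"
  using square_integrable_exp_sum[of T e c F] unfolding square_integrable_def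
  by (subst nn_integral_eq_integral) (auto simp: integral_exp_sum_eq_energy)

text \<open>
  Lower semicontinuity of the \<open>L\<^sup>2\<close> norm under almost everywhere convergence.
\<close>

lemma Fatou_sq:
  fixes h :: "nat \<Rightarrow> 'a \<Rightarrow> complex"
  assumes [measurable]: "\<And>n. h n \<in> borel_measurable M"
    and lim: "AE x in M. (\<lambda>n. h n x) \<longlonglongrightarrow> l x"
    and le: "\<And>n. n \<ge> m \<Longrightarrow> (\<integral>\<^sup>+x. ennreal ((cmod (h n x))\<^sup>2) \<partial>M) \<le> B"
  shows "(\<integral>\<^sup>+x. ennreal ((cmod (l x))\<^sup>2) \<partial>M) \<le> B"
proof -
  have "(\<integral>\<^sup>+x. ennreal ((cmod (l x))\<^sup>2) \<partial>M) = (\<integral>\<^sup>+x. liminf (\<lambda>n. ennreal ((cmod (h n x))\<^sup>2)) \<partial>M)"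
  proof (rule nn_integral_cong_AE)
    show "AE x in M. ennreal ((cmod (l x))\<^sup>2) = liminf (\<lambda>n. ennreal ((cmod (h n x))\<^sup>2))"
      using lim
    proof eventually_elim
      case (elim x)
      hence "(\<lambda>n. ennreal ((cmod (h n x))\<^sup>2)) \<longlonglongrightarrow> ennreal ((cmod (l x))\<^sup>2)"
        by (intro tendsto_intros)
      thus ?case by (rule lim_imp_Liminf [symmetric, rotated]) simp
    qed
  qed
  also have "\<dots> \<le> liminf (\<lambda>n. \<integral>\<^sup>+x. ennreal ((cmod (h n x))\<^sup>2) \<partial>M)"
    by (rule nn_integral_liminf) simp
  also have "\<dots> \<le> liminf (\<lambda>n. B)"
    by (rule Liminf_mono) (auto simp: eventually_sequentially intro!: exI[of _ m] le)
  finally show ?thesis by (simp add: Liminf_const)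
qed

text \<open>
  Partial sums over two sets that both contain \<open>A\<close> differ by a sum over indices outside \<open>A\<close>,
  so Bessel's inequality makes the partial sums a Cauchy net.
\<close>

lemma bessel_symm_diff:
  assumes "K \<ge> 0" and bes: "\<And>F c. finite F \<Longrightarrow> F \<subseteq> I \<Longrightarrow> energy (exp_sum e c F) 0 T \<le> K * (\<Sum>i\<in>F. (cmod (c i))\<^sup>2)"
    and F: "finite F" "F \<subseteq> I" and G: "finite G" "G \<subseteq> I"
    and A: "A \<subseteq> F" "A \<subseteq> G" and tail: "\<And>S. finite S \<Longrightarrow> S \<subseteq> I - A \<Longrightarrow> (\<Sum>i\<in>S. (cmod (c i))\<^sup>2) \<le> \<epsilon>"
  shows "\<exists>c' S. energy (exp_sum e c' S) 0 T \<le> K * \<epsilon> \<and> (\<forall>t. exp_sum e c F t - exp_sum e c G t = exp_sum e c' S t)"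
proof -
  define S where "S = (F - G) \<union> (G - F)"
  define c' where "c' = (\<lambda>i. if i \<in> F then c i else - c i)"
  have fS: "finite S" "S \<subseteq> I" "S \<subseteq> I - A" using F G A by (auto simp: S_def)
  have "exp_sum e c F t - exp_sum e c G t = exp_sum e c' S t" for t
  proof -
    have "exp_sum e c F t = exp_sum e c (F \<inter> G) t + exp_sum e c (F - G) t"
      unfolding exp_sum_def by (rule sum.Int_Diff[OF F(1)])
    moreover have "exp_sum e c G t = exp_sum e c (F \<inter> G) t + exp_sum e c (G - F) t"
      unfolding exp_sum_def by (subst sum.Int_Diff[OF G(1), of _ F]) (simp add: Int_commute)
    moreover have "exp_sum e c' S t = exp_sum e c' (F - G) t + exp_sum e c' (G - F) t"
      unfolding S_def using F G by (intro exp_sum_Un) auto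
    moreover have "exp_sum e c' (F - G) t = exp_sum e c (F - G) t"
      unfolding exp_sum_def by (intro sum.cong) (auto simp: c'_def)
    moreover have "exp_sum e c' (G - F) t = - exp_sum e c (G - F) t"
      unfolding exp_sum_def sum_negf [symmetric] by (intro sum.cong) (auto simp: c'_def)
    ultimately show ?thesis by simp
  qed
  moreover have "energy (exp_sum e c' S) 0 T \<le> K * \<epsilon>"
  proof -
    have "energy (exp_sum e c' S) 0 T \<le> K * (\<Sum>i\<in>S. (cmod (c' i))\<^sup>2)" by (rule bes[OF fS(1,2)])
    also have "(\<Sum>i\<in>S. (cmod (c' i))\<^sup>2) = (\<Sum>i\<in>S. (cmod (c i))\<^sup>2)"
      by (intro sum.cong) (auto simp: c'_def)
    also have "K * \<dots> \<le> K * \<epsilon>" by (intro mult_left_mono tail fS assms(1))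
    finally show ?thesis .
  qed
  ultimately show ?thesis by blast
qed

lemma ell2_on_exhaustion:
  assumes "ell2_on I c"
  obtains A where "\<And>n::nat. finite (A n)" "\<And>n. A n \<subseteq> I" "\<And>m n. m \<le> n \<Longrightarrow> A m \<subseteq> A n"
    "\<And>n S. finite S \<Longrightarrow> S \<subseteq> I - A n \<Longrightarrow> (\<Sum>i\<in>S. (cmod (c i))\<^sup>2) \<le> (1/4) ^ n"
proof -
  define q where "q = (\<lambda>i. (cmod (c i))\<^sup>2)"
  have sm: "q summable_on I" using assms unfolding ell2_on_def q_def .
  have "\<exists>G. finite G \<and> G \<subseteq> I \<and> infsum q I - (1/4) ^ n < sum q G" for n :: nat
  proof -
    have "eventually (\<lambda>F. infsum q I - (1/4) ^ n < sum q F) (finite_subsets_at_top I)"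
      using infsum_tendsto[OF sm] by (intro order_tendstoD(1)[of _ "infsum q I"]) auto
    thus ?thesis unfolding eventually_finite_subsets_at_top by blast
  qed
  then obtain G where G: "\<And>n. finite (G n)" "\<And>n. G n \<subseteq> I" "\<And>n::nat. infsum q I - (1/4) ^ n < sum q (G n)"
    by metis
  define A where "A = (\<lambda>n. \<Union>m\<le>n. G m)"
  have A: "finite (A n)" "A n \<subseteq> I" for n using G by (auto simp: A_def)
  show ?thesis
  proof (rule that[of A])
    show "A m \<subseteq> A n" if "m \<le> n" for m n using that unfolding A_def by (intro UN_mono) auto
    fix n S assume S: "finite S" "S \<subseteq> I - A n"
    have "sum q (G n) \<le> sum q (A n)" using A by (intro sum_mono2) (auto simp: A_def q_def)
    moreover have "sum q (A n) + sum q S = sum q (A n \<union> S)"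
      using S A by (subst sum.union_disjoint) auto
    moreover have "sum q (A n \<union> S) \<le> infsum q I"
      using S A by (intro finite_sum_le_infsum sm) (auto simp: q_def)
    ultimately show "(\<Sum>i\<in>S. (cmod (c i))\<^sup>2) \<le> (1/4) ^ n" using G(3)[of n] unfolding q_def by linarith
  qed (use A in auto)
qed

text \<open>
  Completeness of \<open>L\<^sup>2\<close>, for the net of partial sums. Along the exhaustion \<open>A n\<close> consecutive
  partial sums differ by \<open>O(4\<^bsup>-n\<^esup>)\<close> in squared norm, so the series of differences converges
  almost everywhere; Fatou's lemma identifies its sum as the limit in the mean of the whole net.
\<close>

lemma Riesz_Fischer:
  assumes "bessel e I T" "ell2_on I c"
  shows "\<exists>f. has_L2_sum T (\<lambda>k t. c k * exp (e k * of_real t)) I f"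
proof (rule ell2_on_exhaustion[OF assms(2)])
  fix A
  assume A: "\<And>n::nat. finite (A n)" "\<And>n. A n \<subseteq> I" "\<And>m n. m \<le> n \<Longrightarrow> A m \<subseteq> A n"
    and tail: "\<And>n S. finite S \<Longrightarrow> S \<subseteq> I - A n \<Longrightarrow> (\<Sum>i\<in>S. (cmod (c i))\<^sup>2) \<le> (1/4) ^ n"
  let ?M = "lebesgue_on {0..T}"
  obtain K where K: "K \<ge> 0" "\<And>F c. finite F \<Longrightarrow> F \<subseteq> I \<Longrightarrow>
      energy (exp_sum e c F) 0 T \<le> K * (\<Sum>i\<in>F. (cmod (c i))\<^sup>2)"
    using assms(1) unfolding bessel_def by blast
  define s where "s = (\<lambda>n. exp_sum e c (A n))"
  have ms [measurable]: "exp_sum e c' F \<in> borel_measurable ?M" for c' F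
    using square_integrable_exp_sum unfolding square_integrable_def by blast
  have ms' [measurable]: "s n \<in> borel_measurable ?M" for n unfolding s_def by (rule ms)
  have diff: "(\<integral>\<^sup>+t. ennreal ((cmod (exp_sum e c F t - exp_sum e c G t))\<^sup>2) \<partial>?M) \<le> ennreal (K * (1/4) ^ n)"
    if FG: "finite F" "F \<subseteq> I" "finite G" "G \<subseteq> I" "A n \<subseteq> F" "A n \<subseteq> G" for F G n
  proof -
    have "\<exists>c' S. energy (exp_sum e c' S) 0 T \<le> K * (1/4) ^ n
        \<and> (\<forall>t. exp_sum e c F t - exp_sum e c G t = exp_sum e c' S t)"
      by (rule bessel_symm_diff[of K I e T F G "A n" c]) (fact K FG tail)+
    then obtain c' S where "energy (exp_sum e c' S) 0 T \<le> K * (1/4) ^ n"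
      "\<And>t. exp_sum e c F t - exp_sum e c G t = exp_sum e c' S t"
      by blast
    thus ?thesis by (simp add: nn_integral_exp_sum_eq_energy ennreal_leI)
  qed
  define d where "d = (\<lambda>n t. s (Suc n) t - s n t)"
  have md [measurable]: "d n \<in> borel_measurable ?M" for n unfolding d_def by measurable
  have "(\<integral>\<^sup>+t. (\<Sum>n. ennreal (2 ^ n * (cmod (d n t))\<^sup>2)) \<partial>?M)
      = (\<Sum>n. \<integral>\<^sup>+t. ennreal (2 ^ n * (cmod (d n t))\<^sup>2) \<partial>?M)"
    by (rule nn_integral_suminf) measurable
  also have "\<dots> \<le> (\<Sum>n. ennreal (K * (1/2) ^ n))"
  proof (intro suminf_le allI)
    fix n
    have "(\<integral>\<^sup>+t. ennreal (2 ^ n * (cmod (d n t))\<^sup>2) \<partial>?M) = ennreal (2 ^ n) * (\<integral>\<^sup>+t. ennreal ((cmod (d n t))\<^sup>2) \<partial>?M)"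
      by (simp add: ennreal_mult nn_integral_cmult)
    also have "\<dots> \<le> ennreal (2 ^ n) * ennreal (K * (1/4) ^ n)"
      unfolding d_def s_def using A by (intro mult_left_mono diff) auto
    also have "\<dots> = ennreal (K * (1/2) ^ n)"
      using K by (simp add: ennreal_mult [symmetric] power_divide power_mult_distrib [symmetric] field_simps)
    finally show "(\<integral>\<^sup>+t. ennreal (2 ^ n * (cmod (d n t))\<^sup>2) \<partial>?M) \<le> ennreal (K * (1/2) ^ n)" .
  qed auto
  also have "\<dots> < \<infinity>"
  proof -
    have "summable (\<lambda>n. K * (1/2) ^ n)" by (intro summable_mult summable_geometric) auto
    hence "(\<Sum>n. ennreal (K * (1/2) ^ n)) = ennreal (\<Sum>n. K * (1/2) ^ n)"
      using K by (intro suminf_ennreal2) auto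
    thus ?thesis by simp
  qed
  finally have fin: "(\<integral>\<^sup>+t. (\<Sum>n. ennreal (2 ^ n * (cmod (d n t))\<^sup>2)) \<partial>?M) \<noteq> \<infinity>" by simp
  have AEfin: "AE t in ?M. (\<Sum>n. ennreal (2 ^ n * (cmod (d n t))\<^sup>2)) \<noteq> \<infinity>"
    by (rule nn_integral_PInf_AE[OF _ fin]) measurable
  define f where "f = (\<lambda>t. lim (\<lambda>n. s n t))"
  have mf [measurable]: "f \<in> borel_measurable ?M" unfolding f_def
    by (rule borel_measurable_lim_metric) measurable
  have lim: "AE t in ?M. (\<lambda>n. s n t) \<longlonglongrightarrow> f t"
    using AEfin
  proof eventually_elim
    case (elim t)
    hence "summable (\<lambda>n. 2 ^ n * (cmod (d n t))\<^sup>2)"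
      by (intro summable_suminf_not_top) (auto simp: top_ennreal_def)
    moreover have "summable (\<lambda>n. (1/2::real) ^ n)" by (rule summable_geometric) simp
    ultimately have "summable (\<lambda>n. (1/2) ^ n + 2 ^ n * (cmod (d n t))\<^sup>2)" by (rule summable_add[rotated])
    hence "summable (\<lambda>n. d n t)"
    proof (rule summable_comparison_test[rotated], intro exI[of _ 0] allI impI)
      fix n :: nat
      define x where "x = cmod (d n t)"
      define y :: real where "y = 2 ^ n"
      have y: "y > 0" "(1/2) ^ n = 1 / y" by (auto simp: y_def power_divide)
      \<comment> \<open>amounts to \<open>x \<le> 1 / y + y x\<^sup>2\<close>, which trades absolute for square summability\<close>
      have "0 \<le> (y * x - 1)\<^sup>2 + y * x" using y by (intro add_nonneg_nonneg) (auto simp: x_def)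
      hence "y * x \<le> 1 + y * (y * x\<^sup>2)" by (simp add: power2_eq_square algebra_simps)
      hence "x \<le> 1 / y + y * x\<^sup>2" using y by (simp add: field_simps)
      thus "norm (d n t) \<le> (1/2) ^ n + 2 ^ n * (cmod (d n t))\<^sup>2" using y by (simp add: x_def y_def)
    qed
    hence "convergent (\<lambda>n. \<Sum>m<n. d m t)" by (simp add: summable_iff_convergent)
    moreover have "(\<Sum>m<n. d m t) = s n t - s 0 t" for n
      unfolding d_def by (rule sum_lessThan_telescope)
    ultimately have "convergent (\<lambda>n. (s n t - s 0 t) + s 0 t)"
      by (intro convergent_add convergent_const) simp
    hence "convergent (\<lambda>n. s n t)" by simp
    thus ?case unfolding f_def by (simp add: convergent_LIMSEQ_iff)
  qed
  have main: "(\<integral>\<^sup>+t. ennreal ((cmod (f t - exp_sum e c F t))\<^sup>2) \<partial>?M) \<le> ennreal (K * (1/4) ^ m)"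
    if F: "finite F" "F \<subseteq> I" "A m \<subseteq> F" for F m
  proof (rule Fatou_sq[where h = "\<lambda>n t. s n t - exp_sum e c F t" and m = m])
    show "AE t in ?M. (\<lambda>n. s n t - exp_sum e c F t) \<longlonglongrightarrow> f t - exp_sum e c F t"
      using lim by eventually_elim (intro tendsto_intros)
    fix n assume "n \<ge> m"
    thus "(\<integral>\<^sup>+t. ennreal ((cmod (s n t - exp_sum e c F t))\<^sup>2) \<partial>?M) \<le> ennreal (K * (1/4) ^ m)"
      unfolding s_def using A F by (intro diff) auto
  qed measurable
  have sqd: "square_integrable T (\<lambda>t. f t - exp_sum e c (A 0) t)"
    unfolding square_integrable_def
  proof (intro conjI integrableI_bounded)
    have "(\<integral>\<^sup>+t. ennreal ((cmod (f t - exp_sum e c (A 0) t))\<^sup>2) \<partial>?M) \<le> ennreal (K * (1/4) ^ 0)"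
      by (rule main) (use A in auto)
    also have "\<dots> < \<infinity>" by simp
    finally show "(\<integral>\<^sup>+t. ennreal (norm ((cmod (f t - exp_sum e c (A 0) t))\<^sup>2)) \<partial>?M) < \<infinity>" by simp
  qed measurable
  have sf: "square_integrable T f"
    using square_integrable_add(1)[OF sqd square_integrable_exp_sum[of T e c "A 0"]] by simp
  have "((\<lambda>F. \<integral>t. (cmod (f t - exp_sum e c F t))\<^sup>2 \<partial>?M) \<longlongrightarrow> 0) (finite_subsets_at_top I)"
  proof (rule tendstoI)
    fix \<epsilon> :: real assume \<epsilon>: "\<epsilon> > 0"
    have "(\<lambda>m. K * (1/4) ^ m) \<longlonglongrightarrow> K * 0" by (intro tendsto_intros LIMSEQ_power_zero) auto
    hence "eventually (\<lambda>m. K * (1/4) ^ m < \<epsilon>) sequentially" using \<epsilon> by (intro order_tendstoD(2)) auto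
    then obtain m where m: "K * (1/4) ^ m < \<epsilon>" by (auto simp: eventually_sequentially)
    have "dist (\<integral>t. (cmod (f t - exp_sum e c F t))\<^sup>2 \<partial>?M) 0 < \<epsilon>"
      if F: "finite F" "F \<subseteq> I" "A m \<subseteq> F" for F
    proof -
      have "(\<integral>t. (cmod (f t - exp_sum e c F t))\<^sup>2 \<partial>?M)
          = enn2real (\<integral>\<^sup>+t. ennreal ((cmod (f t - exp_sum e c F t))\<^sup>2) \<partial>?M)"
        by (rule integral_eq_nn_integral) (auto, measurable)
      also have "\<dots> \<le> enn2real (ennreal (K * (1/4) ^ m))"
        using main[OF F] by (intro enn2real_mono) auto
      also have "\<dots> = K * (1/4) ^ m" using K by simp
      finally show ?thesis using m by (simp add: integral_nonneg)
    qed
    thus "eventually (\<lambda>F. dist (\<integral>t. (cmod (f t - exp_sum e c F t))\<^sup>2 \<partial>?M) 0 < \<epsilon>) (finite_subsets_at_top I)"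
      unfolding eventually_finite_subsets_at_top using A(1,2)[of m]
      by (intro exI[of _ "A m"] conjI allI impI) auto
  qed
  thus "\<exists>f. has_L2_sum T (\<lambda>k t. c k * exp (e k * of_real t)) I f"
    using sf unfolding has_L2_sum_def exp_sum_def by (intro exI[of _ f] conjI)
qed

text \<open>
  The inequality for finite sums passes to the limit because both sides are continuous under mean
  square convergence; comparing \<open>f + g\<close> with its partial sums by \<open>|x + y|\<^sup>2 \<le> 2 |x|\<^sup>2 + 2 |y|\<^sup>2\<close>
  costs a factor \<open>2\<close>. The limits in the two index sets are taken one after the other.
\<close>

lemma L2_sum_lower_bound:
  assumes obs: "observable (case_sum lam \<gamma>) (Inl ` A \<union> Inr ` B) T"
    and W: "\<And>k. k \<in> B \<Longrightarrow> - W \<le> Re (\<gamma> k)" and K: "\<And>k. k \<in> A \<Longrightarrow> Re (lam k) \<le> K" and T: "T \<ge> 0"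
  shows "\<exists>C>0. \<forall>a b f g. ell2_on A a \<longrightarrow> ell2_on B b \<longrightarrow>
     has_L2_sum T (\<lambda>k t. a k * exp (lam k * of_real t)) A f \<longrightarrow>
     has_L2_sum T (\<lambda>k t. b k * exp (\<gamma> k * of_real t)) B g \<longrightarrow>
     C * ((\<Sum>\<^sub>\<infinity>k\<in>A. (cmod (a k))\<^sup>2 * exp (2 * Re (lam k) * T)) + (\<Sum>\<^sub>\<infinity>k\<in>B. (cmod (b k))\<^sup>2))
      \<le> (\<integral>t. (cmod (f t + g t))\<^sup>2 \<partial>lebesgue_on {0..T})"
proof -
  let ?M = "lebesgue_on {0..T}"
  let ?e = "case_sum lam \<gamma>"
  obtain C where C: "C > 0" "\<And>F c. finite F \<Longrightarrow> F \<subseteq> Inl ` A \<union> Inr ` B \<Longrightarrow>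
     C * (\<Sum>i\<in>F. (cmod (c i))\<^sup>2 * exp (2 * Re (?e i) * T)) \<le> energy (exp_sum ?e c F) 0 T"
    using obs unfolding observable_def by blast
  define m where "m = min 1 (exp (- (2 * W * T)))"
  have m: "m > 0" "m \<le> 1" by (auto simp: m_def)
  have main: "C * m / 2 * ((\<Sum>\<^sub>\<infinity>k\<in>A. (cmod (a k))\<^sup>2 * exp (2 * Re (lam k) * T)) + (\<Sum>\<^sub>\<infinity>k\<in>B. (cmod (b k))\<^sup>2))
      \<le> (\<integral>t. (cmod (f t + g t))\<^sup>2 \<partial>?M)"
    if ab: "ell2_on A a" "ell2_on B b"
      and f: "has_L2_sum T (\<lambda>k t. a k * exp (lam k * of_real t)) A f"
      and g: "has_L2_sum T (\<lambda>k t. b k * exp (\<gamma> k * of_real t)) B g" for a b f g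
  proof -
    define J where "J = (\<integral>t. (cmod (f t + g t))\<^sup>2 \<partial>?M)"
    define p where "p = (\<lambda>F. \<integral>t. (cmod (f t - exp_sum lam a F t))\<^sup>2 \<partial>?M)"
    define q where "q = (\<lambda>F. \<integral>t. (cmod (g t - exp_sum \<gamma> b F t))\<^sup>2 \<partial>?M)"
    define x where "x = (\<lambda>k. (cmod (a k))\<^sup>2 * exp (2 * Re (lam k) * T))"
    define y where "y = (\<lambda>k. (cmod (b k))\<^sup>2)"
    have sf: "square_integrable T f" and p0: "(p \<longlongrightarrow> 0) (finite_subsets_at_top A)"
      using f unfolding has_L2_sum_def p_def exp_sum_def by auto
    have sg: "square_integrable T g" and q0: "(q \<longlongrightarrow> 0) (finite_subsets_at_top B)"
      using g unfolding has_L2_sum_def q_def exp_sum_def by auto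
    have est: "C * m * (sum x F1 + sum y F2) \<le> 2 * J + 4 * p F1 + 4 * q F2"
      if F: "finite F1" "F1 \<subseteq> A" "finite F2" "F2 \<subseteq> B" for F1 F2
    proof -
      define c where "c = case_sum a b"
      let ?F = "Inl ` F1 \<union> Inr ` F2"
      let ?s = "exp_sum lam a F1" and ?r = "exp_sum \<gamma> b F2"
      have Fs: "exp_sum ?e c ?F t = ?s t + ?r t" for t
        using exp_sum_case_sum[OF F(1,3), of lam \<gamma> c] by (simp add: c_def)
      have ss: "square_integrable T (\<lambda>t. - ?s t)" "square_integrable T (\<lambda>t. - ?r t)"
        by (intro square_integrable_minus square_integrable_exp_sum)+
      note fs = square_integrable_add(1)[OF sf ss(1)]
      note gr = square_integrable_add(1)[OF sg ss(2)]
      note fg = square_integrable_add(1)[OF sf sg]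
      note d = square_integrable_add[OF fs gr]
      have "energy (exp_sum ?e c ?F) 0 T = (\<integral>t. (cmod (?s t + ?r t))\<^sup>2 \<partial>?M)"
        unfolding integral_exp_sum_eq_energy [symmetric] Fs ..
      also have "\<dots> = (\<integral>t. (cmod ((f t + g t) + - ((f t + - ?s t) + (g t + - ?r t))))\<^sup>2 \<partial>?M)"
        by (simp add: algebra_simps)
      also have "\<dots> \<le> 2 * J + 2 * (\<integral>t. (cmod (- ((f t + - ?s t) + (g t + - ?r t))))\<^sup>2 \<partial>?M)"
        unfolding J_def by (rule square_integrable_add(2)[OF fg square_integrable_minus[OF d(1)]])
      also have "\<dots> \<le> 2 * J + 2 * (2 * p F1 + 2 * q F2)"
        using d(2) unfolding p_def q_def norm_minus_cancel by simp
      finally have 1: "energy (exp_sum ?e c ?F) 0 T \<le> 2 * J + 4 * p F1 + 4 * q F2" by simp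
      have "C * (\<Sum>i\<in>?F. (cmod (c i))\<^sup>2 * exp (2 * Re (?e i) * T)) \<le> energy (exp_sum ?e c ?F) 0 T"
        using F by (intro C(2)) auto
      moreover have "(\<Sum>i\<in>?F. (cmod (c i))\<^sup>2 * exp (2 * Re (?e i) * T))
         = sum x F1 + (\<Sum>k\<in>F2. (cmod (b k))\<^sup>2 * exp (2 * Re (\<gamma> k) * T))"
        using F by (subst sum.union_disjoint) (auto simp: sum.reindex c_def x_def)
      moreover have "m * (sum x F1 + sum y F2) \<le> sum x F1 + (\<Sum>k\<in>F2. (cmod (b k))\<^sup>2 * exp (2 * Re (\<gamma> k) * T))"
        unfolding distrib_left
      proof (rule add_mono)
        have "sum x F1 \<ge> 0" by (intro sum_nonneg) (auto simp: x_def)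
        thus "m * sum x F1 \<le> sum x F1" using m by (simp add: mult_left_le_one_le)
        show "m * sum y F2 \<le> (\<Sum>k\<in>F2. (cmod (b k))\<^sup>2 * exp (2 * Re (\<gamma> k) * T))"
          unfolding sum_distrib_left y_def
        proof (rule sum_mono)
          fix k assume "k \<in> F2"
          hence "- W * T \<le> Re (\<gamma> k) * T" using W F T by (intro mult_right_mono) auto
          hence "- (2 * W * T) \<le> 2 * Re (\<gamma> k) * T" by linarith
          hence "exp (- (2 * W * T)) \<le> exp (2 * Re (\<gamma> k) * T)" by (simp only: exp_le_cancel_iff)
          hence "m \<le> exp (2 * Re (\<gamma> k) * T)" unfolding m_def by linarith
          thus "m * (cmod (b k))\<^sup>2 \<le> (cmod (b k))\<^sup>2 * exp (2 * Re (\<gamma> k) * T)"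
            by (subst mult.commute) (rule mult_left_mono, auto)
        qed
      qed
      ultimately have "C * (m * (sum x F1 + sum y F2)) \<le> energy (exp_sum ?e c ?F) 0 T"
        using C(1) by (smt (verit) mult_left_mono)
      thus ?thesis using 1 by (simp add: mult.assoc)
    qed
    have sy: "y summable_on B" using ab(2) unfolding ell2_on_def y_def .
    have sx: "x summable_on A"
    proof (rule summable_on_comparison_test)
      show "(\<lambda>k. exp (2 * \<bar>K\<bar> * T) * (cmod (a k))\<^sup>2) summable_on A"
        using ab(1) unfolding ell2_on_def by (rule summable_on_cmult_right)
      fix k assume "k \<in> A"
      hence "Re (lam k) * T \<le> \<bar>K\<bar> * T" using K[of k] T by (intro mult_right_mono) auto
      thus "x k \<le> exp (2 * \<bar>K\<bar> * T) * (cmod (a k))\<^sup>2"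
        unfolding x_def by (subst mult.commute) (rule mult_right_mono, auto)
    qed (auto simp: x_def)
    have tx: "(sum x \<longlongrightarrow> infsum x A) (finite_subsets_at_top A)" by (rule infsum_tendsto[OF sx])
    have ty: "(sum y \<longlongrightarrow> infsum y B) (finite_subsets_at_top B)" by (rule infsum_tendsto[OF sy])
    have "C * m * (infsum x A + sum y F2) \<le> 2 * J + 4 * 0 + 4 * q F2" if F2: "finite F2" "F2 \<subseteq> B" for F2
    proof (rule tendsto_le)
      show "((\<lambda>F1. C * m * (sum x F1 + sum y F2)) \<longlongrightarrow> C * m * (infsum x A + sum y F2)) (finite_subsets_at_top A)"
        by (intro tendsto_intros tx)
      show "((\<lambda>F1. 2 * J + 4 * p F1 + 4 * q F2) \<longlongrightarrow> 2 * J + 4 * 0 + 4 * q F2) (finite_subsets_at_top A)"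
        by (intro tendsto_intros p0)
      show "eventually (\<lambda>F1. C * m * (sum x F1 + sum y F2) \<le> 2 * J + 4 * p F1 + 4 * q F2) (finite_subsets_at_top A)"
        using est F2 by (intro eventually_finite_subsets_at_top_weakI) auto
    qed simp
    note est2 = this
    have "C * m * (infsum x A + infsum y B) \<le> 2 * J + 4 * 0 + 4 * 0"
    proof (rule tendsto_le)
      show "((\<lambda>F2. C * m * (infsum x A + sum y F2)) \<longlongrightarrow> C * m * (infsum x A + infsum y B)) (finite_subsets_at_top B)"
        by (intro tendsto_intros ty)
      show "((\<lambda>F2. 2 * J + 4 * 0 + 4 * q F2) \<longlongrightarrow> 2 * J + 4 * 0 + 4 * 0) (finite_subsets_at_top B)"
        by (intro tendsto_intros q0)
      show "eventually (\<lambda>F2. C * m * (infsum x A + sum y F2) \<le> 2 * J + 4 * 0 + 4 * q F2) (finite_subsets_at_top B)"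
        using est2 by (intro eventually_finite_subsets_at_top_weakI) auto
    qed simp
    thus ?thesis unfolding J_def x_def y_def by simp
  qed
  show ?thesis using main C m by (intro exI[of _ "C * m / 2"]) auto
qed

section \<open>The parabolic-hyperbolic inequality\<close>

text \<open>
  The squared norms of the exponentials are at most \<open>1 / (2 |Re (\<lambda> k)|)\<close>, which is summable, so
  the Cauchy-Schwarz inequality suffices.
\<close>

lemma bessel_parabolic:
  fixes lam :: "nat \<Rightarrow> complex"
  assumes "r > 1" "c1 > 0" "N \<ge> 1" "T \<ge> 0"
    and lower: "\<And>k. k \<ge> N \<Longrightarrow> c1 * real k powr r \<le> - Re (lam k)"
  shows "bessel lam {N..} T"
proof -
  have sm: "summable (\<lambda>k. 1 / (2 * c1) * real k powr (- r))"
    using assms by (intro summable_mult) (simp add: summable_real_powr_iff)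
  define S where "S = (\<Sum>k. 1 / (2 * c1) * real k powr (- r))"
  have S: "S \<ge> 0" unfolding S_def using assms by (intro suminf_nonneg[OF sm]) auto
  have "energy (exp_sum lam c F) 0 T \<le> S * (\<Sum>k\<in>F. (cmod (c k))\<^sup>2)" if F: "finite F" "F \<subseteq> {N..}" for F c
  proof -
    let ?B = "\<Sum>k\<in>F. (cmod (c k))\<^sup>2"
    have ex: "((\<lambda>t. exp (2 * Re (lam k) * t)) has_integral
        (exp (2 * Re (lam k) * T) / (2 * Re (lam k)) - exp (2 * Re (lam k) * 0) / (2 * Re (lam k)))) {0..T}"
      and le: "exp (2 * Re (lam k) * T) / (2 * Re (lam k)) - exp (2 * Re (lam k) * 0) / (2 * Re (lam k))
        \<le> 1 / (2 * c1) * real k powr (- r)" if k: "k \<in> F" for k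
    proof -
      have k1: "real k > 0" "k \<ge> N" using k F assms by (auto simp: Suc_le_eq subset_iff)
      have pos: "c1 * real k powr r > 0" using assms k1 by simp
      have neg: "Re (lam k) < 0" using lower[OF k1(2)] pos by linarith
      show "((\<lambda>t. exp (2 * Re (lam k) * t)) has_integral
        (exp (2 * Re (lam k) * T) / (2 * Re (lam k)) - exp (2 * Re (lam k) * 0) / (2 * Re (lam k)))) {0..T}"
        using assms neg
        by (intro fundamental_theorem_of_calculus)
          (auto intro!: derivative_eq_intros simp: has_real_derivative_iff_has_vector_derivative [symmetric])
      have "exp (2 * Re (lam k) * T) / (2 * Re (lam k)) \<le> 0"
        using neg by (intro divide_nonneg_nonpos) auto
      moreover have "- (1 / (2 * Re (lam k))) \<le> 1 / (2 * (c1 * real k powr r))"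
      proof -
        have "1 / (2 * (- Re (lam k))) \<le> 1 / (2 * (c1 * real k powr r))"
          using lower[OF k1(2)] pos by (intro frac_le) (simp_all del: zero_less_mult_iff)
        thus ?thesis by simp
      qed
      moreover have "1 / (2 * c1) * real k powr (- r) = 1 / (2 * (c1 * real k powr r))"
        by (simp add: powr_minus divide_simps)
      ultimately show "exp (2 * Re (lam k) * T) / (2 * Re (lam k)) - exp (2 * Re (lam k) * 0) / (2 * Re (lam k))
        \<le> 1 / (2 * c1) * real k powr (- r)" by simp
    qed
    have "energy (exp_sum lam c F) 0 T \<le> integral {0..T} (\<lambda>t. ?B * (\<Sum>k\<in>F. exp (2 * Re (lam k) * t)))"
      unfolding energy_def
    proof (intro integral_le energy_integrable integrable_continuous_real continuous_intros)
      fix t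
      have "(cmod (exp_sum lam c F t))\<^sup>2 \<le> ?B * (\<Sum>k\<in>F. (cmod (exp (lam k * of_real t)))\<^sup>2)"
        unfolding exp_sum_def by (rule sq_cmod_sum_le)
      thus "(cmod (exp_sum lam c F t))\<^sup>2 \<le> ?B * (\<Sum>k\<in>F. exp (2 * Re (lam k) * t))"
        by (simp add: exp_double [symmetric] mult.assoc)
    qed
    also have "\<dots> = ?B * (\<Sum>k\<in>F. exp (2 * Re (lam k) * T) / (2 * Re (lam k)) - exp (2 * Re (lam k) * 0) / (2 * Re (lam k)))"
      by (intro integral_unique has_integral_mult_right has_integral_sum F ex)
    also have "\<dots> \<le> ?B * (\<Sum>k\<in>F. 1 / (2 * c1) * real k powr (- r))"
      by (intro mult_left_mono sum_mono le sum_nonneg) auto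
    also have "\<dots> \<le> ?B * S"
      unfolding S_def using assms F by (intro mult_left_mono sum_le_suminf[OF sm] sum_nonneg) auto
    finally show ?thesis by (simp add: mult.commute)
  qed
  thus ?thesis using S unfolding bessel_def by blast
qed

text \<open>
  Because of this, a gap \<open>\<delta> |k\<^sup>r - j\<^sup>r|\<close> between exponents is a uniform gap \<open>\<delta>\<close>.
\<close>

lemma powr_gap:
  fixes r :: real and j k :: nat
  assumes "r > 1" "1 \<le> j" "j < k"
  shows "real j powr r + 1 \<le> real k powr r"
proof -
  have j1: "real j \<ge> 1" and jk: "real j + 1 \<le> real k" using assms by linarith+
  have pj: "real j powr (r - 1) \<ge> 1" using j1 assms by (intro ge_one_powr_ge_zero) auto
  have e: "real m powr r = real m * real m powr (r - 1)" if "real m > 0" for m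
    using that powr_add[of "real m" 1 "r - 1"] by simp
  have "real j powr r + 1 \<le> real j * real j powr (r - 1) + real j powr (r - 1)"
    using e[of j] j1 pj by simp
  also have "\<dots> = (real j + 1) * real j powr (r - 1)" by (simp add: distrib_right)
  also have "\<dots> \<le> real k * real k powr (r - 1)"
    using jk j1 assms by (intro mult_mono powr_mono2) auto
  also have "\<dots> = real k powr r" using e[of k] j1 jk by simp
  finally show ?thesis .
qed

theorem proposition1p6:
  fixes lam :: "nat \<Rightarrow> complex" and \<gamma> \<nu> :: "int \<Rightarrow> complex" and \<beta> :: complex
    and N :: nat and A\<^sub>0 B\<^sub>0 \<delta> \<epsilon> c r T :: real
  assumes N: "N \<ge> 1"
    and gamma_inj: "\<And>k j. k \<noteq> j \<Longrightarrow> \<gamma> k \<noteq> \<gamma> j"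
    and gamma_asymp: "\<And>k. \<bar>k\<bar> \<ge> int N \<Longrightarrow>
           \<gamma> k = \<beta> + 2 * of_int k * of_real pi * \<i> + \<nu> k"
    and nu_ell2: "ell2_on {k. \<bar>k\<bar> \<ge> int N} \<nu>"
    and constants: "A\<^sub>0 \<ge> 0" "\<delta> > 0" "B\<^sub>0 \<ge> \<delta>" "\<epsilon> > 0" "c > 0" "r > 1"
    and lam_inj: "\<And>k j. k \<ge> 1 \<Longrightarrow> j \<ge> 1 \<Longrightarrow> k \<noteq> j \<Longrightarrow> lam k \<noteq> lam j"
    and lam_sector: "\<And>k. k \<ge> N \<Longrightarrow> - Re (lam k) \<ge> c * \<bar>Im (lam k)\<bar>"
    and lam_gap: "\<And>k j. k \<ge> N \<Longrightarrow> j \<ge> N \<Longrightarrow> k \<noteq> j \<Longrightarrow>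
           cmod (lam k - lam j) \<ge> \<delta> * \<bar>real k powr r - real j powr r\<bar>"
    and lam_lower: "\<And>k. k \<ge> N \<Longrightarrow> \<epsilon> * (A\<^sub>0 + B\<^sub>0 * real k powr r) \<le> cmod (lam k)"
    and lam_upper: "\<And>k. k \<ge> N \<Longrightarrow> cmod (lam k) \<le> A\<^sub>0 + B\<^sub>0 * real k powr r"
    and disjoint: "range \<gamma> \<inter> lam ` {1..} = {}"
    and T: "T > 1"
  shows "\<exists>C>0. \<forall>(a :: nat \<Rightarrow> complex) (b :: int \<Rightarrow> complex).
    ell2_on {1..} a \<longrightarrow> ell2_on UNIV b \<longrightarrow>
      (\<exists>f. has_L2_sum T (\<lambda>k t. a k * exp (lam k * of_real t)) {1..} f) \<and>
      (\<exists>g. has_L2_sum T (\<lambda>k t. b k * exp (\<gamma> k * of_real t)) UNIV g) \<and>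
      (\<forall>f g. has_L2_sum T (\<lambda>k t. a k * exp (lam k * of_real t)) {1..} f \<longrightarrow>
             has_L2_sum T (\<lambda>k t. b k * exp (\<gamma> k * of_real t)) UNIV g \<longrightarrow>
        (\<integral>t. (cmod (f t + g t))\<^sup>2 \<partial>lebesgue_on {0..T}) \<ge>
          C * ((\<Sum>\<^sub>\<infinity>k\<in>{1..}. (cmod (a k))\<^sup>2 * exp (2 * Re (lam k) * T)) +
               (\<Sum>\<^sub>\<infinity>k\<in>UNIV. (cmod (b k))\<^sup>2)))"
proof -
  have B0: "B\<^sub>0 > 0" using constants by linarith
  define D where "D = {k::int. \<bar>k\<bar> \<ge> int N}"
  \<comment> \<open>in the sector, \<open>|\<lambda> k|\<close> is at most \<open>1 + 1 / c\<close> times \<open>- Re (\<lambda> k)\<close>\<close>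
  define c1 where "c1 = \<epsilon> * B\<^sub>0 / (1 + 1 / c)"
  define c2 where "c2 = A\<^sub>0 + B\<^sub>0"
  have c1: "c1 > 0" unfolding c1_def using constants B0 by (intro divide_pos_pos mult_pos_pos add_pos_pos) auto
  have kr: "1 \<le> real k powr r" if "k \<ge> N" for k
    using that N constants by (intro ge_one_powr_ge_zero) auto
  have upper: "- Re (lam k) \<le> c2 * real k powr r" if k: "k \<ge> N" for k
  proof -
    have "- Re (lam k) \<le> cmod (lam k)" using abs_Re_le_cmod[of "lam k"] by linarith
    also have "\<dots> \<le> A\<^sub>0 * 1 + B\<^sub>0 * real k powr r" using lam_upper[OF k] by simp
    also have "\<dots> \<le> A\<^sub>0 * real k powr r + B\<^sub>0 * real k powr r"
      using kr[OF k] constants by (intro add_right_mono mult_left_mono) auto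
    finally show ?thesis by (simp add: c2_def distrib_right)
  qed
  have lower: "c1 * real k powr r \<le> - Re (lam k)" if k: "k \<ge> N" for k
  proof -
    define x where "x = - Re (lam k)"
    have sec: "c * \<bar>Im (lam k)\<bar> \<le> x" using lam_sector[OF k] by (simp add: x_def)
    hence "x \<ge> 0" using constants by (smt (verit) mult_nonneg_nonneg)
    hence "cmod (lam k) \<le> x + \<bar>Im (lam k)\<bar>"
      using cmod_le[of "lam k"] by (simp add: x_def)
    also have "\<bar>Im (lam k)\<bar> \<le> x / c" using sec constants by (simp add: field_simps)
    finally have "cmod (lam k) \<le> x * (1 + 1 / c)" by (simp add: distrib_left)
    moreover have "\<epsilon> * (0 + B\<^sub>0 * real k powr r) \<le> \<epsilon> * (A\<^sub>0 + B\<^sub>0 * real k powr r)"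
      using constants by (intro mult_left_mono add_right_mono) auto
    ultimately have "\<epsilon> * B\<^sub>0 * real k powr r \<le> x * (1 + 1 / c)"
      using lam_lower[OF k] by simp
    moreover have "1 + 1 / c > 0" using constants by (intro add_pos_pos) auto
    ultimately show ?thesis unfolding c1_def x_def by (simp add: pos_divide_le_eq)
  qed
  have gap: "\<delta> \<le> cmod (lam k - lam j)" if kj: "k \<ge> N" "j \<ge> N" "k \<noteq> j" for k j
  proof -
    have "1 \<le> \<bar>real k powr r - real j powr r\<bar>"
    proof (cases "j < k")
      case True
      thus ?thesis using powr_gap[of r j k] True kj N constants by simp
    next
      case False
      hence "k < j" using kj(3) by linarith
      thus ?thesis using powr_gap[of r k j] kj N constants by simp
    qed
    hence "\<delta> * 1 \<le> \<delta> * \<bar>real k powr r - real j powr r\<bar>" using constants by (intro mult_left_mono) auto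
    thus ?thesis using lam_gap[OF kj] by linarith
  qed
  have gD: "\<gamma> k = line_freq \<beta> k + \<nu> k" if "k \<in> D" for k
    using gamma_asymp that by (simp add: D_def line_freq_def)
  have gN: "\<gamma> k = line_freq \<beta> k + \<nu> k" if "\<bar>k\<bar> \<ge> int N" for k
    using gamma_asymp[OF that] by (simp add: line_freq_def)
  have nuD: "ell2_on D \<nu>" using nu_ell2 by (simp add: D_def)
  have Dfin: "finite (- D)"
    by (rule finite_subset[of _ "{- int N..int N}"]) (auto simp: D_def)
  obtain V where V: "V \<ge> 0" "\<And>k. k \<in> D \<Longrightarrow> cmod (\<nu> k) \<le> V"
    using ell2_on_bounded[OF nuD] by blast
  define K where "K = cmod \<beta> + V + (\<Sum>k\<in>- D. cmod (\<gamma> k)) + (\<Sum>k<N. cmod (lam k))"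
  have K0: "(\<Sum>k\<in>- D. cmod (\<gamma> k)) \<ge> 0" "(\<Sum>k<N. cmod (lam k)) \<ge> 0" by (intro sum_nonneg; simp)+
  have gK: "\<bar>Re (\<gamma> k)\<bar> \<le> K" for k
  proof (cases "k \<in> D")
    case True
    have "\<bar>Re (\<gamma> k)\<bar> \<le> \<bar>Re \<beta>\<bar> + \<bar>Re (\<nu> k)\<bar>" using gD[OF True] by (simp add: line_freq_def)
    thus ?thesis unfolding K_def
      using V(2)[OF True] abs_Re_le_cmod[of \<beta>] abs_Re_le_cmod[of "\<nu> k"] K0 by linarith
  next
    case False
    have "cmod (\<gamma> k) \<le> (\<Sum>k\<in>- D. cmod (\<gamma> k))" using False Dfin by (intro member_le_sum) auto
    thus ?thesis unfolding K_def
      using abs_Re_le_cmod[of "\<gamma> k"] K0(2) V(1) norm_ge_zero[of \<beta>] by linarith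
  qed
  have lK: "Re (lam k) \<le> K" for k
  proof (cases "k < N")
    case True
    have "cmod (lam k) \<le> (\<Sum>k<N. cmod (lam k))" using True by (intro member_le_sum) auto
    thus ?thesis unfolding K_def
      using abs_Re_le_cmod[of "lam k"] K0(1) V(1) norm_ge_zero[of \<beta>] by linarith
  next
    case False
    have "0 \<le> c1 * real k powr r" using c1 by simp
    hence "Re (lam k) \<le> 0" using lower[of k] False by linarith
    thus ?thesis unfolding K_def using K0 V(1) norm_ge_zero[of \<beta>] by linarith
  qed
  let ?e = "case_sum lam \<gamma>"
  have bl: "bessel lam {1..} T"
  proof -
    have "{1..} = {N..} \<union> {1..<N}" using N by auto
    thus ?thesis using bessel_Un[OF bessel_parabolic[OF constants(6) c1 N _ lower] bessel_finite] T by simp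
  qed
  have bg: "bessel \<gamma> UNIV T"
  proof -
    have "bessel \<gamma> D T" by (rule bessel_hyperbolic[OF gD nuD]) (use T in auto)
    from bessel_Un[OF this bessel_finite[OF Dfin]] show ?thesis by (simp add: Compl_partition)
  qed
  define I where "I = Inl ` {1..} \<union> range (Inr :: int \<Rightarrow> nat + int)"
  have be: "bessel ?e I T"
    unfolding I_def using bl bg by (intro bessel_Un bessel_reindex) auto
  have fin: "finite {i \<in> I. cmod (?e i) \<le> R}" for R
  proof -
    have "finite {k. cmod (lam k) \<le> R}"
    proof (rule finite_subset)
      show "{k. cmod (lam k) \<le> R} \<subseteq> {..max N (nat \<lceil>R / c1\<rceil>)}"
      proof
        fix k assume k: "k \<in> {k. cmod (lam k) \<le> R}"
        show "k \<in> {..max N (nat \<lceil>R / c1\<rceil>)}"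
        proof (cases "k \<ge> N")
          case True
          have "real k = real k powr 1" using True N by simp
          also have "\<dots> \<le> real k powr r" using True N constants by (intro powr_mono) auto
          finally have "c1 * real k \<le> c1 * real k powr r" using c1 by simp
          also have "\<dots> \<le> R" using lower[OF True] abs_Re_le_cmod[of "lam k"] k by simp
          finally have "real k \<le> R / c1" using c1 by (simp add: field_simps)
          thus ?thesis by (simp add: le_max_iff_disj) linarith
        qed simp
      qed
    qed simp
    moreover have "finite {k. cmod (\<gamma> k) \<le> R}"
    proof (rule finite_subset)
      define Q where "Q = R + cmod \<beta> + V"
      show "{k. cmod (\<gamma> k) \<le> R} \<subseteq> - D \<union> {- \<lceil>Q\<rceil>..\<lceil>Q\<rceil>}"
      proof
        fix k assume k: "k \<in> {k. cmod (\<gamma> k) \<le> R}"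
        show "k \<in> - D \<union> {- \<lceil>Q\<rceil>..\<lceil>Q\<rceil>}"
        proof (cases "k \<in> D")
          case True
          have "2 * of_int k * of_real pi * \<i> = \<gamma> k - \<beta> - \<nu> k" using gD[OF True] by (simp add: line_freq_def)
          hence "cmod (2 * of_int k * of_real pi * \<i>) \<le> cmod (\<gamma> k) + cmod \<beta> + cmod (\<nu> k)"
            using norm_triangle_ineq4[of "\<gamma> k - \<beta>" "\<nu> k"] norm_triangle_ineq4[of "\<gamma> k" \<beta>] by simp
          hence "2 * pi * \<bar>real_of_int k\<bar> \<le> Q" using k V(2)[OF True] by (simp add: norm_mult Q_def mult_ac)
          moreover have "1 * \<bar>real_of_int k\<bar> \<le> 2 * pi * \<bar>real_of_int k\<bar>"
            using pi_ge_two by (intro mult_right_mono) auto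
          ultimately have "\<bar>real_of_int k\<bar> \<le> Q" by linarith
          thus ?thesis by (simp add: abs_le_iff) linarith
        qed simp
      qed
    qed (use Dfin in simp)
    ultimately have "finite (Inl ` {k. cmod (lam k) \<le> R} \<union> Inr ` {k. cmod (\<gamma> k) \<le> R})" by simp
    thus ?thesis by (rule finite_subset[rotated]) (auto simp: I_def)
  qed
  have inj: "inj_on ?e I"
  proof (rule inj_onI)
    fix x y assume xy: "x \<in> I" "y \<in> I" "?e x = ?e y"
    have dis: "\<gamma> k \<noteq> lam j" if "j \<ge> 1" for k j using disjoint that by auto
    show "x = y"
    proof (cases x; cases y)
      fix k j assume "x = Inl k" "y = Inl j"
      thus ?thesis using xy lam_inj[of k j] by (auto simp: I_def)
    next
      fix k j assume "x = Inl k" "y = Inr j"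
      thus ?thesis using xy dis[of k j] by (auto simp: I_def)
    next
      fix k j assume "x = Inr k" "y = Inl j"
      thus ?thesis using xy dis[of j k] by (auto simp: I_def)
    next
      fix k j assume "x = Inr k" "y = Inr j"
      thus ?thesis using xy gamma_inj[of k j] by auto
    qed
  qed
  \<comment> \<open>the tail is observed in time \<open>T0 > 1\<close>; the time left over pays for the remaining exponents\<close>
  define T0 where "T0 = (1 + T) / 2"
  have T0: "1 < T0" "T0 < T" using T by (auto simp: T0_def)
  have "\<exists>M\<ge>N. observable ?e (Inl ` {M..} \<union> Inr ` {k. \<bar>k\<bar> \<ge> int M}) T0"
    by (rule tail_observable[of r c1 \<delta> N T0 lam c2 \<gamma> \<beta> \<nu>]) (fact constants c1 N T0 lower upper gap gN nu_ell2)+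
  then obtain M where M: "M \<ge> N" "observable ?e (Inl ` {M..} \<union> Inr ` {k. \<bar>k\<bar> \<ge> int M}) T0" by blast
  have "finite {k::int. \<bar>k\<bar> < int M}"
    by (rule finite_subset[of _ "{- int M..int M}"]) auto
  hence fJ: "finite (Inl ` {1..<M} \<union> Inr ` {k::int. \<bar>k\<bar> < int M})" by simp
  have split: "I = (Inl ` {M..} \<union> Inr ` {k. \<bar>k\<bar> \<ge> int M}) \<union> (Inl ` {1..<M} \<union> Inr ` {k. \<bar>k\<bar> < int M})"
  proof (rule set_eqI)
    fix x show "x \<in> I \<longleftrightarrow> x \<in> (Inl ` {M..} \<union> Inr ` {k. \<bar>k\<bar> \<ge> int M}) \<union> (Inl ` {1..<M} \<union> Inr ` {k. \<bar>k\<bar> < int M})"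
      using N M(1) by (cases x) (auto simp: I_def image_iff)
  qed
  have obs: "observable ?e I T"
    unfolding split
  proof (rule observable_Un_finite[OF fJ _ T0(2) M(2)])
    fix i assume "i \<in> (Inl ` {M..} \<union> Inr ` {k. \<bar>k\<bar> \<ge> int M}) \<union> (Inl ` {1..<M} \<union> Inr ` {k. \<bar>k\<bar> < int M})"
    show "Re (?e i) \<le> K" using lK gK by (cases i) (auto simp: abs_le_iff)
  next
    show "0 \<le> T0" using T0 by simp
    show "(Inl ` {M..} \<union> Inr ` {k. \<bar>k\<bar> \<ge> int M}) \<inter> (Inl ` {1..<M} \<union> Inr ` {k. \<bar>k\<bar> < int M}) = {}"
      by auto
  qed (fact be[unfolded split] fin[unfolded split] inj[unfolded split])+
  have "\<exists>C>0. \<forall>a b f g. ell2_on {1..} a \<longrightarrow> ell2_on UNIV b \<longrightarrow>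
     has_L2_sum T (\<lambda>k t. a k * exp (lam k * of_real t)) {1..} f \<longrightarrow>
     has_L2_sum T (\<lambda>k t. b k * exp (\<gamma> k * of_real t)) UNIV g \<longrightarrow>
     C * ((\<Sum>\<^sub>\<infinity>k\<in>{1..}. (cmod (a k))\<^sup>2 * exp (2 * Re (lam k) * T)) + (\<Sum>\<^sub>\<infinity>k\<in>UNIV. (cmod (b k))\<^sup>2))
      \<le> (\<integral>t. (cmod (f t + g t))\<^sup>2 \<partial>lebesgue_on {0..T})"
  proof (rule L2_sum_lower_bound)
    show "observable ?e (Inl ` {1..} \<union> range Inr) T" using obs unfolding I_def .
    show "- K \<le> Re (\<gamma> k)" for k using gK[of k] by linarith
  qed (use lK T in auto)
  thus ?thesis using Riesz_Fischer[OF bl] Riesz_Fischer[OF bg] by meson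
qed

end
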